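(* Let $A$ be a lower semi-bounded self-adjoint operator on a Hilbert space $X$. Let $\phi\in\mathcal{X}^2_{\mathrm{loc}}$ and suppose that for some $\beta>0$ $$\|(\nabla_t^2-A)\phi(t)\|_X\le\beta\|\phi(t)\|_X\quad\text{for all }t>0.$$ If $\phi$ satisfies $$\int_0^\infty e^{2\lambda t^{4/3}}\|\phi(t)\|_X^2\,dt<+\infty$$ for all $\lambda>0$, then $\phi\equiv0$.
   Context: $\mathbb{R}_+=(0,+\infty)$ and $\nabla_t$ denotes differentiation with respect to $t$. For $j=0,1,2$ set $X_j=\mathrm{Dom}(|A|^{j/2})\subseteq X$ (so $X_2=\mathrm{Dom}(A)$, $X_1$ is the form domain of $A$, $X_0=X$); for $j=1,2$, $X_j$ is made a Hilbert space via the isomorphism $|A|^{j/2}+I:X_j\to X$. Set $$\mathcal{X}^2_{\mathrm{loc}}=L^2_{\mathrm{loc}}(\mathbb{R}_+,X_2)\cap H^1_{\mathrm{loc}}(\mathbb{R}_+,X_1)\cap H^2_{\mathrm{loc}}(\mathbb{R}_+,X),\qquad \mathcal{X}^0_{\mathrm{loc}}=L^2_{\mathrm{loc}}(\mathbb{R}_+,X),$$ so that $\nabla_t^2-A$ maps $\mathcal{X}^2_{\mathrm{loc}}\to\mathcal{X}^0_{\mathrm{loc}}$. Here "loc" refers to compact subsets of the open half-line $\mathbb{R}_+$. Pointwise inequalities in $t$ between $L^2_{\mathrm{loc}}$ functions are understood for almost every $t$. *)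

theory Defs
  imports "HOL-Analysis.Analysis"
begin

section \<open>Unbounded operators\<close>

text \<open>
  An unbounded operator is represented by its graph, so that equality of operators includes
  equality of domains, and the composition of operators (with its maximal domain) is relational
  composition. Hilbert spaces are types of sort \<open>{real_inner, complete_space}\<close>, with no
  separability assumption. Complex Hilbert spaces are covered by restriction of scalars: with the
  inner product Re \<open>\<langle>x,y\<rangle>\<close>, the adjoint of a complex-linear operator is the same as for the
  complex inner product, hence so are self-adjointness, semi-boundedness, the modulus and the
  square root.
\<close>

type_synonym 'a oper = "('a \<times> 'a) set"

definition op_app :: "'a oper \<Rightarrow> 'a \<Rightarrow> 'a" where
  "op_app A x = (THE y. (x, y) \<in> A)"

definition densely_defined_operator :: "'a::real_normed_vector oper \<Rightarrow> bool" where
  "densely_defined_operator A \<longleftrightarrow> subspace A \<and> single_valued A \<and> closure (Domain A) = UNIV"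

definition op_adjoint :: "'a::real_inner oper \<Rightarrow> 'a oper" where
  "op_adjoint A = {(y, z). \<forall>(x, w) \<in> A. w \<bullet> y = x \<bullet> z}"

definition self_adjoint :: "'a::real_inner oper \<Rightarrow> bool" where
  "self_adjoint A \<longleftrightarrow> densely_defined_operator A \<and> op_adjoint A = A"

definition lower_semibounded :: "'a::real_inner oper \<Rightarrow> bool" where
  "lower_semibounded A \<longleftrightarrow> (\<exists>c. \<forall>(x, y) \<in> A. c * (norm x)\<^sup>2 \<le> y \<bullet> x)"

definition nonneg_operator :: "'a::real_inner oper \<Rightarrow> bool" where
  "nonneg_operator A \<longleftrightarrow> (\<forall>(x, y) \<in> A. 0 \<le> y \<bullet> x)"

text \<open>
  The description below is proper whenever \<open>T\<close> is self-adjoint and nonnegative.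
\<close>

definition op_sqrt :: "'a::real_inner oper \<Rightarrow> 'a oper" where
  "op_sqrt T = (THE S. self_adjoint S \<and> nonneg_operator S \<and> S O S = T)"

text \<open>
  The modulus is the square root of \<open>A\<^sup>*A\<close>; relational composition applies its left argument first.
\<close>

definition op_abs :: "'a::real_inner oper \<Rightarrow> 'a oper" where
  "op_abs A = op_sqrt (A O op_adjoint A)"

text \<open>
  \<open>|A|\<close> to the power \<open>j/2\<close>, as the \<open>j\<close>-th relational power of its square root
  (the identity on the whole space for \<open>j = 0\<close>).
\<close>

definition abs_half_power :: "'a::real_inner oper \<Rightarrow> nat \<Rightarrow> 'a oper" where
  "abs_half_power A j = op_sqrt (op_abs A) ^^ j"

section \<open>Bochner integration without separability\<close>

text \<open>
  The library constant \<^const>\<open>has_bochner_integral\<close> demands a second countable target type. The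
  following is the same definition for arbitrary normed spaces, with Borel measurability replaced
  by strong measurability.
\<close>

definition strongly_measurable :: "'m measure \<Rightarrow> ('m \<Rightarrow> 'a::real_normed_vector) \<Rightarrow> bool" where
  "strongly_measurable M f \<longleftrightarrow>
     (\<exists>s. (\<forall>i::nat. simple_function M (s i)) \<and> (AE x in M. (\<lambda>i. s i x) \<longlonglongrightarrow> f x))"

definition has_bochner_int :: "'m measure \<Rightarrow> ('m \<Rightarrow> 'a::real_normed_vector) \<Rightarrow> 'a \<Rightarrow> bool" where
  "has_bochner_int M f v \<longleftrightarrow> strongly_measurable M f \<and>
     (\<exists>s. (\<forall>i::nat. Bochner_Integration.simple_bochner_integrable M (s i)) \<and>
          (\<lambda>i. \<integral>\<^sup>+x. ennreal (norm (f x - s i x)) \<partial>M) \<longlonglongrightarrow> 0 \<and>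
          (\<lambda>i. Bochner_Integration.simple_bochner_integral M (s i)) \<longlonglongrightarrow> v)"

section \<open>Local Sobolev spaces on the open half-line\<close>

text \<open>
  Elements of these spaces are represented by functions on the reals; values outside the
  open half-line and on null sets are irrelevant.
\<close>

abbreviation half_line :: "real measure" where
  "half_line \<equiv> lebesgue_on {0<..}"

definition L2_loc :: "(real \<Rightarrow> 'a::real_normed_vector) set" where
  "L2_loc = {f. strongly_measurable half_line f \<and>
     (\<forall>K. compact K \<and> K \<subseteq> {0<..} \<longrightarrow> (\<integral>\<^sup>+t\<in>K. ennreal ((norm (f t))\<^sup>2) \<partial>lebesgue) < \<infinity>)}"

definition test_function :: "(real \<Rightarrow> real) \<Rightarrow> bool" where
  "test_function \<eta> \<longleftrightarrow> (\<forall>k t. (deriv ^^ k) \<eta> field_differentiable at t) \<and>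
     (\<exists>K. compact K \<and> K \<subseteq> {0<..} \<and> (\<forall>t. t \<notin> K \<longrightarrow> \<eta> t = 0))"

definition has_weak_deriv ::
    "nat \<Rightarrow> (real \<Rightarrow> 'a::real_normed_vector) \<Rightarrow> (real \<Rightarrow> 'a) \<Rightarrow> bool" where
  "has_weak_deriv k f g \<longleftrightarrow> (\<forall>\<eta>. test_function \<eta> \<longrightarrow>
     (\<exists>v. has_bochner_int half_line (\<lambda>t. (deriv ^^ k) \<eta> t *\<^sub>R f t) v \<and>
          has_bochner_int half_line (\<lambda>t. \<eta> t *\<^sub>R g t) ((-1) ^ k *\<^sub>R v)))"

text \<open>
  A representative of the \<open>k\<close>-th weak derivative, which is unique up to null sets.
\<close>

definition weak_deriv :: "nat \<Rightarrow> (real \<Rightarrow> 'a::real_normed_vector) \<Rightarrow> real \<Rightarrow> 'a" where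
  "weak_deriv k f = (SOME g. has_weak_deriv k f g)"

definition H_loc :: "nat \<Rightarrow> (real \<Rightarrow> 'a::real_normed_vector) set" where
  "H_loc k = {f \<in> L2_loc. \<forall>j\<in>{1..k}. \<exists>g\<in>L2_loc. has_weak_deriv j f g}"

text \<open>
  For a nonnegative self-adjoint operator \<open>B\<close>, the Hilbert space structure on its domain is
  transported from the whole space along the isomorphism \<open>B + I\<close>. Hence a domain-valued function
  \<open>f\<close> has local Sobolev regularity of order \<open>k\<close> iff \<open>(B + I) f\<close> has it.
\<close>

definition H_loc_dom :: "nat \<Rightarrow> 'a::real_inner oper \<Rightarrow> (real \<Rightarrow> 'a) set" where
  "H_loc_dom k B = {f. (AE t in half_line. f t \<in> Domain B) \<and>
                       (\<lambda>t. op_app B (f t) + f t) \<in> H_loc k}"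

definition X2_loc :: "'a::real_inner oper \<Rightarrow> (real \<Rightarrow> 'a) set" where
  "X2_loc A = H_loc_dom 0 (abs_half_power A 2) \<inter> H_loc_dom 1 (abs_half_power A 1) \<inter> H_loc 2"

end

theory Submission
  imports Defs
begin

text \<open>
  Write \<open>w = l t\<^bsup>4/3\<^esup>\<close> and \<open>u = e\<^sup>w \<phi>\<close>. In the Carleman commutator computation for
  \<open>e\<^sup>w (\<nabla>\<^sup>2 - A) e\<^bsup>-w\<^esup>\<close> the operator \<open>A\<close> drops out, and \<open>w'\<^sup>2 w''\<close> is a positive constant times
  \<open>l\<^sup>3\<close>: the exponent 4/3 is the one for which the perturbation of size \<open>\<beta>\<close> is absorbed on every
  \<open>[t\<^sub>0, \<infinity>)\<close> once \<open>l\<close> is large. No cutoff is needed: the computation says that the energy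
  \<open>w' (\<parallel>u'\<parallel>\<^sup>2 + w'\<^sup>2 \<parallel>u\<parallel>\<^sup>2 - \<langle>A u, u\<rangle>) + w'' \<langle>u', u\<rangle> - w''' \<parallel>u\<parallel>\<^sup>2 / 2\<close> is nondecreasing, while the
  semi-boundedness of \<open>A\<close> and the decay of \<open>\<phi>\<close> prevent it from becoming positive. Dividing by
  \<open>e\<^bsup>2w\<^esup> l\<^sup>3\<close> and letting \<open>l \<rightarrow> \<infinity>\<close> at a fixed time leaves a positive multiple of \<open>\<parallel>\<phi>(t)\<parallel>\<^sup>2\<close>.

  Only \<open>Dom A\<close> is needed from the description of the solution space through \<open>|A|\<^bsup>j/2\<^esup>\<close>, but it
  requires existence and uniqueness of square roots of unbounded nonnegative operators. These are
  reduced to bounded operators through the resolvent \<open>(I + T)\<^bsup>-1\<^esup>\<close>.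
\<close>


section \<open>Square roots of nonnegative self-adjoint operators\<close>

text \<open>Conjugation gives \<open>e\<^sup>w (\<nabla>\<^sup>2 - A) \<phi> = P u - S u\<close>
  with the symmetric part \<open>P u = u'' + w'\<^sup>2 u - A u\<close> and
  \<open>S u = 2 w' u' + w'' u\<close>. The derivative of the energy is \<open>\<langle>S u, P
  u\<rangle> + 2 w'' \<parallel>u'\<parallel>\<^sup>2 + (2 w'\<^sup>2 w'' - w''''/2)
  \<parallel>u\<parallel>\<^sup>2\<close>. Since \<open>P u = S u + e\<^sup>w r\<close> with
  \<open>r = (\<nabla>\<^sup>2 - A) \<phi>\<close>, the first term is at least
  \<open>- \<parallel>e\<^sup>w r\<parallel>\<^sup>2 / 4\<close>, so that only the size of
  \<open>r\<close> enters. The obstacle is regularity: \<open>A \<phi>\<close> is merely locally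
  integrable in time, so \<open>\<langle>A \<phi>, \<phi>\<rangle>\<close> cannot be differentiated
  by the product rule. Its weak derivative \<open>2 \<langle>A \<phi>, \<phi>'\<rangle>\<close>
  comes from the symmetry of \<open>A\<close>, and the lemma of du Bois-Reymond then yields an
  absolutely continuous representative, for which monotonicity of the energy makes sense. As the
  space may be nonseparable, vector-valued calculus is reduced to integrals of inner
  products.\<close>

lemma quadratic_nonneg_imp_zero:
  fixes a b :: real
  assumes "\<And>t. 0 \<le> a * t + b * t\<^sup>2"
  shows "a = 0"
proof (rule ccontr)
  assume "a \<noteq> 0"
  \<comment> \<open>Any positive \<open>c > b\<close> works: at \<open>t = - a / c\<close> the
    quadratic takes the value \<open>a\<^sup>2 * (b - c) / c\<^sup>2\<close>, which is
    negative.\<close>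
  define c where "c = 1 + \<bar>b\<bar>"
  have c: "0 < c" "b < c" by (auto simp: c_def)
  have "0 \<le> a * (- a / c) + b * (- a / c)\<^sup>2" by (rule assms)
  also have "\<dots> = a\<^sup>2 * (b - c) / c\<^sup>2"
    using c by (simp add: field_simps power2_eq_square)
  also have "\<dots> < 0"
    using \<open>a \<noteq> 0\<close> c by (intro divide_neg_pos mult_pos_neg) auto
  finally show False by simp
qed

text \<open>A minimising sequence for the distance is Cauchy by the parallelogram identity, since
  midpoints stay in \<open>S\<close> and so keep distance at least \<open>d\<close> from
  \<open>x\<close>; minimality along lines in \<open>S\<close> makes the inner products vanish.
  Besides subspaces of \<open>X\<close>, it is applied to graphs as subspaces of
  \<open>X \<times> X\<close>.\<close>

lemma orthogonal_projection_exists: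
  fixes S :: "'a::{real_inner,complete_space} set"
  assumes "closed S" "subspace S"
  obtains p where "p \<in> S" "\<And>s. s \<in> S \<Longrightarrow> (x - p) \<bullet> s = 0"
proof -
  define d where "d = infdist x S"
  have ne: "S \<noteq> {}" using subspace_0[OF assms(2)] by auto
  have dle: "d \<le> norm (x - s)" if "s \<in> S" for s
    using infdist_le[OF that, of x] by (simp add: d_def dist_norm)
  have d0: "0 \<le> d" by (simp add: d_def infdist_nonneg)
  have "\<exists>s\<in>S. norm (x - s) < d + 1 / Suc n" for n
  proof -
    have "d = Inf (dist x ` S)" using ne by (simp add: d_def infdist_def)
    then have "Inf (dist x ` S) < d + 1 / Suc n" by simp
    moreover have "bdd_below (dist x ` S)" by (intro bdd_belowI2[of _ 0]) simp
    ultimately show ?thesis using ne by (simp add: cInf_less_iff dist_norm)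
  qed
  then obtain p where pS: "\<And>n. p n \<in> S" and pn: "\<And>n. norm (x - p n) < d + 1 / Suc n" by metis
  have "(\<lambda>n. d + 1 / real (Suc n)) \<longlonglongrightarrow> d"
    using tendsto_add[OF tendsto_const LIMSEQ_inverse_real_of_nat, of d] by (simp add: inverse_eq_divide)
  then have lim: "(\<lambda>n. norm (x - p n)) \<longlonglongrightarrow> d"
    by (rule tendsto_sandwich[OF _ _ tendsto_const, rotated 2])
       (use dle pS pn less_imp_le in \<open>blast intro: always_eventually\<close>)+
  have par: "(norm (p n - p m))\<^sup>2 \<le> 2 * (norm (x - p n))\<^sup>2 + 2 * (norm (x - p m))\<^sup>2 - 4 * d\<^sup>2" for n m
  proof -
    have "(1/2) *\<^sub>R (p n + p m) \<in> S"
      using pS assms(2) by (auto intro: subspace_add subspace_scale)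
    then have "d\<^sup>2 \<le> (norm (x - (1/2) *\<^sub>R (p n + p m)))\<^sup>2" using dle d0 by (intro power_mono) auto
    moreover have "(norm (p n - p m))\<^sup>2 = 2 * (norm (x - p n))\<^sup>2 + 2 * (norm (x - p m))\<^sup>2
        - 4 * (norm (x - (1/2) *\<^sub>R (p n + p m)))\<^sup>2"
      by (simp add: power2_norm_eq_inner inner_diff inner_add algebra_simps inner_commute)
    ultimately show ?thesis by simp
  qed
  have "Cauchy p"
  proof (rule metric_CauchyI)
    fix e :: real assume e: "0 < e"
    have "(\<lambda>n. (norm (x - p n))\<^sup>2) \<longlonglongrightarrow> d\<^sup>2" by (intro tendsto_intros lim)
    moreover have "d\<^sup>2 < d\<^sup>2 + e\<^sup>2 / 4" using e by simp
    ultimately have "\<forall>\<^sub>F n in sequentially. (norm (x - p n))\<^sup>2 < d\<^sup>2 + e\<^sup>2 / 4"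
      by (rule order_tendstoD(2))
    then obtain N where N: "\<And>n. n \<ge> N \<Longrightarrow> (norm (x - p n))\<^sup>2 < d\<^sup>2 + e\<^sup>2 / 4"
      by (auto simp: eventually_sequentially)
    show "\<exists>M. \<forall>m\<ge>M. \<forall>n\<ge>M. dist (p m) (p n) < e"
    proof (intro exI allI impI)
      fix m n assume "N \<le> m" "N \<le> n"
      then have "(norm (p m - p n))\<^sup>2 < e\<^sup>2" using par[of m n] N[of m] N[of n] by linarith
      then show "dist (p m) (p n) < e" using e by (simp add: dist_norm power2_less_imp_less)
    qed
  qed
  then obtain l where l: "p \<longlonglongrightarrow> l" using Cauchy_convergent_iff convergent_def by blast
  have lS: "l \<in> S" using closed_sequentially[OF assms(1)] pS l by blast
  have "(\<lambda>n. norm (x - p n)) \<longlonglongrightarrow> norm (x - l)" by (intro tendsto_intros l)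
  then have nl: "norm (x - l) = d" using lim LIMSEQ_unique by blast
  have "(x - l) \<bullet> s = 0" if "s \<in> S" for s
  proof -
    have "0 \<le> (-2 * ((x - l) \<bullet> s)) * t + (s \<bullet> s) * t\<^sup>2" for t
    proof -
      have "l + t *\<^sub>R s \<in> S" using that lS assms(2) by (auto intro: subspace_add subspace_scale)
      then have "d\<^sup>2 \<le> (norm (x - (l + t *\<^sub>R s)))\<^sup>2" using dle d0 by (intro power_mono) auto
      then have "(norm (x - l))\<^sup>2 \<le> (norm (x - (l + t *\<^sub>R s)))\<^sup>2" using nl by simp
      also have "\<dots> = (norm (x - l))\<^sup>2 + ((-2 * ((x - l) \<bullet> s)) * t + (s \<bullet> s) * t\<^sup>2)"
        unfolding power2_norm_eq_inner
        by (simp add: inner_diff inner_add algebra_simps inner_commute power2_eq_square)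
      finally show ?thesis by simp
    qed
    then have "-2 * ((x - l) \<bullet> s) = 0" by (rule quadratic_nonneg_imp_zero)
    then show ?thesis by simp
  qed
  then show ?thesis using that lS by blast
qed

lemma subspace_closure:
  fixes S :: "'a::real_normed_vector set"
  assumes "subspace S"
  shows "subspace (closure S)"
  unfolding subspace_def
proof (intro conjI ballI allI)
  show "0 \<in> closure S" using subspace_0[OF assms] closure_subset by blast
next
  fix x y assume "x \<in> closure S" "y \<in> closure S"
  then obtain f g where "\<And>n. f n \<in> S" "f \<longlonglongrightarrow> x" "\<And>n. g n \<in> S" "g \<longlonglongrightarrow> y"
    by (auto simp: closure_sequential)
  then show "x + y \<in> closure S"
    unfolding closure_sequential using assms
    by (intro exI[of _ "\<lambda>n. f n + g n"]) (auto intro: tendsto_add subspace_add)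
next
  fix c x assume "x \<in> closure S"
  then obtain f where "\<And>n. f n \<in> S" "f \<longlonglongrightarrow> x" by (auto simp: closure_sequential)
  then show "c *\<^sub>R x \<in> closure S"
    unfolding closure_sequential using assms
    by (intro exI[of _ "\<lambda>n. c *\<^sub>R f n"]) (auto intro: tendsto_intros subspace_scale)
qed

lemma subspace_closure_eq_UNIV:
  fixes S :: "'a::{real_inner,complete_space} set"
  assumes "subspace S" and orth: "\<And>y. (\<And>s. s \<in> S \<Longrightarrow> y \<bullet> s = 0) \<Longrightarrow> y = 0"
  shows "closure S = UNIV"
proof -
  have "x \<in> closure S" for x
  proof -
    obtain p where p: "p \<in> closure S" "\<And>s. s \<in> closure S \<Longrightarrow> (x - p) \<bullet> s = 0"
      using orthogonal_projection_exists[of "closure S" x] closed_closure subspace_closure[OF assms(1)]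
      by blast
    then have "x - p = 0" using orth closure_subset by blast
    then show ?thesis using p by simp
  qed
  then show ?thesis by auto
qed

subsection \<open>Bounded operators\<close>

definition symmetric_map :: "('a::real_inner \<Rightarrow> 'a) \<Rightarrow> bool" where
  "symmetric_map f \<longleftrightarrow> (\<forall>x y. f x \<bullet> y = x \<bullet> f y)"

lemma symmetric_mapD: "symmetric_map f \<Longrightarrow> f x \<bullet> y = x \<bullet> f y"
  by (simp add: symmetric_map_def)

text \<open>
  If \<open>Q\<close> is a contraction, then these iterates converge to a solution \<open>Y\<close> of \<open>Y = (Q + Y\<^sup>2)/2\<close>,
  that is, \<open>(I - Y)\<^sup>2 = I - Q\<close>. They are dominated by the scalar iterates for \<open>Q = 1\<close>.
\<close>

fun sqrt_iter :: "('a::real_vector \<Rightarrow> 'a) \<Rightarrow> nat \<Rightarrow> 'a \<Rightarrow> 'a" where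
  "sqrt_iter Q 0 x = 0"
| "sqrt_iter Q (Suc n) x = (1/2) *\<^sub>R (Q x + sqrt_iter Q n (sqrt_iter Q n x))"

fun sqrt_iter_bound :: "nat \<Rightarrow> real" where
  "sqrt_iter_bound 0 = 0"
| "sqrt_iter_bound (Suc n) = (1 + (sqrt_iter_bound n)\<^sup>2) / 2"

lemma sqrt_iter_bound_range: "0 \<le> sqrt_iter_bound n \<and> sqrt_iter_bound n \<le> 1"
proof (induction n)
  case (Suc n)
  then have "(sqrt_iter_bound n)\<^sup>2 \<le> 1" by (simp add: power_le_one)
  then show ?case by simp
qed simp

lemma sqrt_iter_bound_Suc: "sqrt_iter_bound n \<le> sqrt_iter_bound (Suc n)"
proof -
  have "0 \<le> (1 - sqrt_iter_bound n)\<^sup>2" by simp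
  then show ?thesis by (simp add: power2_eq_square algebra_simps)
qed

lemma sqrt_iter_linear: "linear Q \<Longrightarrow> linear (sqrt_iter Q n)"
proof (induction n)
  case 0
  show ?case by (rule linearI) auto
next
  case (Suc n)
  then have "linear (sqrt_iter Q n)" by simp
  with Suc.prems show ?case
    by (intro linearI) (simp_all add: linear_add linear_scale algebra_simps)
qed

lemma sqrt_iter_commute:
  assumes "linear K" "\<And>x. K (Q x) = Q (K x)"
  shows "K (sqrt_iter Q n x) = sqrt_iter Q n (K x)"
  by (induction n arbitrary: x) (simp_all add: linear_0 linear_add linear_scale assms)

lemma sqrt_iter_symmetric:
  assumes "linear Q" "symmetric_map Q"
  shows "symmetric_map (sqrt_iter Q n)"
proof (induction n)
  case (Suc n)
  have "sqrt_iter Q (Suc n) x \<bullet> y = x \<bullet> sqrt_iter Q (Suc n) y" for x y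
    using Suc assms(2) by (simp add: symmetric_map_def inner_add)
  then show ?case by (simp only: symmetric_map_def) blast
qed (simp add: symmetric_map_def)

lemma sqrt_iter_norm:
  fixes Q :: "'a::real_normed_vector \<Rightarrow> 'a"
  assumes "\<And>x. norm (Q x) \<le> norm x"
  shows "norm (sqrt_iter Q n x) \<le> sqrt_iter_bound n * norm x"
proof (induction n arbitrary: x)
  case (Suc n)
  have "norm (sqrt_iter Q n (sqrt_iter Q n x)) \<le> sqrt_iter_bound n * norm (sqrt_iter Q n x)" by (rule Suc)
  also have "\<dots> \<le> sqrt_iter_bound n * (sqrt_iter_bound n * norm x)"
    using Suc sqrt_iter_bound_range by (intro mult_left_mono) auto
  finally have "norm (Q x + sqrt_iter Q n (sqrt_iter Q n x)) \<le> norm x + sqrt_iter_bound n * (sqrt_iter_bound n * norm x)"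
    using norm_triangle_ineq[of "Q x"] assms[of x] by (smt (verit))
  then show ?case by (simp add: power2_eq_square algebra_simps del: scaleR_right_distrib scaleR_add_right)
qed simp

text \<open>The iterates commute with each other, so the difference of two squares factors as
  \<open>Z (Z - Y) + Y (Z - Y)\<close>. The scalar recursion factors in the same way, which is why
  its increments are the right majorants.\<close>

lemma sqrt_iter_step:
  fixes Q :: "'a::real_normed_vector \<Rightarrow> 'a"
  assumes "linear Q" "\<And>x. norm (Q x) \<le> norm x"
  shows "norm (sqrt_iter Q (Suc n) x - sqrt_iter Q n x) \<le> (sqrt_iter_bound (Suc n) - sqrt_iter_bound n) * norm x"
proof (induction n arbitrary: x)
  case 0
  then show ?case using assms(2) by simp
next
  case (Suc n)
  let ?Y = "sqrt_iter Q n" and ?Z = "sqrt_iter Q (Suc n)"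
  let ?b = "sqrt_iter_bound n" and ?c = "sqrt_iter_bound (Suc n)"
  have lin: "linear ?Y" "linear ?Z" using sqrt_iter_linear assms(1) by blast+
  have "?Y (Q x) = Q (?Y x)" for x
    using sqrt_iter_commute[of Q Q n x, OF assms(1)] by simp
  then have comm: "?Y (?Z x) = ?Z (?Y x)" by (rule sqrt_iter_commute[OF lin(1)])
  have b: "0 \<le> ?b" "0 \<le> ?c" using sqrt_iter_bound_range by blast+
  have "norm (?Z (?Z x - ?Y x)) \<le> ?c * norm (?Z x - ?Y x)" "norm (?Y (?Z x - ?Y x)) \<le> ?b * norm (?Z x - ?Y x)"
    using sqrt_iter_norm[of Q, OF assms(2)] by blast+
  moreover have "?c * norm (?Z x - ?Y x) \<le> ?c * ((?c - ?b) * norm x)" "?b * norm (?Z x - ?Y x) \<le> ?b * ((?c - ?b) * norm x)"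
    using Suc b by (intro mult_left_mono; simp)+
  ultimately have "norm (?Z (?Z x - ?Y x) + ?Y (?Z x - ?Y x)) \<le> ?c * ((?c - ?b) * norm x) + ?b * ((?c - ?b) * norm x)"
    using norm_triangle_ineq[of "?Z (?Z x - ?Y x)" "?Y (?Z x - ?Y x)"] by linarith
  moreover have "sqrt_iter Q (Suc (Suc n)) x - ?Z x = (1/2) *\<^sub>R (?Z (?Z x - ?Y x) + ?Y (?Z x - ?Y x))"
  proof -
    have "sqrt_iter Q (Suc (Suc n)) x - ?Z x = (1/2) *\<^sub>R (?Z (?Z x) - ?Y (?Y x))"
      using sqrt_iter.simps(2)[of Q "Suc n" x] sqrt_iter.simps(2)[of Q n x]
      by (metis scaleR_diff_right add_diff_cancel_left)
    also have "?Z (?Z x) - ?Y (?Y x) = ?Z (?Z x - ?Y x) + ?Y (?Z x - ?Y x)"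
      by (simp only: linear_diff[OF lin(1)] linear_diff[OF lin(2)] comm) simp
    finally show ?thesis .
  qed
  moreover have "(sqrt_iter_bound (Suc (Suc n)) - ?c) * norm x = (?c * ((?c - ?b) * norm x) + ?b * ((?c - ?b) * norm x)) / 2"
  proof -
    have "sqrt_iter_bound (Suc (Suc n)) - ?c = (1 + ?c\<^sup>2) / 2 - (1 + ?b\<^sup>2) / 2"
      by (simp only: sqrt_iter_bound.simps(2))
    then show ?thesis by (simp only: power2_eq_square) (simp add: field_simps del: sqrt_iter_bound.simps)
  qed
  ultimately show ?case by (simp del: sqrt_iter.simps sqrt_iter_bound.simps)
qed

text \<open>The step bounds telescope to increments of \<open>sqrt_iter_bound\<close>, which is
  increasing and bounded by 1. This comparison converges even when \<open>Q\<close> has norm 1,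
  where a geometric series would be useless.\<close>

lemma sqrt_iter_Cauchy:
  fixes Q :: "'a::real_normed_vector \<Rightarrow> 'a"
  assumes "linear Q" "\<And>x. norm (Q x) \<le> norm x"
  shows "Cauchy (\<lambda>n. sqrt_iter Q n x)"
proof -
  have le: "norm (sqrt_iter Q (n + k) x - sqrt_iter Q n x) \<le> (sqrt_iter_bound (n + k) - sqrt_iter_bound n) * norm x" for n k
  proof (induction k)
    case (Suc k)
    have "norm (sqrt_iter Q (n + Suc k) x - sqrt_iter Q n x) \<le>
        norm (sqrt_iter Q (Suc (n + k)) x - sqrt_iter Q (n + k) x) + norm (sqrt_iter Q (n + k) x - sqrt_iter Q n x)"
      using norm_triangle_ineq[of "sqrt_iter Q (Suc (n + k)) x - sqrt_iter Q (n + k) x"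
        "sqrt_iter Q (n + k) x - sqrt_iter Q n x"] by (simp del: sqrt_iter.simps)
    also have "\<dots> \<le> (sqrt_iter_bound (Suc (n + k)) - sqrt_iter_bound (n + k)) * norm x
        + (sqrt_iter_bound (n + k) - sqrt_iter_bound n) * norm x"
      by (intro add_mono Suc sqrt_iter_step assms)
    finally show ?case by (simp add: algebra_simps del: sqrt_iter.simps sqrt_iter_bound.simps)
  qed simp
  have "incseq sqrt_iter_bound" by (intro incseq_SucI sqrt_iter_bound_Suc)
  then have "convergent sqrt_iter_bound"
    using sqrt_iter_bound_range by (intro Bseq_monoseq_convergent BseqI'[of _ 1]) (auto simp: monoseq_iff)
  then have C: "Cauchy (\<lambda>n. sqrt_iter_bound n * norm x)"
    by (intro convergent_Cauchy convergent_mult convergent_const)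
  show ?thesis
  proof (rule CauchyI')
    fix e :: real assume "0 < e"
    then obtain N where N: "\<And>m n. m \<ge> N \<Longrightarrow> n \<ge> N \<Longrightarrow> norm (sqrt_iter_bound m * norm x - sqrt_iter_bound n * norm x) < e"
      using CauchyD[OF C] by blast
    show "\<exists>M. \<forall>m\<ge>M. \<forall>n>m. dist (sqrt_iter Q m x) (sqrt_iter Q n x) < e"
    proof (intro exI allI impI)
      fix m n assume "N \<le> m" "m < n"
      then obtain k where "n = m + k" using less_imp_add_positive by blast
      with le[of m k] N[of n m] \<open>N \<le> m\<close> show "dist (sqrt_iter Q m x) (sqrt_iter Q n x) < e"
        by (simp add: dist_norm norm_minus_commute algebra_simps) 
    qed
  qed
qed

text \<open>
  A symmetric map within distance \<open>1\<close> of the identity is nonnegative; these are the operators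
  whose square roots are needed, and the class is closed under taking the root.
\<close>

definition near_id :: "('a::real_inner \<Rightarrow> 'a) \<Rightarrow> bool" where
  "near_id f \<longleftrightarrow> linear f \<and> symmetric_map f \<and> (\<forall>x. norm (x - f x) \<le> norm x)"

lemma near_id_nonneg:
  assumes "near_id f"
  shows "0 \<le> f x \<bullet> x"
proof -
  have "(x - f x) \<bullet> x \<le> norm (x - f x) * norm x" by (rule norm_cauchy_schwarz)
  also have "\<dots> \<le> norm x * norm x"
    using assms by (intro mult_right_mono) (auto simp: near_id_def)
  finally have "(x - f x) \<bullet> x \<le> x \<bullet> x" by (simp add: dot_square_norm power2_eq_square)
  then show ?thesis by (simp add: inner_diff)
qed

lemma near_id_bounded_linear:
  assumes "near_id f"
  shows "bounded_linear f"
proof (rule bounded_linear_intro)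
  fix x
  have "norm (f x) \<le> norm x + norm (x - f x)"
    using norm_triangle_ineq4[of x "x - f x"] by simp
  then show "norm (f x) \<le> norm x * 2" using assms by (auto simp: near_id_def intro: order_trans)
qed (use assms in \<open>auto simp: near_id_def linear_add linear_scale\<close>)

text \<open>With \<open>Q = I - B\<close> and \<open>Y\<close> the limit of the iterates,
  \<open>C = I - Y\<close> satisfies \<open>C\<^sup>2 = I - Q = B\<close>. The last conclusion holds
  because the iterates are polynomials in \<open>Q\<close>; it is the source of the later
  commutation relations between roots.\<close>

lemma near_id_sqrt:
  fixes B :: "'a::{real_inner,complete_space} \<Rightarrow> 'a"
  assumes "near_id B"
  obtains C where "near_id C" "\<And>x. C (C x) = B x"
    "\<And>K x. bounded_linear K \<Longrightarrow> (\<And>x. K (B x) = B (K x)) \<Longrightarrow> K (C x) = C (K x)"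
proof -
  have linB: "linear B" and symB: "symmetric_map B" using assms by (auto simp: near_id_def)
  define Q where "Q x = x - B x" for x
  have linQ: "linear Q" unfolding Q_def using linear_compose_sub[OF linear_id linB] by (simp add: id_def)
  have symQ: "symmetric_map Q" using symB by (simp add: Q_def symmetric_map_def inner_diff)
  have nQ: "norm (Q x) \<le> norm x" for x using assms by (simp add: Q_def near_id_def)
  define Y where "Y x = lim (\<lambda>n. sqrt_iter Q n x)" for x
  have Y: "(\<lambda>n. sqrt_iter Q n x) \<longlonglongrightarrow> Y x" for x
    using sqrt_iter_Cauchy[OF linQ nQ, of x] by (simp add: Y_def Cauchy_convergent_iff convergent_LIMSEQ_iff)
  have nY': "norm (sqrt_iter Q n x) \<le> norm x" for n x
    using sqrt_iter_norm[of Q n x, OF nQ] mult_right_mono[of "sqrt_iter_bound n" 1 "norm x"] sqrt_iter_bound_range[of n]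
    by auto
  have nY: "norm (Y x) \<le> norm x" for x
    by (rule Lim_bounded[OF tendsto_norm[OF Y], of 0]) (use nY' in auto)
  note lin = sqrt_iter_linear[OF linQ]
  have linY: "linear Y"
  proof (rule linearI)
    fix x y c
    have "(\<lambda>n. sqrt_iter Q n (x + y)) \<longlonglongrightarrow> Y x + Y y"
      using tendsto_add[OF Y Y] by (simp add: linear_add[OF lin])
    then show "Y (x + y) = Y x + Y y" using Y LIMSEQ_unique by blast
    have "(\<lambda>n. sqrt_iter Q n (c *\<^sub>R x)) \<longlonglongrightarrow> c *\<^sub>R Y x"
      using tendsto_scaleR[OF tendsto_const Y] by (simp add: linear_scale[OF lin])
    then show "Y (c *\<^sub>R x) = c *\<^sub>R Y x" using Y LIMSEQ_unique by blast
  qed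
  have symY: "symmetric_map Y"
    unfolding symmetric_map_def
  proof (intro allI)
    fix x y
    have "(\<lambda>n. sqrt_iter Q n x \<bullet> y) \<longlonglongrightarrow> Y x \<bullet> y" "(\<lambda>n. x \<bullet> sqrt_iter Q n y) \<longlonglongrightarrow> x \<bullet> Y y"
      by (intro tendsto_intros Y)+
    then show "Y x \<bullet> y = x \<bullet> Y y"
      using LIMSEQ_unique by (simp add: symmetric_mapD[OF sqrt_iter_symmetric[OF linQ symQ]])
  qed
  have fix_Y: "Y x = (1/2) *\<^sub>R (Q x + Y (Y x))" for x
  proof -
    \<comment> \<open>Two limits at once: every \<open>sqrt_iter Q n\<close> is a contraction, so
      its argument can be replaced by the limit at the cost
      \<open>norm (sqrt_iter Q n x - Y x)\<close>.\<close>
    have "(\<lambda>n. sqrt_iter Q n (sqrt_iter Q n x) - sqrt_iter Q n (Y x)) \<longlonglongrightarrow> 0"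
    proof (rule Lim_null_comparison)
      show "\<forall>\<^sub>F n in sequentially. norm (sqrt_iter Q n (sqrt_iter Q n x) - sqrt_iter Q n (Y x)) \<le> norm (sqrt_iter Q n x - Y x)"
        by (simp add: linear_diff[OF lin, symmetric] nY')
      show "(\<lambda>n. norm (sqrt_iter Q n x - Y x)) \<longlonglongrightarrow> 0"
        using Y[of x] by (simp add: LIM_zero_iff tendsto_norm_zero_iff)
    qed
    from tendsto_add[OF this Y[of "Y x"]]
    have "(\<lambda>n. (1/2) *\<^sub>R (Q x + sqrt_iter Q n (sqrt_iter Q n x))) \<longlonglongrightarrow> (1/2) *\<^sub>R (Q x + Y (Y x))"
      by (intro tendsto_intros) simp
    moreover have "(\<lambda>n. sqrt_iter Q (Suc n) x) \<longlonglongrightarrow> Y x" using Y LIMSEQ_Suc by blast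
    ultimately show ?thesis using LIMSEQ_unique by simp
  qed
  define C where "C x = x - Y x" for x
  show ?thesis
  proof
    have "linear C" unfolding C_def using linear_compose_sub[OF linear_id linY] by (simp add: id_def)
    moreover have "symmetric_map C" using symY by (simp add: C_def symmetric_map_def inner_diff)
    ultimately show "near_id C" using nY by (simp add: near_id_def C_def)
    show "C (C x) = B x" for x
    proof -
      have "C (C x) = x - 2 *\<^sub>R Y x + Y (Y x)"
        by (simp add: C_def linear_diff[OF linY] scaleR_2)
      also have "2 *\<^sub>R Y x = Q x + Y (Y x)" by (subst fix_Y) simp
      finally show ?thesis by (simp add: Q_def)
    qed
    show "K (C x) = C (K x)" if K: "bounded_linear K" "\<And>x. K (B x) = B (K x)" for K x
    proof -
      interpret K: bounded_linear K by fact
      have "K (Q x) = Q (K x)" for x by (simp add: Q_def K.diff K(2))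
      then have "(\<lambda>n. K (sqrt_iter Q n x)) \<longlonglongrightarrow> Y (K x)"
        using Y[of "K x"] sqrt_iter_commute[of K Q, OF K.linear] by simp
      moreover have "(\<lambda>n. K (sqrt_iter Q n x)) \<longlonglongrightarrow> K (Y x)" by (rule K.tendsto[OF Y])
      ultimately have "K (Y x) = Y (K x)" using LIMSEQ_unique by blast
      then show ?thesis by (simp add: C_def K.diff)
    qed
  qed
qed

text \<open>A root \<open>K\<close> of \<open>C\<close> commutes with \<open>D\<close>, so half of
  \<open>C\<close> can be moved to the other side: the form equals
  \<open>D (K x) \<bullet> K x\<close>.\<close>

lemma near_id_mult_nonneg:
  fixes C :: "'a::{real_inner,complete_space} \<Rightarrow> 'a"
  assumes C: "near_id C" and D: "near_id D" and comm: "\<And>x. D (C x) = C (D x)"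
  shows "0 \<le> C (D x) \<bullet> x"
proof -
  obtain K where K: "near_id K" "\<And>x. K (K x) = C x"
    "\<And>L x. bounded_linear L \<Longrightarrow> (\<And>x. L (C x) = C (L x)) \<Longrightarrow> L (K x) = K (L x)"
    using near_id_sqrt[OF C] by blast
  have "C (D x) \<bullet> x = D (K x) \<bullet> K x"
    using K(1) K(3)[OF near_id_bounded_linear[OF D] comm, of x]
    by (simp add: K(2)[symmetric] near_id_def symmetric_map_def)
  then show ?thesis using near_id_nonneg[OF D] by simp
qed

text \<open>Along \<open>y + t F y\<close> the nonnegative form of \<open>F\<close> has no constant
  term, so its linear coefficient \<open>2 \<parallel>F y\<parallel>\<^sup>2\<close> must be
  zero.\<close>

lemma nonneg_symmetric_null:
  assumes "linear F" "symmetric_map F" "\<And>x. 0 \<le> F x \<bullet> x" "F y \<bullet> y = 0"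
  shows "F y = 0"
proof -
  have "0 \<le> (2 * (F y \<bullet> F y)) * t + (F (F y) \<bullet> F y) * t\<^sup>2" for t
  proof -
    have "0 \<le> F (y + t *\<^sub>R F y) \<bullet> (y + t *\<^sub>R F y)" by (rule assms)
    also have "\<dots> = (2 * (F y \<bullet> F y)) * t + (F (F y) \<bullet> F y) * t\<^sup>2"
      using assms(4) symmetric_mapD[OF assms(2), of "F y" y]
      by (simp add: linear_add[OF assms(1)] linear_scale[OF assms(1)] inner_add power2_eq_square algebra_simps)
    finally show ?thesis .
  qed
  then have "2 * (F y \<bullet> F y) = 0" by (rule quadratic_nonneg_imp_zero)
  then show ?thesis by simp
qed

text \<open>For \<open>y = (F - G) x\<close>, commutation gives
  \<open>(F + G) y = (F\<^sup>2 - G\<^sup>2) x = 0\<close>. Both nonnegative forms then vanish at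
  \<open>y\<close>, hence \<open>F y = G y = 0\<close>, and \<open>\<parallel>y\<parallel>\<^sup>2 =
  \<langle>x, (F - G) y\<rangle> = 0\<close>.\<close>

lemma nonneg_sqrt_unique:
  assumes F: "linear F" "symmetric_map F" "\<And>x. 0 \<le> F x \<bullet> x"
    and G: "linear G" "symmetric_map G" "\<And>x. 0 \<le> G x \<bullet> x"
    and comm: "\<And>x. F (G x) = G (F x)" and sq: "\<And>x. F (F x) = G (G x)"
  shows "F x = G x"
proof -
  define y where "y = F x - G x"
  have "F y + G y = 0"
    by (simp add: y_def linear_diff[OF F(1)] linear_diff[OF G(1)] comm sq)
  then have "F y \<bullet> y + G y \<bullet> y = 0" by (metis inner_add_left inner_zero_left)
  then have "F y \<bullet> y = 0" "G y \<bullet> y = 0" using F(3)[of y] G(3)[of y] by linarith+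
  then have "F y = 0" "G y = 0" using nonneg_symmetric_null F G by blast+
  moreover have "y \<bullet> y = x \<bullet> (F y - G y)"
    by (subst (1) y_def) (simp add: inner_diff symmetric_mapD[OF F(2)] symmetric_mapD[OF G(2)])
  ultimately show ?thesis by (simp add: y_def)
qed

subsection \<open>Unbounded operators\<close>

definition symmetric_operator :: "'a::real_inner oper \<Rightarrow> bool" where
  "symmetric_operator T \<longleftrightarrow> (\<forall>(x, y) \<in> T. \<forall>(u, v) \<in> T. y \<bullet> u = x \<bullet> v)"

lemma symmetric_operatorD: "symmetric_operator T \<Longrightarrow> (x, y) \<in> T \<Longrightarrow> (u, v) \<in> T \<Longrightarrow> y \<bullet> u = x \<bullet> v"
  unfolding symmetric_operator_def by blast

lemma nonneg_operatorD: "nonneg_operator T \<Longrightarrow> (x, y) \<in> T \<Longrightarrow> 0 \<le> y \<bullet> x"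
  unfolding nonneg_operator_def by blast

lemma op_subspaceD:
  assumes "subspace (T :: 'a::real_vector oper)"
  shows "(x, y) \<in> T \<Longrightarrow> (u, v) \<in> T \<Longrightarrow> (x + u, y + v) \<in> T"
    "(x, y) \<in> T \<Longrightarrow> (u, v) \<in> T \<Longrightarrow> (x - u, y - v) \<in> T"
    "(x, y) \<in> T \<Longrightarrow> (c *\<^sub>R x, c *\<^sub>R y) \<in> T"
    "(0, 0) \<in> T"
  using subspace_add[OF assms, of "(x, y)" "(u, v)"] subspace_diff[OF assms, of "(x, y)" "(u, v)"]
    subspace_scale[OF assms, of "(x, y)" c] subspace_0[OF assms] by (auto simp: zero_prod_def)

lemma op_subspaceI:
  assumes "(0, 0) \<in> T" "\<And>x y u v. (x, y) \<in> T \<Longrightarrow> (u, v) \<in> T \<Longrightarrow> (x + u, y + v) \<in> T"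
    "\<And>c x y. (x, y) \<in> T \<Longrightarrow> (c *\<^sub>R x, c *\<^sub>R y) \<in> T"
  shows "subspace (T :: 'a::real_vector oper)"
  using assms by (auto simp: subspace_def zero_prod_def)

section \<open>Elementary facts on graphs of self-adjoint operators\<close>

lemma self_adjoint_symmetric: "self_adjoint T \<Longrightarrow> symmetric_operator T"
  unfolding self_adjoint_def symmetric_operator_def op_adjoint_def by (smt (verit) case_prod_conv mem_Collect_eq split_beta)

lemma self_adjoint_subspace: "self_adjoint T \<Longrightarrow> subspace T"
  by (simp add: self_adjoint_def densely_defined_operator_def)

lemma self_adjoint_unique: "self_adjoint T \<Longrightarrow> (x, y) \<in> T \<Longrightarrow> (x, z) \<in> T \<Longrightarrow> y = z"
  by (auto simp: self_adjoint_def densely_defined_operator_def single_valued_def)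

lemma self_adjointI_adjoint:
  assumes "self_adjoint T" "\<And>u v. (u, v) \<in> T \<Longrightarrow> v \<bullet> x = u \<bullet> y"
  shows "(x, y) \<in> T"
proof -
  have "(x, y) \<in> op_adjoint T" using assms(2) by (auto simp: op_adjoint_def)
  then show ?thesis using assms(1) by (simp add: self_adjoint_def)
qed

lemma subspace_Domain:
  assumes "subspace (T :: 'a::real_vector oper)"
  shows "subspace (Domain T)"
proof -
  have "linear (fst :: 'a \<times> 'a \<Rightarrow> 'a)" by (intro linearI) auto
  then show ?thesis using linear_subspace_image[OF _ assms] by (auto simp: Domain_fst)
qed

lemma self_adjoint_closed:
  assumes "self_adjoint T"
  shows "closed T"
proof -
  have "closed {p. v \<bullet> fst p = u \<bullet> snd p}" for u v :: 'a
    by (intro closed_Collect_eq continuous_intros)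
  then have "closed (\<Inter>(u, v)\<in>T. {p. v \<bullet> fst p = u \<bullet> snd p})" by (intro closed_INT) auto
  also have "(\<Inter>(u, v)\<in>T. {p. v \<bullet> fst p = u \<bullet> snd p}) = op_adjoint T"
    by (auto simp: op_adjoint_def)
  finally show ?thesis using assms by (simp add: self_adjoint_def)
qed

lemma self_adjoint_closedD:
  assumes "self_adjoint T" "\<And>n. (x n, y n) \<in> T" "x \<longlonglongrightarrow> u" "y \<longlonglongrightarrow> v"
  shows "(u, v) \<in> T"
  using closed_sequentially[OF self_adjoint_closed[OF assms(1)], of "\<lambda>n. (x n, y n)"] assms(2-)
  by (auto intro: tendsto_Pair)

text \<open>Single-valuedness comes for free: if \<open>(0, d)\<close> lies in a symmetric graph,
  then \<open>d\<close> is orthogonal to the dense domain.\<close>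

lemma self_adjoint_intro:
  fixes T :: "'a::{real_inner,complete_space} oper"
  assumes "subspace T" "symmetric_operator T" "closure (Domain T) = UNIV"
    and "\<And>x y. (x, y) \<in> op_adjoint T \<Longrightarrow> (x, y) \<in> T"
  shows "self_adjoint T"
proof -
  have "single_valued T"
  proof (rule single_valuedI)
    fix x y z assume "(x, y) \<in> T" "(x, z) \<in> T"
    then have "(0, y - z) \<in> T" using op_subspaceD(2)[OF assms(1)] by fastforce
    then have *: "(y - z) \<bullet> u = 0" if "u \<in> Domain T" for u
      using symmetric_operatorD[OF assms(2)] that by fastforce
    obtain s where "\<And>n. s n \<in> Domain T" "s \<longlonglongrightarrow> y - z"
      using assms(3) closure_sequential by (metis UNIV_I)
    then have "(\<lambda>n. (y - z) \<bullet> s n) \<longlonglongrightarrow> (y - z) \<bullet> (y - z)" by (intro tendsto_intros)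
    then have "(y - z) \<bullet> (y - z) = 0" using * \<open>\<And>n. s n \<in> Domain T\<close> by (simp add: LIMSEQ_const_iff)
    then show "y = z" by simp
  qed
  moreover have "op_adjoint T = T"
    using assms(2,4) by (auto simp: op_adjoint_def symmetric_operator_def)
  ultimately show ?thesis using assms by (simp add: self_adjoint_def densely_defined_operator_def)
qed

text \<open>Surjectivity of \<open>I + T\<close> leaves no room for a larger adjoint: if
  \<open>(y, z)\<close> is in the adjoint and \<open>x + T x = y + z\<close>, then
  \<open>y - x\<close> is orthogonal to the range of \<open>I + T\<close>. Density of the domain
  follows by solving \<open>z + T z = y\<close> for \<open>y\<close> orthogonal to it: nonnegativity
  forces \<open>z = 0\<close>.\<close>

lemma self_adjoint_if_onto:
  fixes T :: "'a::{real_inner,complete_space} oper"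
  assumes "subspace T" "symmetric_operator T" "nonneg_operator T"
    and zero: "\<And>y. (0, y) \<in> T \<Longrightarrow> y = 0" and onto: "\<And>h. \<exists>x. (x, h - x) \<in> T"
  shows "self_adjoint T"
proof (rule self_adjoint_intro[OF assms(1,2)])
  show "closure (Domain T) = UNIV"
  proof (rule subspace_closure_eq_UNIV[OF subspace_Domain[OF assms(1)]])
    fix y assume y: "\<And>s. s \<in> Domain T \<Longrightarrow> y \<bullet> s = 0"
    obtain z where z: "(z, y - z) \<in> T" using onto by blast
    then have "y \<bullet> z = 0" "0 \<le> (y - z) \<bullet> z" using y nonneg_operatorD[OF assms(3)] by blast+
    then have "z = 0" using inner_ge_zero[of z] by (simp add: inner_diff)
    with z zero show "y = 0" by simp
  qed
  fix y z assume yz: "(y, z) \<in> op_adjoint T"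
  obtain x where x: "(x, y + z - x) \<in> T" using onto by blast
  have "w \<bullet> (y - x) = - (u \<bullet> (y - x))" if "(u, w) \<in> T" for u w
    using yz symmetric_operatorD[OF assms(2) that x] that by (auto simp: op_adjoint_def inner_diff inner_add)
  moreover obtain u where "(u, y - x - u) \<in> T" using onto by blast
  ultimately have "(y - x - u) \<bullet> (y - x) = - (u \<bullet> (y - x))" by blast
  then have "(y - x) \<bullet> (y - x) = 0" by (simp add: inner_diff)
  then have "y - x = 0" by (simp only: inner_eq_zero_iff)
  then have "y = x" by simp
  then show "(y, z) \<in> T" using x by simp
qed

text \<open>Von Neumann's argument: the graph is closed, so \<open>(h, 0)\<close> can be projected
  onto it. Orthogonality of the residual \<open>(h - x, - y)\<close> to the graph says that
  \<open>(y, h - x)\<close> lies in the adjoint, which is \<open>A\<close> itself.\<close>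

lemma square_onto:
  fixes A :: "'a::{real_inner,complete_space} oper"
  assumes A: "self_adjoint A"
  shows "\<exists>x. (x, h - x) \<in> A O A"
proof -
  obtain p where p: "p \<in> A" "\<And>s. s \<in> A \<Longrightarrow> ((h, 0) - p) \<bullet> s = 0"
    using orthogonal_projection_exists[OF self_adjoint_closed[OF A] self_adjoint_subspace[OF A]] by blast
  obtain x y where xy: "p = (x, y)" by fastforce
  have "(y, h - x) \<in> A"
  proof (rule self_adjointI_adjoint[OF A])
    fix u v assume "(u, v) \<in> A"
    then show "v \<bullet> y = u \<bullet> (h - x)" using p(2)[of "(u, v)"] by (simp add: xy inner_diff inner_commute)
  qed
  then show ?thesis using p xy by blast
qed

lemma self_adjoint_square:
  fixes A :: "'a::{real_inner,complete_space} oper"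
  assumes A: "self_adjoint A"
  shows "self_adjoint (A O A)" "nonneg_operator (A O A)"
proof -
  note sub = self_adjoint_subspace[OF A] and sym = symmetric_operatorD[OF self_adjoint_symmetric[OF A]]
  show nn: "nonneg_operator (A O A)"
  proof (unfold nonneg_operator_def, safe)
    fix x y z assume "(x, y) \<in> A" "(y, z) \<in> A"
    then have "z \<bullet> x = y \<bullet> y" using sym by blast
    then show "0 \<le> z \<bullet> x" by simp
  qed
  show "self_adjoint (A O A)"
  proof (rule self_adjoint_if_onto[OF _ _ nn _ square_onto[OF A]])
    show "subspace (A O A)"
      by (rule op_subspaceI) (blast intro: op_subspaceD[OF sub])+
    show "symmetric_operator (A O A)"
      unfolding symmetric_operator_def using sym by (smt (verit) case_prodI2 relcompE prod.inject)
    show "y = 0" if "(0, y) \<in> A O A" for y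
      using that self_adjoint_unique[OF A] op_subspaceD(4)[OF sub] by blast
  qed
qed

text \<open>The estimate \<open>\<parallel>x\<parallel> \<le> \<parallel>x + T x\<parallel>\<close>
  does double duty: it makes the range of \<open>I + T\<close> closed, and it annihilates a vector
  \<open>y\<close> orthogonal to the range, for which \<open>(y, - y)\<close> lies in the adjoint,
  hence in \<open>T\<close>.\<close>

lemma one_plus_onto:
  fixes T :: "'a::{real_inner,complete_space} oper"
  assumes T: "self_adjoint T" and nn: "nonneg_operator T"
  shows "\<exists>x. (x, h - x) \<in> T"
proof -
  note sub = self_adjoint_subspace[OF T]
  define R where "R = (\<lambda>(x, y). x + y) ` T"
  have R_iff: "h \<in> R \<longleftrightarrow> (\<exists>x. (x, h - x) \<in> T)" for h
  proof
    show "h \<in> R \<Longrightarrow> \<exists>x. (x, h - x) \<in> T" by (auto simp: R_def) (metis add_diff_cancel_left')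
    assume "\<exists>x. (x, h - x) \<in> T"
    then obtain x where "(x, h - x) \<in> T" by blast
    then show "h \<in> R" unfolding R_def by (rule image_eqI[rotated]) simp
  qed
  have "linear (\<lambda>p :: 'a \<times> 'a. fst p + snd p)" by (intro linearI) (auto simp: algebra_simps)
  then have subR: "subspace R"
    using linear_subspace_image[OF _ sub] by (simp add: R_def split_beta')
  have ineq: "norm x \<le> norm (x + y)" if "(x, y) \<in> T" for x y
  proof -
    have "(norm x)\<^sup>2 \<le> (norm (x + y))\<^sup>2"
      using nonneg_operatorD[OF nn that] inner_ge_zero[of y]
      unfolding power2_norm_eq_inner by (simp add: inner_add inner_commute)
    then show ?thesis by (rule power2_le_imp_le) simp
  qed
  have "closed R"
    unfolding closed_sequential_limits
  proof (intro allI impI, elim conjE)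
    fix r l assume "\<forall>n. r n \<in> R" and l: "r \<longlonglongrightarrow> l"
    then have "\<forall>n. \<exists>x. (x, r n - x) \<in> T" by (simp add: R_iff)
    then obtain x where x: "\<And>n. (x n, r n - x n) \<in> T" by metis
    have "Cauchy x"
    proof (rule metric_CauchyI)
      fix e :: real assume "0 < e"
      then obtain M where M: "\<And>m n. m \<ge> M \<Longrightarrow> n \<ge> M \<Longrightarrow> dist (r m) (r n) < e"
        using metric_CauchyD[OF LIMSEQ_imp_Cauchy[OF l]] by blast
      have "dist (x m) (x n) \<le> dist (r m) (r n)" for m n
        using ineq[OF op_subspaceD(2)[OF sub x[of m] x[of n]]] by (simp add: dist_norm algebra_simps)
      then show "\<exists>M. \<forall>m\<ge>M. \<forall>n\<ge>M. dist (x m) (x n) < e" using M le_less_trans by blast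
    qed
    then obtain u where u: "x \<longlonglongrightarrow> u" using Cauchy_convergent_iff convergent_def by blast
    have "(u, l - u) \<in> T" by (rule self_adjoint_closedD[OF T x u]) (intro tendsto_intros l u)
    then show "l \<in> R" by (auto simp: R_iff)
  qed
  moreover have "closure R = UNIV"
  proof (rule subspace_closure_eq_UNIV[OF subR])
    fix y assume y: "\<And>s. s \<in> R \<Longrightarrow> y \<bullet> s = 0"
    have "(y, - y) \<in> T"
    proof (rule self_adjointI_adjoint[OF T])
      fix u v assume "(u, v) \<in> T"
      then have "y \<bullet> (u + v) = 0" using y by (force simp: R_def)
      then show "v \<bullet> y = u \<bullet> - y" by (simp add: inner_add inner_commute)
    qed
    from ineq[OF this] show "y = 0" by simp
  qed
  ultimately have "h \<in> R" by (simp add: closure_closed)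
  then show ?thesis by (simp add: R_iff)
qed

text \<open>Nonnegativity bounds both \<open>\<parallel>x\<parallel>\<close> and
  \<open>\<parallel>T x\<parallel>\<close> by \<open>\<parallel>x + T x\<parallel>\<close>. For the
  resolvent \<open>B\<close> these are the \<open>near_id\<close> bounds for \<open>I - B\<close>
  and for \<open>B\<close> respectively, so that both have roots by
  \<open>near_id_sqrt\<close>.\<close>

lemma resolvent_exists:
  fixes T :: "'a::{real_inner,complete_space} oper"
  assumes T: "self_adjoint T" and nn: "nonneg_operator T"
  obtains B where "near_id B" "near_id (\<lambda>x. x - B x)" "\<And>h. (B h, h - B h) \<in> T"
    "\<And>x y. (x, y) \<in> T \<Longrightarrow> B (x + y) = x"
proof -
  note sub = self_adjoint_subspace[OF T] and sym = symmetric_operatorD[OF self_adjoint_symmetric[OF T]]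
  obtain B where B: "\<And>h. (B h, h - B h) \<in> T" using one_plus_onto[OF T nn] by metis
  have ineq: "norm x \<le> norm (x + y) \<and> norm y \<le> norm (x + y)" if "(x, y) \<in> T" for x y
  proof -
    have "(norm x)\<^sup>2 \<le> (norm (x + y))\<^sup>2" "(norm y)\<^sup>2 \<le> (norm (x + y))\<^sup>2"
      using nonneg_operatorD[OF nn that] inner_ge_zero[of y] inner_ge_zero[of x]
      unfolding power2_norm_eq_inner by (simp_all add: inner_add inner_commute)
    then show ?thesis by (auto intro: power2_le_imp_le)
  qed
  have inv: "B (x + y) = x" if "(x, y) \<in> T" for x y
  proof -
    have "(B (x + y) - x, - (B (x + y) - x)) \<in> T"
      using op_subspaceD(2)[OF sub B[of "x + y"] that] by (simp add: algebra_simps)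
    from ineq[OF this] show ?thesis by simp
  qed
  have lin: "linear B"
  proof (rule linearI)
    fix x y c
    show "B (x + y) = B x + B y"
      using inv[OF op_subspaceD(1)[OF sub B[of x] B[of y]]] by (simp add: algebra_simps)
    show "B (c *\<^sub>R x) = c *\<^sub>R B x"
      using inv[OF op_subspaceD(3)[OF sub B[of x], of c]] by (simp add: algebra_simps)
  qed
  have symB: "symmetric_map B"
    unfolding symmetric_map_def using sym[OF B B] by (simp add: inner_diff inner_commute)
  have norms: "norm (B x) \<le> norm x" "norm (x - B x) \<le> norm x" for x
    using ineq[OF B[of x]] by auto
  show ?thesis
  proof
    show "near_id B" using lin symB norms by (simp add: near_id_def)
    have "linear (\<lambda>x. x - B x)" using linear_compose_sub[OF linear_id lin] by (simp add: id_def)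
    then show "near_id (\<lambda>x. x - B x)" using symB norms by (simp add: near_id_def symmetric_map_def inner_diff)
  qed (use B inv in auto)
qed

text \<open>
  With \<open>B = (I + T)\<^bsup>-1\<^esup>\<close>, \<open>C\<^sup>2 = B\<close> and \<open>D\<^sup>2 = I - B\<close>, a square root of \<open>T\<close> is the graph \<open>{(C y, D y)}\<close>.
  Any other root \<open>S\<close> is recovered from the bounded operator \<open>F = S B\<close>, the nonnegative root
  of \<open>B (I - B)\<close>, as \<open>{(x, y). F x = B y}\<close>.
\<close>

lemma op_sqrt_exists:
  fixes T :: "'a::{real_inner,complete_space} oper"
  assumes T: "self_adjoint T" and nn: "nonneg_operator T"
  shows "\<exists>!S. self_adjoint S \<and> nonneg_operator S \<and> S O S = T"
proof -
  obtain B where B: "near_id B" "near_id (\<lambda>x. x - B x)" "\<And>h. (B h, h - B h) \<in> T"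
    "\<And>x y. (x, y) \<in> T \<Longrightarrow> B (x + y) = x"
    using resolvent_exists[OF assms] by blast
  interpret B: bounded_linear B by (rule near_id_bounded_linear[OF B(1)])
  obtain C where C: "near_id C" "\<And>x. C (C x) = B x"
    "\<And>K x. bounded_linear K \<Longrightarrow> (\<And>x. K (B x) = B (K x)) \<Longrightarrow> K (C x) = C (K x)"
    using near_id_sqrt[OF B(1)] by blast
  obtain D where D: "near_id D" "\<And>x. D (D x) = x - B x"
    "\<And>K x. bounded_linear K \<Longrightarrow> (\<And>x. K (x - B x) = K x - B (K x)) \<Longrightarrow> K (D x) = D (K x)"
    using near_id_sqrt[OF B(2)] by blast
  note C_bl = near_id_bounded_linear[OF C(1)] and D_bl = near_id_bounded_linear[OF D(1)]
  interpret C: bounded_linear C by (rule C_bl)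
  interpret D: bounded_linear D by (rule D_bl)
  have symC: "symmetric_map C" and symD: "symmetric_map D" using C D by (auto simp: near_id_def)
  have "B (D x) = D (B x)" for x
    using D(3)[OF B.bounded_linear_axioms, of x] by (simp add: B.diff)
  then have CD: "C (D x) = D (C x)" for x using C(3)[OF D_bl] by simp
  have B0: "y = 0" if "B y = 0" for y
    using B(3)[of y] that self_adjoint_unique[OF T, of 0 y 0] op_subspaceD(4)[OF self_adjoint_subspace[OF T]] by simp
  have CD0: "0 \<le> C (D x) \<bullet> x" for x using near_id_mult_nonneg[OF C(1) D(1)] CD by simp
  define G where "G x = C (D x)" for x
  have G: "linear G" "symmetric_map G" "\<And>x. 0 \<le> G x \<bullet> x"
    using CD0 symmetric_mapD[OF symC] symmetric_mapD[OF symD] CD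
    by (auto simp: G_def symmetric_map_def C.add D.add C.scale D.scale intro!: linearI)
  define S where "S = (\<lambda>y. (C y, D y)) ` UNIV"
  \<comment> \<open>Since \<open>C\<^sup>2 + D\<^sup>2 = I\<close> with commuting factors, the pairs
    with \<open>D u = C v\<close> are exactly those of the form \<open>(C y, D y)\<close>, and
    \<open>y = C u + D v\<close> recovers the parameter. Both self-adjointness of \<open>S\<close>
    and \<open>S O S = T\<close> rest on this.\<close>
  have solve: "\<exists>y. u = C y \<and> v = D y" if "D u = C v" for u v
  proof (intro exI conjI)
    have "D (C v) = u - B u" using D(2)[of u] that by simp
    then show "u = C (C u + D v)" by (simp add: C.add C(2) CD)
    have "D (C u) = B v" using C(2)[of v] that CD[of u] by simp
    then show "v = D (C u + D v)" by (simp add: D.add D(2))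
  qed
  have "self_adjoint S"
  proof (rule self_adjoint_intro)
    show "subspace S"
    proof (rule op_subspaceI)
      show "(0, 0) \<in> S" unfolding S_def by (rule image_eqI[of _ _ 0]) (simp_all add: C.zero D.zero)
    next
      fix x y u v assume "(x, y) \<in> S" "(u, v) \<in> S"
      then obtain p q where "x = C p" "y = D p" "u = C q" "v = D q" by (auto simp: S_def)
      then show "(x + u, y + v) \<in> S"
        unfolding S_def by (intro image_eqI[of _ _ "p + q"]) (simp_all add: C.add D.add)
    next
      fix c x y assume "(x, y) \<in> S"
      then obtain p where "x = C p" "y = D p" by (auto simp: S_def)
      then show "(c *\<^sub>R x, c *\<^sub>R y) \<in> S"
        unfolding S_def by (intro image_eqI[of _ _ "c *\<^sub>R p"]) (simp_all add: C.scale D.scale)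
    qed
    show "symmetric_operator S"
      by (auto simp: symmetric_operator_def S_def symmetric_mapD[OF symC] symmetric_mapD[OF symD] CD)
    show "closure (Domain S) = UNIV"
    proof (rule subspace_closure_eq_UNIV)
      show "subspace (Domain S)" by (rule subspace_Domain) fact
      fix y assume "\<And>s. s \<in> Domain S \<Longrightarrow> y \<bullet> s = 0"
      then have "y \<bullet> C (C y') = 0" for y' by (auto simp: S_def)
      then have "B y \<bullet> y' = 0" for y' using B(1) by (simp add: C(2) near_id_def symmetric_map_def)
      then have "B y = 0" using inner_eq_zero_iff by blast
      then show "y = 0" by (rule B0)
    qed
    fix u v assume "(u, v) \<in> op_adjoint S"
    then have "D y \<bullet> u = C y \<bullet> v" for y by (auto simp: op_adjoint_def S_def)
    then have "y \<bullet> (D u - C v) = 0" for y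
      by (simp add: inner_diff symmetric_mapD[OF symC] symmetric_mapD[OF symD])
    then have "D u = C v" using inner_eq_zero_iff by (metis eq_iff_diff_eq_0)
    then obtain y where "u = C y" "v = D y" using solve by blast
    then show "(u, v) \<in> S" by (simp add: S_def)
  qed
  moreover have "nonneg_operator S"
    using CD0 by (auto simp: nonneg_operator_def S_def inner_commute symmetric_mapD[OF symC])
  moreover have "S O S = T"
  proof (intro set_eqI iffI)
    fix p assume "p \<in> S O S"
    then obtain y z where p: "p = (C y, D z)" "D y = C z" by (auto simp: S_def)
    then obtain x where "y = C x" "z = D x" using solve by blast
    then show "p \<in> T" using p B(3) by (simp add: C(2) D(2))
  next
    fix p assume "p \<in> T"
    moreover obtain x y where p: "p = (x, y)" by fastforce
    ultimately have "x = B (x + y)" using B(4) by simp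
    then have "p = (C (C (x + y)), D (D (x + y)))" 
      unfolding C(2) D(2) p by simp
    then show "p \<in> S O S" by (force simp: S_def CD)
  qed
  moreover have "S' = {(x, y). G x = B y}" if S': "self_adjoint S'" "nonneg_operator S'" "S' O S' = T" for S'
  proof -
    note sub = self_adjoint_subspace[OF S'(1)] and sym = symmetric_operatorD[OF self_adjoint_symmetric[OF S'(1)]]
    \<comment> \<open>The middle point of \<open>(B h, h - B h) \<in> S' O S'\<close> is the value
      of \<open>S'\<close> at \<open>B h\<close>; choosing it for every \<open>h\<close> makes
      \<open>S' B\<close> an everywhere defined map.\<close>
    have "\<exists>f. (B h, f) \<in> S' \<and> (f, h - B h) \<in> S'" for h using B(3)[of h] S'(3) by blast
    then obtain F where F: "\<And>h. (B h, F h) \<in> S'" "\<And>h. (F h, h - B h) \<in> S'" by metis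
    have FB: "F x = B y" if "(x, y) \<in> S'" for x y
    proof -
      have "(x - B x, y - F x) \<in> S'" using op_subspaceD(2)[OF sub that F(1)[of x]] .
      then have "(F x, y - F x) \<in> T" using F(2)[of x] S'(3) by blast
      from B(4)[OF this] show ?thesis by simp
    qed
    have linF: "linear F"
    proof (rule linearI)
      fix x y c
      have "(B (x + y), F x + F y) \<in> S'" using op_subspaceD(1)[OF sub F(1)[of x] F(1)[of y]] by (simp add: B.add)
      then show "F (x + y) = F x + F y" using F(1) self_adjoint_unique[OF S'(1)] by blast
      have "(B (c *\<^sub>R x), c *\<^sub>R F x) \<in> S'" using op_subspaceD(3)[OF sub F(1)[of x]] by (simp add: B.scale)
      then show "F (c *\<^sub>R x) = c *\<^sub>R F x" using F(1) self_adjoint_unique[OF S'(1)] by blast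
    qed
    have symF: "symmetric_map F"
      unfolding symmetric_map_def
    proof (intro allI)
      fix h k
      have "F h \<bullet> B k = B h \<bullet> F k" using sym[OF F(1) F(1)] .
      moreover have "(h - B h) \<bullet> F k = F h \<bullet> (k - B k)" using sym[OF F(2) F(2)] .
      ultimately show "F h \<bullet> k = h \<bullet> F k" by (simp add: inner_diff)
    qed
    have posF: "0 \<le> F h \<bullet> h" for h
      using nonneg_operatorD[OF S'(2) F(1)[of h]] nonneg_operatorD[OF S'(2) F(2)[of h]]
      by (simp add: inner_diff inner_commute)
    have sqF: "F (F h) = B (h - B h)" for h using FB[OF F(2)] .
    have BF: "F (B h) = B (F h)" for h using FB[OF F(1)] .
    have nF: "norm (F h) \<le> norm h * 1" for h
    proof -
      have "(norm (F h))\<^sup>2 = B (h - B h) \<bullet> h"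
        using symmetric_mapD[OF symF, of h "F h"] by (simp add: power2_norm_eq_inner sqF inner_commute)
      also have "\<dots> = (h - B h) \<bullet> B h" using B(1) by (simp add: near_id_def symmetric_map_def)
      also have "\<dots> \<le> h \<bullet> h"
      proof -
        have "h \<bullet> h = (h - B h) \<bullet> B h + (B h \<bullet> h + (h - B h) \<bullet> (h - B h))"
          by (simp add: inner_diff inner_commute)
        then show ?thesis using inner_ge_zero[of "h - B h"] near_id_nonneg[OF B(1), of h] by linarith
      qed
      finally have "(norm (F h))\<^sup>2 \<le> (norm h)\<^sup>2" by (simp add: power2_norm_eq_inner)
      then show ?thesis by (auto intro: power2_le_imp_le)
    qed
    have F_bl: "bounded_linear F"
      by (rule bounded_linear_intro[OF _ _ nF]) (simp_all add: linear_add[OF linF] linear_scale[OF linF])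
    have FC: "F (C x) = C (F x)" for x using C(3)[OF F_bl] BF by blast
    have FD: "F (D x) = D (F x)" for x using D(3)[OF F_bl] BF by (simp add: linear_diff[OF linF])
    have "F x = G x" for x
    proof (rule nonneg_sqrt_unique[OF linF symF posF G])
      show "F (G x) = G (F x)" for x by (simp add: G_def FC FD)
      show "F (F x) = G (G x)" for x 
      proof -
        have "G (G x) = C (C (D (D x)))" by (simp add: G_def CD)
        then show ?thesis by (simp add: sqF D(2) C(2))
      qed
    qed
    then have FG: "F = G" by blast
    show ?thesis
    proof (intro set_eqI iffI; clarify)
      fix x y assume "(x, y) \<in> S'"
      then show "G x = B y" using FB FG by simp
    next
      fix x y assume xy: "G x = B y"
      \<comment> \<open>Here \<open>F x = B y\<close>, so the two values of \<open>S'\<close> at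
        this point agree, which gives \<open>F y = x - B x\<close>. Then \<open>(x, y)\<close> is
        the sum of \<open>(B x, F x)\<close> and \<open>(F y, y - B y)\<close>.\<close>
      have "(F x, x - B x) \<in> S'" "(F x, F y) \<in> S'" using F(2)[of x] F(1)[of y] xy FG by auto
      then have y: "F y = x - B x" using self_adjoint_unique[OF S'(1)] by blast
      then show "(x, y) \<in> S'"
        using op_subspaceD(1)[OF sub F(1)[of x] F(2)[of y]] xy FG by simp
    qed
  qed
  ultimately show ?thesis by blast
qed

lemma op_sqrt_props:
  fixes T :: "'a::{real_inner,complete_space} oper"
  assumes "self_adjoint T" "nonneg_operator T"
  shows "self_adjoint (op_sqrt T)" "nonneg_operator (op_sqrt T)" "op_sqrt T O op_sqrt T = T"
  using theI'[OF op_sqrt_exists[OF assms]] by (simp_all add: op_sqrt_def)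

text \<open>In other words, the domain of \<open>A\<^sup>2\<close> is a core. A residual
  \<open>(x - a, y - b)\<close> orthogonal to the restricted graph is tested with
  \<open>(z, A z)\<close>, where \<open>z + A\<^sup>2 z = x - a\<close>; by symmetry the pairing
  equals \<open>\<parallel>x - a\<parallel>\<^sup>2\<close>.\<close>

lemma square_core:
  fixes A :: "'a::{real_inner,complete_space} oper"
  assumes A: "self_adjoint A" and xy: "(x, y) \<in> A"
  shows "(x, y) \<in> closure {(u, v) \<in> A. u \<in> Domain (A O A)}"
proof -
  let ?S = "{(u, v) \<in> A. u \<in> Domain (A O A)}"
  note sub = self_adjoint_subspace[OF A]
  have "subspace (Domain (A O A))"
    using subspace_Domain self_adjoint_subspace[OF self_adjoint_square(1)[OF A]] by blast
  then have subS: "subspace ?S"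
    by (intro op_subspaceI) (auto intro: op_subspaceD[OF sub] subspace_add subspace_scale subspace_0)
  obtain p where p: "p \<in> closure ?S" "\<And>s. s \<in> closure ?S \<Longrightarrow> ((x, y) - p) \<bullet> s = 0"
    using orthogonal_projection_exists[OF closed_closure subspace_closure[OF subS]] by blast
  have "closure ?S \<subseteq> A" by (rule closure_minimal) (auto simp: self_adjoint_closed[OF A])
  then have pA: "p \<in> A" using p by blast
  obtain a b where ab: "p = (a, b)" by fastforce
  have d: "(x - a, y - b) \<in> A" using op_subspaceD(2)[OF sub xy] pA ab by blast
  obtain z w where zw: "(z, w) \<in> A" "(w, (x - a) - z) \<in> A" using square_onto[OF A, of "x - a"] by blast
  then have "(z, w) \<in> closure ?S" using closure_subset[of ?S] by blast
  then have "(x - a) \<bullet> z + (y - b) \<bullet> w = 0" using p(2)[of "(z, w)"] by (simp add: ab)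
  moreover have "(y - b) \<bullet> w = (x - a) \<bullet> (x - a - z)"
    using symmetric_operatorD[OF self_adjoint_symmetric[OF A] d zw(2)] .
  ultimately have "(x - a) \<bullet> (x - a) = 0" by (simp add: inner_diff)
  then have "x - a = 0" by (simp only: inner_eq_zero_iff)
  moreover from this have "y - b = 0"
    using d self_adjoint_unique[OF A] op_subspaceD(4)[OF sub] by metis
  ultimately show ?thesis using p(1) ab by simp
qed

text \<open>On the domain of the common square, \<open>\<parallel>A u\<parallel>\<^sup>2 =
  \<langle>A\<^sup>2 u, u\<rangle> = \<parallel>M u\<parallel>\<^sup>2\<close>. Approximating a
  point of the graph of \<open>M\<close> from the core therefore makes the values of
  \<open>A\<close> Cauchy, and \<open>A\<close> is closed. It is applied to
  \<open>M = |A|\<close>.\<close>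

lemma Domain_eq_if_square_eq:
  fixes A M :: "'a::{real_inner,complete_space} oper"
  assumes A: "self_adjoint A" and M: "self_adjoint M" and eq: "A O A = M O M"
  shows "Domain M \<subseteq> Domain A"
proof
  fix x assume "x \<in> Domain M"
  then obtain y where "(x, y) \<in> M" by blast
  from square_core[OF M this] obtain f where f: "\<And>n. f n \<in> {(u, v) \<in> M. u \<in> Domain (M O M)}" "f \<longlonglongrightarrow> (x, y)"
    by (auto simp: closure_sequential)
  define u v where "u n = fst (f n)" and "v n = snd (f n)" for n
  have uv: "(u n, v n) \<in> M" "u n \<in> Domain (A O A)" for n
    using f(1)[of n] unfolding u_def v_def eq by (cases "f n"; simp)+
  have lims: "u \<longlonglongrightarrow> x" "v \<longlonglongrightarrow> y"
    using tendsto_fst[OF f(2)] tendsto_snd[OF f(2)] by (simp_all add: u_def[abs_def] v_def[abs_def])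
  have "\<exists>a b. (u n, a) \<in> A \<and> (a, b) \<in> A" for n using uv(2)[of n] by blast
  then obtain a b where ab: "\<And>n. (u n, a n) \<in> A" "\<And>n. (a n, b n) \<in> A" by metis
  note symA = symmetric_operatorD[OF self_adjoint_symmetric[OF A]]
    and symM = symmetric_operatorD[OF self_adjoint_symmetric[OF M]]
  have same: "norm (a m - a n) = norm (v m - v n)" for m n
  proof -
    have d: "(u m - u n, a m - a n) \<in> A" "(a m - a n, b m - b n) \<in> A" "(u m - u n, v m - v n) \<in> M"
      using op_subspaceD(2) self_adjoint_subspace A M ab uv by blast+
    then have "(u m - u n, b m - b n) \<in> M O M" using eq by blast
    then have "(v m - v n, b m - b n) \<in> M" using d(3) self_adjoint_unique[OF M] by blast
    then have "(b m - b n) \<bullet> (u m - u n) = (v m - v n) \<bullet> (v m - v n)" using symM d(3) by blast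
    moreover have "(b m - b n) \<bullet> (u m - u n) = (a m - a n) \<bullet> (a m - a n)" using symA d by blast
    ultimately show ?thesis by (simp add: norm_eq_sqrt_inner)
  qed
  have "Cauchy a"
    using LIMSEQ_imp_Cauchy[OF lims(2)] by (simp add: Cauchy_def dist_norm same)
  then obtain c where "a \<longlonglongrightarrow> c" using Cauchy_convergent_iff convergent_def by blast
  then have "(x, c) \<in> A" using self_adjoint_closedD[OF A ab(1) lims(1)] by blast
  then show "x \<in> Domain A" by blast
qed

lemma Domain_abs_half_power_2:
  fixes A :: "'a::{real_inner,complete_space} oper"
  assumes A: "self_adjoint A"
  shows "Domain (abs_half_power A 2) \<subseteq> Domain A"
proof -
  have adj: "op_adjoint A = A" using A by (simp add: self_adjoint_def)
  note M = op_sqrt_props[OF self_adjoint_square[OF A]]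
  have "abs_half_power A 2 = op_sqrt (A O A)"
    using op_sqrt_props(3)[OF M(1,2)] by (simp add: abs_half_power_def op_abs_def adj numeral_2_eq_2)
  then show ?thesis using Domain_eq_if_square_eq[OF A M(1)] M(3) by simp
qed

section \<open>Test functions\<close>

text \<open>The parameters \<open>p\<close> and \<open>m\<close> make the family closed under differentiation, hence smooth.\<close>

definition bump :: "real \<Rightarrow> real \<Rightarrow> real \<Rightarrow> real poly \<Rightarrow> nat \<Rightarrow> real \<Rightarrow> real" where
  "bump a b c p m t = (if a < t \<and> t < b
     then poly p t / ((t - a) * (b - t)) ^ m * exp (- c / ((t - a) * (b - t))) else 0)"

lemma exp_minus_le:
  fixes y :: real
  assumes "0 < y" "0 < n"
  shows "exp (- y) \<le> (real n / y) ^ n"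
proof -
  have "(y / real n) ^ n \<le> (1 + y / real n) ^ n" using assms by (intro power_mono) auto
  also have "\<dots> \<le> exp y" using assms by (intro exp_ge_one_plus_x_over_n_power_n) auto
  finally have "1 / exp y \<le> 1 / (y / real n) ^ n" using assms by (intro divide_left_mono) auto
  then show ?thesis by (simp add: exp_minus inverse_eq_divide power_divide)
qed

lemma has_real_derivative_zero_quadratic:
  fixes f :: "real \<Rightarrow> real"
  assumes "\<And>t. \<bar>f t\<bar> \<le> K * (t - x)\<^sup>2"
  shows "(f has_real_derivative 0) (at x)"
proof -
  have fx: "f x = 0" using assms[of x] by simp
  have "((\<lambda>h. (f (x + h) - f x) / h) \<longlongrightarrow> 0) (at 0)"
  proof (rule Lim_null_comparison)
    show "\<forall>\<^sub>F h in at 0. norm ((f (x + h) - f x) / h) \<le> K * \<bar>h\<bar>"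
    proof (intro eventually_at_topological[THEN iffD2] exI[of _ UNIV] conjI ballI impI; (simp; fail)?)
      fix h :: real assume "h \<noteq> 0"
      then have "\<bar>f (x + h)\<bar> / \<bar>h\<bar> \<le> K * h\<^sup>2 / \<bar>h\<bar>"
        using assms[of "x + h"] by (intro divide_right_mono) auto
      also have "\<dots> = K * \<bar>h\<bar>" using \<open>h \<noteq> 0\<close> by (simp add: power2_eq_square field_simps)
      finally show "norm ((f (x + h) - f x) / h) \<le> K * \<bar>h\<bar>" by (simp add: fx)
    qed
    have "((\<lambda>h. K * \<bar>h\<bar>) \<longlongrightarrow> K * \<bar>0\<bar>) (at (0::real))" by (intro tendsto_intros)
    then show "((\<lambda>h. K * \<bar>h\<bar>) \<longlongrightarrow> 0) (at (0::real))" by simp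
  qed
  then show ?thesis by (simp add: DERIV_def)
qed

lemma bump_has_derivative_outside:
  assumes "0 < c" "x \<le> a \<or> b \<le> x"
  shows "(bump a b c p m has_real_derivative 0) (at x)"
proof (cases "a < b")
  case False
  then have "bump a b c p m = (\<lambda>t. 0)" by (auto simp: bump_def)
  then show ?thesis by simp
next
  case True
  have "compact (poly p ` {a..b})" by (intro compact_continuous_image continuous_intros compact_Icc)
  then obtain P where P: "\<And>t. t \<in> {a..b} \<Longrightarrow> \<bar>poly p t\<bar> \<le> P"
    using compact_imp_bounded bounded_iff by (metis image_eqI real_norm_def)
  have P0: "0 \<le> P" using P[of a] True by simp
  \<comment> \<open>From \<open>exp_minus_le\<close> at \<open>y = c / s\<close> with exponent
    \<open>m + 2\<close>: the exponential beats the pole \<open>1 / s ^ m\<close> and leaves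
    \<open>s\<^sup>2\<close>, the quadratic bound that gives derivative zero.\<close>
  define L where "L = (real (m + 2) / c) ^ (m + 2)"
  have L: "0 \<le> L" using assms by (simp add: L_def)
  show ?thesis
  proof (rule has_real_derivative_zero_quadratic[where K = "P * L * (b - a)\<^sup>2"])
    fix t
    show "\<bar>bump a b c p m t\<bar> \<le> P * L * (b - a)\<^sup>2 * (t - x)\<^sup>2"
    proof (cases "a < t \<and> t < b")
      case False
      then show ?thesis using P0 L by (auto simp: bump_def)
    next
      case t: True
      define s where "s = (t - a) * (b - t)"
      have s: "0 < s" using t by (simp add: s_def)
      \<comment> \<open>One of the two factors of \<open>s\<close> is the distance from
        \<open>t\<close> to the endpoint on the side of \<open>x\<close>, so it is at most
        \<open>\<bar>t - x\<bar>\<close>; the other is at most \<open>b - a\<close>.\<close>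
      have "s \<le> (b - a) * \<bar>t - x\<bar>"
      proof -
        have "(t - a) * (b - t) \<le> (t - a) * (b - a)" "(t - a) * (b - t) \<le> (b - a) * (b - t)"
          using t by (intro mult_left_mono mult_right_mono; simp)+
        moreover have "(b - a) * (t - a) \<le> (b - a) * \<bar>t - x\<bar> \<or> (b - a) * (b - t) \<le> (b - a) * \<bar>t - x\<bar>"
          using assms(2) t by (auto intro!: mult_left_mono)
        ultimately show ?thesis by (auto simp: s_def mult.commute)
      qed
      then have s2: "s\<^sup>2 \<le> ((b - a) * \<bar>t - x\<bar>)\<^sup>2" using s by (intro power_mono) auto
      have "exp (- (c / s)) \<le> (real (m + 2) / (c / s)) ^ (m + 2)"
        using assms s by (intro exp_minus_le) auto
      also have "\<dots> = L * s ^ (m + 2)" by (simp add: L_def power_mult_distrib[symmetric])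
      finally have e: "exp (- c / s) \<le> L * s ^ (m + 2)" by simp
      have "\<bar>bump a b c p m t\<bar> = \<bar>poly p t\<bar> / s ^ m * exp (- c / s)"
        using t s by (simp add: bump_def s_def[symmetric] abs_mult)
      also have "\<dots> \<le> P / s ^ m * (L * s ^ (m + 2))"
        using P[of t] t s e P0 by (intro mult_mono divide_right_mono) auto
      also have "\<dots> = P * L * s\<^sup>2" using s by (simp add: power_add power2_eq_square)
      also have "\<dots> \<le> P * L * ((b - a) * \<bar>t - x\<bar>)\<^sup>2" using s2 P0 L by (intro mult_left_mono) auto
      finally show ?thesis by (simp add: power_mult_distrib)
    qed
  qed
qed

lemma bump_has_derivative:
  assumes "0 < c"
  shows "\<exists>p'. \<forall>x. (bump a b c p m has_real_derivative bump a b c p' (m + 2) x) (at x)"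
proof -
  define q where "q = [:- a, 1:] * [:b, - 1:]"
  have q: "poly q t = (t - a) * (b - t)" for t by (simp add: q_def algebra_simps)
  \<comment> \<open>Numerator of the derivative of \<open>p / q ^ m * exp (- c / q)\<close> over the
    common denominator \<open>q ^ (m + 2)\<close>.\<close>
  define p' where "p' = pderiv p * q\<^sup>2 - smult (real m) (p * pderiv q * q) + smult c (p * pderiv q)"
  have "(bump a b c p m has_real_derivative bump a b c p' (m + 2) x) (at x)" for x
  proof (cases "a < x \<and> x < b")
    case False
    then show ?thesis using bump_has_derivative_outside[OF assms, of x a b p m] by (auto simp: bump_def)
  next
    case True
    define s where "s = poly q x"
    have s: "0 < s" using True by (simp add: s_def q)
    have pow: "real m * s ^ (m - 1) / s ^ m = real m / s"
      using s by (cases m) auto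
    have "((\<lambda>t. poly p t / poly q t ^ m * exp (- c / poly q t)) has_real_derivative
      (poly (pderiv p) x * s ^ m - poly p x * (real m * s ^ (m - 1) * poly (pderiv q) x)) / (s ^ m * s ^ m) * exp (- c / s)
       + exp (- c / s) * (c * poly (pderiv q) x / (s * s)) * (poly p x / s ^ m)) (at x)"
      using s unfolding s_def
      by (auto intro!: derivative_eq_intros simp: field_simps)
    also have "(poly (pderiv p) x * s ^ m - poly p x * (real m * s ^ (m - 1) * poly (pderiv q) x)) / (s ^ m * s ^ m) * exp (- c / s)
       + exp (- c / s) * (c * poly (pderiv q) x / (s * s)) * (poly p x / s ^ m)
       = bump a b c p' (m + 2) x"
    proof -
      have "(poly (pderiv p) x * s ^ m - poly p x * (real m * s ^ (m - 1) * poly (pderiv q) x)) / (s ^ m * s ^ m)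
        = poly (pderiv p) x / s ^ m - poly p x * poly (pderiv q) x * (real m * s ^ (m - 1) / s ^ m) / s ^ m"
        using s by (simp add: diff_divide_distrib)
      moreover have "bump a b c p' (m + 2) x = poly p' x / s ^ (m + 2) * exp (- c / s)"
        using True by (simp add: bump_def s_def q)
      moreover have "poly p' x = poly (pderiv p) x * s\<^sup>2 - real m * (poly p x * poly (pderiv q) x * s) + c * (poly p x * poly (pderiv q) x)"
        by (simp add: p'_def s_def)
      moreover have "(u / M - v * (real m / s) / M) * e + e * (c * w / (s * s)) * (z / M)
          = (u * s\<^sup>2 - real m * (v * s) + c * (z * w)) / (M * s\<^sup>2) * e"
        if "0 < M" for u v w z M e :: real
        using s that by (simp add: field_simps power2_eq_square)
      ultimately show ?thesis
        unfolding pow power_add using s by simp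
    qed
    finally have "((\<lambda>t. poly p t / poly q t ^ m * exp (- c / poly q t)) has_real_derivative bump a b c p' (m + 2) x) (at x)" .
    then show ?thesis
    proof (rule DERIV_cong_ev[THEN iffD1, rotated -1])
      have "\<forall>\<^sub>F t in nhds x. t \<in> {a<..<b}" using True by (intro eventually_nhds_in_open) auto
      then show "\<forall>\<^sub>F t in nhds x. poly p t / poly q t ^ m * exp (- c / poly q t) = bump a b c p m t"
        by eventually_elim (simp add: bump_def q)
    qed auto
  qed
  then show ?thesis by blast
qed

text \<open>The class is closed under differentiation and contains the combinations used in
  \<open>du_bois_reymond\<close>: a bump minus a multiple of another one, the multiple being chosen
  so that the integral is zero.\<close>

definition bump_combinations :: "(real \<Rightarrow> real) set" where
  "bump_combinations = {\<lambda>t. bump a b c p m t - d * bump a' b' c' p' m' t |a b c p m d a' b' c' p' m'. 0 < c \<and> 0 < c'}"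

lemma bump_in_combinations: "0 < c \<Longrightarrow> bump a b c p m \<in> bump_combinations"
proof -
  assume "0 < c"
  moreover have "bump a b c p m = (\<lambda>t. bump a b c p m t - 0 * bump a b c p m t)" by simp
  ultimately show ?thesis unfolding bump_combinations_def by blast
qed

lemma bump_combinations_derivative:
  assumes "f \<in> bump_combinations"
  obtains g where "g \<in> bump_combinations" "\<And>x. (f has_real_derivative g x) (at x)"
proof -
  from assms obtain a b c p m d a' b' c' p' m'
    where f: "f = (\<lambda>t. bump a b c p m t - d * bump a' b' c' p' m' t)" and c: "0 < c" "0 < c'"
    unfolding bump_combinations_def by blast
  obtain r where r: "\<And>x. (bump a b c p m has_real_derivative bump a b c r (m + 2) x) (at x)"
    using bump_has_derivative[OF c(1)] by blast
  obtain r' where r': "\<And>x. (bump a' b' c' p' m' has_real_derivative bump a' b' c' r' (m' + 2) x) (at x)"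
    using bump_has_derivative[OF c(2)] by blast
  show ?thesis
  proof
    show "(\<lambda>t. bump a b c r (m + 2) t - d * bump a' b' c' r' (m' + 2) t) \<in> bump_combinations"
      using c unfolding bump_combinations_def by blast
    show "(f has_real_derivative bump a b c r (m + 2) x - d * bump a' b' c' r' (m' + 2) x) (at x)" for x
      unfolding f by (intro DERIV_diff DERIV_cmult r r')
  qed
qed

lemma bump_combinations_higher_deriv: "f \<in> bump_combinations \<Longrightarrow> (deriv ^^ k) f \<in> bump_combinations"
proof (induction k arbitrary: f)
  case (Suc k)
  obtain g where g: "g \<in> bump_combinations" "\<And>x. (f has_real_derivative g x) (at x)"
    using bump_combinations_derivative[OF Suc.prems] by blast
  then have "deriv f = g" using DERIV_imp_deriv by blast
  then show ?case using Suc.IH[OF g(1)] by (simp add: funpow_swap1)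
qed simp

lemma bump_combinations_smooth:
  "f \<in> bump_combinations \<Longrightarrow> (deriv ^^ k) f field_differentiable at t"
  using bump_combinations_derivative[OF bump_combinations_higher_deriv]
  unfolding field_differentiable_def by metis

lemma test_function_bump:
  assumes "0 < a" "0 < c"
  shows "test_function (bump a b c p m)"
  unfolding test_function_def
proof (intro conjI allI)
  show "(deriv ^^ k) (bump a b c p m) field_differentiable at t" for k t
    by (intro bump_combinations_smooth bump_in_combinations assms)
  show "\<exists>K. compact K \<and> K \<subseteq> {0<..} \<and> (\<forall>t. t \<notin> K \<longrightarrow> bump a b c p m t = 0)"
    using assms by (intro exI[of _ "{a..b}"]) (auto simp: bump_def)
qed

text \<open>Mean zero makes the antiderivative return to 0 at \<open>b\<close>, so that its support
  is compact; its derivatives of positive order are those of the smooth \<open>f\<close>.\<close>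

lemma test_function_antiderivative:
  assumes f: "f \<in> bump_combinations" and "0 < a" "a < b" and supp: "\<And>t. t \<notin> {a..b} \<Longrightarrow> f t = 0"
    and int: "integral {a..b} f = 0"
  obtains \<eta> where "test_function \<eta>" "\<And>t. (\<eta> has_real_derivative f t) (at t)" "\<And>t. t \<notin> {a<..<b} \<Longrightarrow> \<eta> t = 0"
proof -
  have "isCont f t" for t
    using bump_combinations_derivative[OF f] DERIV_isCont by metis
  then have cont: "continuous_on S f" for S by (simp add: continuous_at_imp_continuous_on)
  \<comment> \<open>For \<open>t < 0\<close> the interval \<open>{0..t}\<close> is empty and the
    integral is 0, so this formula is correct on the whole line.\<close>
  define \<eta> where "\<eta> t = integral {0..t} f" for t
  have left: "\<eta> t = 0" if "t \<le> a" for t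
  proof -
    have "negligible {a}" by simp
    have "integral {0..t} f = integral {0..t} (\<lambda>t. 0)"
      by (rule integral_spike[OF \<open>negligible {a}\<close>]) (use that supp in auto)
    then show ?thesis by (simp add: \<eta>_def)
  qed
  have right: "\<eta> t = 0" if "b \<le> t" for t
  proof -
    have "integral {0..t} f = integral {a..b} f"
    proof (rule integral_spike_set)
      show "negligible {x \<in> {0..t} - {a..b}. f x \<noteq> 0}" "negligible {x \<in> {a..b} - {0..t}. f x \<noteq> 0}"
        using supp that assms by (auto intro!: negligible_subset[OF negligible_empty])
    qed
    then show ?thesis by (simp add: \<eta>_def int)
  qed
  have der: "(\<eta> has_real_derivative f t) (at t)" for t
  proof (cases "t < a")
    case True
    then have "\<forall>\<^sub>F s in nhds t. s \<in> {..<a}" by (intro eventually_nhds_in_open) auto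
    then have "\<forall>\<^sub>F s in nhds t. \<eta> s = 0" by eventually_elim (simp add: left)
    then have "(\<eta> has_real_derivative 0) (at t)" by (subst DERIV_cong_ev[OF refl _ refl]) auto
    then show ?thesis using True supp by simp
  next
    case False
    then have t: "0 < t" using assms by simp
    have "(\<eta> has_real_derivative f t) (at t within {0..t+1})"
      unfolding \<eta>_def by (rule integral_has_real_derivative[OF cont]) (use t in auto)
    then show ?thesis using t by (simp add: at_within_Icc_at)
  qed
  then have "deriv \<eta> = f" using DERIV_imp_deriv by blast
  have "(deriv ^^ k) \<eta> field_differentiable at t" for k t
  proof (cases k)
    case 0
    then show ?thesis using der by (auto simp: field_differentiable_def)
  next
    case (Suc j)
    then show ?thesis using bump_combinations_smooth[OF f, of j t] \<open>deriv \<eta> = f\<close> by (simp add: funpow_swap1)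
  qed
  moreover have "compact {a..b} \<and> {a..b} \<subseteq> {0<..} \<and> (\<forall>t. t \<notin> {a..b} \<longrightarrow> \<eta> t = 0)"
    using left right assms by auto
  ultimately have "test_function \<eta>" unfolding test_function_def by blast
  then show ?thesis using that der left right by fastforce
qed

lemma deriv_eq_zero_outside:
  fixes \<eta> :: "real \<Rightarrow> real"
  assumes "closed K" "\<And>t. t \<notin> K \<Longrightarrow> \<eta> t = 0" "t \<notin> K"
  shows "deriv \<eta> t = 0"
proof -
  have "\<forall>\<^sub>F s in nhds t. s \<in> - K" using assms by (intro eventually_nhds_in_open) (auto simp: open_Compl)
  then have "\<forall>\<^sub>F s in nhds t. \<eta> s = 0" by eventually_elim (simp add: assms(2))
  then have "(\<eta> has_real_derivative 0) (at t)" by (subst DERIV_cong_ev[OF refl _ refl]) auto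
  then show ?thesis by (rule DERIV_imp_deriv)
qed

lemma test_function_deriv:
  assumes "test_function \<eta>"
  shows "test_function (deriv \<eta>)"
proof -
  obtain K where K: "compact K" "K \<subseteq> {0<..}" "\<And>t. t \<notin> K \<Longrightarrow> \<eta> t = 0"
    using assms unfolding test_function_def by blast
  have "deriv \<eta> t = 0" if "t \<notin> K" for t
    by (rule deriv_eq_zero_outside[OF compact_imp_closed[OF K(1)] K(3) that])
  moreover have "(deriv ^^ k) (deriv \<eta>) field_differentiable at t" for k t
    using assms unfolding test_function_def by (metis funpow.simps(2) funpow_swap1 comp_apply)
  ultimately show ?thesis using K unfolding test_function_def by blast
qed

lemma test_function_has_derivative:
  "test_function \<eta> \<Longrightarrow> (\<eta> has_real_derivative deriv \<eta> t) (at t)"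
  using DERIV_deriv_iff_field_differentiable unfolding test_function_def by (metis funpow_0)

lemma test_function_continuous: "test_function \<eta> \<Longrightarrow> continuous_on S \<eta>"
  using test_function_has_derivative DERIV_isCont by (metis continuous_at_imp_continuous_on)

section \<open>Locally absolutely continuous functions\<close>

lemma AE_half_line_iff: "(AE t in half_line. P t) \<longleftrightarrow> negligible {t. 0 < t \<and> \<not> P t}"
proof -
  have "(AE t in half_line. P t) \<longleftrightarrow> (AE t in lebesgue. t \<in> {0<..} \<longrightarrow> P t)"
    by (rule AE_restrict_space_iff) simp
  also have "\<dots> \<longleftrightarrow> negligible {t. 0 < t \<and> \<not> P t}"
    unfolding eventually_ae_filter_negligible using negligible_subset by (auto simp: greaterThan_def)
  finally show ?thesis .
qed

section \<open>Locally integrable scalar functions and their primitives\<close>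

definition loc_int :: "(real \<Rightarrow> real) \<Rightarrow> bool" where
  "loc_int f \<longleftrightarrow> (\<forall>u v. 0 < u \<longrightarrow> f absolutely_integrable_on {u..v})"

lemma loc_intD: "loc_int f \<Longrightarrow> 0 < u \<Longrightarrow> f absolutely_integrable_on {u..v}"
  by (simp add: loc_int_def)

lemma loc_int_integrable: "loc_int f \<Longrightarrow> 0 < u \<Longrightarrow> f integrable_on {u..v}"
  using loc_intD absolutely_integrable_on_def by blast

lemma loc_int_add: "loc_int f \<Longrightarrow> loc_int g \<Longrightarrow> loc_int (\<lambda>t. f t + g t)"
  by (simp add: loc_int_def set_integral_add)

lemma loc_int_continuous_mult:
  assumes "loc_int f" "continuous_on {0<..} h"
  shows "loc_int (\<lambda>t. h t * f t)"
  unfolding loc_int_def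
proof (intro allI impI)
  fix u v :: real assume u: "0 < u"
  then have c: "continuous_on {u..v} h" using assms(2) by (rule_tac continuous_on_subset) auto
  show "(\<lambda>t. h t * f t) absolutely_integrable_on {u..v}"
  proof (rule absolutely_integrable_bounded_measurable_product_real)
    show "h \<in> borel_measurable (lebesgue_on {u..v})"
      using c by (rule continuous_imp_measurable_on_sets_lebesgue) simp
    show "bounded (h ` {u..v})" using c compact_continuous_image compact_imp_bounded by blast
  qed (use assms u in \<open>auto simp: loc_int_def\<close>)
qed

lemma loc_int_continuous:
  assumes "continuous_on {0<..} (h :: real \<Rightarrow> real)"
  shows "loc_int h"
  unfolding loc_int_def
  using assms by (auto intro!: absolutely_integrable_continuous_real intro: continuous_on_subset)

lemma loc_int_bounded_by:
  assumes "\<And>u v. 0 < u \<Longrightarrow> f integrable_on {u..v}" "loc_int m" "\<And>t. 0 < t \<Longrightarrow> \<bar>f t\<bar> \<le> m t"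
  shows "loc_int f"
  unfolding loc_int_def
  by (auto intro!: absolutely_integrable_integrable_bound[where g = m] assms loc_int_integrable)

lemma loc_int_abs: "loc_int f \<Longrightarrow> loc_int (\<lambda>t. \<bar>f t\<bar>)"
  by (simp add: loc_int_def set_integrable_abs)

lemma loc_int_cmult: "loc_int f \<Longrightarrow> loc_int (\<lambda>t. c * f t)"
  by (rule loc_int_continuous_mult) auto

text \<open>The signed integral from 1 to \<open>t\<close>: an interval with reversed endpoints is
  empty, so at most one of the two terms is nonzero.\<close>

definition primitive :: "(real \<Rightarrow> real) \<Rightarrow> real \<Rightarrow> real" where
  "primitive m t = integral {1..t} m - integral {t..1} m"

lemma primitive_diff:
  assumes "loc_int m" "0 < u" "u \<le> v"
  shows "primitive m v - primitive m u = integral {u..v} m"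
proof -
  note int = loc_int_integrable[OF assms(1)]
  have left: "integral {1..t} m = 0" if "t \<le> 1" for t using that by (cases "t = 1") auto
  have right: "integral {t..1} m = 0" if "1 \<le> t" for t using that by (cases "t = 1") auto
  note that = assms(2,3)
  show ?thesis
  proof -
    consider "1 \<le> u" | "v \<le> 1" | "u < 1" "1 < v" by linarith
    then show ?thesis
    proof cases
      case 1
      have "integral {1..u} m + integral {u..v} m = integral {1..v} m"
        using Henstock_Kurzweil_Integration.integral_combine[OF 1 that(2), of m] int[of 1 v] by simp
      then show ?thesis using right[of u] right[of v] 1 that by (simp add: primitive_def)
    next
      case 2
      have "integral {u..v} m + integral {v..1} m = integral {u..1} m"
        using Henstock_Kurzweil_Integration.integral_combine[OF that(2) 2, of m] int[OF that(1)] by simp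
      then show ?thesis using left[of u] left[of v] 2 that by (simp add: primitive_def)
    next
      case 3
      have "integral {u..1} m + integral {1..v} m = integral {u..v} m"
        using Henstock_Kurzweil_Integration.integral_combine[where a = u and c = 1 and b = v and f = m] int[OF that(1)] 3 by simp
      then show ?thesis using left[of u] right[of v] 3 by (simp add: primitive_def)
    qed
  qed
qed

lemma primitive_has_integral:
  assumes "loc_int m" "0 < u" "u \<le> v"
  shows "(m has_integral (primitive m v - primitive m u)) {u..v}"
  unfolding primitive_diff[OF assms] by (rule integrable_integral[OF loc_int_integrable[OF assms(1,2)]])

lemma continuous_on_primitive:
  assumes "loc_int m"
  shows "continuous_on {0<..} (primitive m)"
proof -
  have "isCont (primitive m) t" if "0 < t" for t
  proof -
    have "continuous_on {t/2..t+1} (\<lambda>x. primitive m (t/2) + integral {t/2..x} m)"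
      by (intro continuous_intros indefinite_integral_continuous_1 loc_int_integrable assms) (use that in auto)
    then have "continuous_on {t/2..t+1} (primitive m)"
    proof (rule continuous_on_eq)
      fix x assume "x \<in> {t/2..t+1}"
      then show "primitive m (t/2) + integral {t/2..x} m = primitive m x"
        using primitive_diff[OF assms, of "t/2" x] that by simp
    qed
    then show ?thesis by (rule continuous_on_interior) (use that in simp)
  qed
  then show ?thesis by (auto intro: continuous_at_imp_continuous_on)
qed

lemma continuous_on_dominated:
  fixes f :: "real \<Rightarrow> 'b::metric_space"
  assumes M: "continuous_on S M" and le: "\<And>u v. u \<in> S \<Longrightarrow> v \<in> S \<Longrightarrow> dist (f u) (f v) \<le> \<bar>M u - M v\<bar>"
  shows "continuous_on S f"
  unfolding continuous_on_iff
proof (intro ballI allI impI)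
  fix x and e :: real assume x: "x \<in> S" "0 < e"
  then obtain d where "0 < d" "\<And>y. y \<in> S \<Longrightarrow> dist y x < d \<Longrightarrow> dist (M y) (M x) < e"
    using M unfolding continuous_on_iff by meson
  moreover have "dist (f y) (f x) \<le> dist (M y) (M x)" if "y \<in> S" for y
    using le[OF that x(1)] by (simp add: dist_real_def)
  ultimately show "\<exists>d>0. \<forall>y\<in>S. dist y x < d \<longrightarrow> dist (f y) (f x) < e"
    by (meson le_less_trans)
qed

text \<open>A substitute for differentiation almost everywhere: when the increments of
  \<open>J\<close> are of smaller order than those of \<open>M\<close>, uniformly over short
  intervals, summing over a fine partition leaves at most \<open>e * (M v - M u)\<close> for every
  \<open>e\<close>.\<close>

lemma telescoping_zero:
  fixes J M :: "real \<Rightarrow> real"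
  assumes uv: "u \<le> v" and
    small: "\<And>e. 0 < e \<Longrightarrow> \<exists>d>0. \<forall>s t. u \<le> s \<and> s \<le> t \<and> t \<le> v \<and> t - s < d \<longrightarrow> \<bar>J t - J s\<bar> \<le> e * (M t - M s)"
  shows "J v = J u"
proof -
  have bd: "\<bar>J v - J u\<bar> \<le> e * (M v - M u)" if e: "0 < e" for e
  proof -
    obtain d where d: "0 < d" "\<And>s t. u \<le> s \<Longrightarrow> s \<le> t \<Longrightarrow> t \<le> v \<Longrightarrow> t - s < d \<Longrightarrow> \<bar>J t - J s\<bar> \<le> e * (M t - M s)"
      using small[OF e] by blast
    obtain n where n: "(v - u) / d < real n" using reals_Archimedean2 by blast
    then have n0: "0 < real n" using uv d by (smt (verit) divide_nonneg_pos)
    define w where "w = (v - u) / real n"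
    define t where "t i = u + real i * w" for i :: nat
    have step: "t (Suc i) - t i = w" for i by (simp add: t_def distrib_right)
    have w: "0 \<le> w" "w < d" using n n0 d uv by (simp_all add: w_def field_simps)
    have nw: "real n * w = v - u" using n0 by (simp add: w_def)
    have tb: "u \<le> t i" "i \<le> n \<Longrightarrow> t i \<le> v" for i
    proof -
      show "u \<le> t i" using w by (simp add: t_def)
      assume "i \<le> n"
      then have "real i * w \<le> real n * w" using w by (intro mult_right_mono) auto
      then show "t i \<le> v" using nw by (simp add: t_def)
    qed
    have ends: "t 0 = u" "t n = v" using nw by (auto simp: t_def)
    have "\<bar>J v - J u\<bar> = \<bar>\<Sum>i<n. J (t (Suc i)) - J (t i)\<bar>"
      using sum_lessThan_telescope[of "\<lambda>i. J (t i)" n] by (simp add: ends)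
    also have "\<dots> \<le> (\<Sum>i<n. \<bar>J (t (Suc i)) - J (t i)\<bar>)" by (rule sum_abs)
    also have "\<dots> \<le> (\<Sum>i<n. e * (M (t (Suc i)) - M (t i)))"
    proof (rule sum_mono)
      fix i assume "i \<in> {..<n}"
      then show "\<bar>J (t (Suc i)) - J (t i)\<bar> \<le> e * (M (t (Suc i)) - M (t i))"
        using d(2)[of "t i" "t (Suc i)"] step[of i] tb[of i] tb[of "Suc i"] w by auto
    qed
    also have "\<dots> = e * (M v - M u)"
      using sum_lessThan_telescope[of "\<lambda>i. M (t i)" n] by (simp add: ends sum_distrib_left[symmetric])
    finally show ?thesis .
  qed
  have "\<bar>J v - J u\<bar> \<le> 0"
  proof (rule field_le_epsilon)
    fix e :: real assume "0 < e"
    define c where "c = e / (1 + \<bar>M v - M u\<bar>)"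
    have "0 < c" using \<open>0 < e\<close> by (simp add: c_def)
    have "c * (M v - M u) \<le> c * (1 + \<bar>M v - M u\<bar>)" using \<open>0 < c\<close> by (intro mult_left_mono) auto
    also have "\<dots> = e" by (simp add: c_def)
    finally show "\<bar>J v - J u\<bar> \<le> 0 + e" using bd[OF \<open>0 < c\<close>] by simp
  qed
  then show ?thesis by simp
qed

text \<open>
  \<open>wac f g\<close>: the function \<open>f\<close> on the open half-line is locally absolutely continuous with
  derivative \<open>g\<close>, where the vector-valued fundamental theorem of calculus is expressed through
  inner products, so that only scalar integrals occur.
\<close>

definition wac :: "(real \<Rightarrow> 'a::real_inner) \<Rightarrow> (real \<Rightarrow> 'a) \<Rightarrow> bool" where
  "wac f g \<longleftrightarrow> (\<exists>m. loc_int m \<and> (\<forall>t>0. norm (g t) \<le> m t)) \<and>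
     (\<forall>x u v. 0 < u \<longrightarrow> u \<le> v \<longrightarrow> ((\<lambda>t. g t \<bullet> x) has_integral (f v - f u) \<bullet> x) {u..v})"

lemma wac_has_integral:
  "wac f g \<Longrightarrow> 0 < u \<Longrightarrow> u \<le> v \<Longrightarrow> ((\<lambda>t. g t \<bullet> x) has_integral (f v - f u) \<bullet> x) {u..v}"
  by (simp add: wac_def)

lemma wac_dominated:
  assumes "wac f g"
  obtains m where "loc_int m" "\<And>t. 0 < t \<Longrightarrow> norm (g t) \<le> m t"
  using assms unfolding wac_def by blast

lemma abs_inner_le: "norm x \<le> a \<Longrightarrow> norm y \<le> b \<Longrightarrow> \<bar>x \<bullet> y\<bar> \<le> a * b"
  by (rule order_trans[OF Cauchy_Schwarz_ineq2 mult_mono]) (auto intro: order_trans[OF norm_ge_zero])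

lemma norm_le_of_inner_self:
  assumes "y \<bullet> y \<le> norm y * c" "0 \<le> c"
  shows "norm y \<le> c"
proof (cases "y = 0")
  case False
  then show ?thesis using assms(1) by (simp add: dot_square_norm power2_eq_square)
qed (use assms in simp)

text \<open>Pairing the vector difference with itself turns the scalar identities into a norm bound.
  The constant \<open>c\<close> serves difference quotients, where \<open>c = g t\<close>;
  \<open>c = 0\<close> gives a modulus of continuity.\<close>

lemma wac_norm_diff_le:
  fixes f :: "real \<Rightarrow> 'a::real_inner"
  assumes "wac f g" "0 < u" "u \<le> v" and m: "m integrable_on {u..v}" "\<And>t. t \<in> {u..v} \<Longrightarrow> norm (g t - c) \<le> m t"
  shows "norm (f v - f u - (v - u) *\<^sub>R c) \<le> integral {u..v} m"
proof (rule norm_le_of_inner_self)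
  let ?y = "f v - f u - (v - u) *\<^sub>R c"
  show "0 \<le> integral {u..v} m"
    using m(2) by (intro integral_nonneg[OF m(1)] order_trans[OF norm_ge_zero])
  have "((\<lambda>t. c \<bullet> ?y) has_integral (v - u) *\<^sub>R (c \<bullet> ?y)) {u..v}"
    using has_integral_const_real[of "c \<bullet> ?y" u v] assms(3) by simp
  with wac_has_integral[OF assms(1-3), of ?y]
  have int: "((\<lambda>t. g t \<bullet> ?y - c \<bullet> ?y) has_integral ((f v - f u) \<bullet> ?y - (v - u) *\<^sub>R (c \<bullet> ?y))) {u..v}"
    by (rule has_integral_diff)
  have "(f v - f u) \<bullet> ?y - (v - u) *\<^sub>R (c \<bullet> ?y) \<le> norm ?y * integral {u..v} m"
  proof (rule has_integral_le[OF int has_integral_mult_right[OF integrable_integral[OF m(1)]]])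
    fix t assume t: "t \<in> {u..v}"
    have "\<bar>(g t - c) \<bullet> ?y\<bar> \<le> m t * norm ?y" by (rule abs_inner_le[OF m(2)[OF t] order_refl])
    then have "(g t - c) \<bullet> ?y \<le> m t * norm ?y" by linarith
    then show "g t \<bullet> ?y - c \<bullet> ?y \<le> norm ?y * m t" by (simp only: inner_diff_left mult.commute)
  qed
  moreover have "?y \<bullet> ?y = (f v - f u) \<bullet> ?y - (v - u) *\<^sub>R (c \<bullet> ?y)"
    by (subst (1) inner_diff_left) simp
  ultimately show "?y \<bullet> ?y \<le> norm ?y * integral {u..v} m" by simp
qed

lemma wac_norm_diff_le_const:
  fixes f :: "real \<Rightarrow> 'a::real_inner"
  assumes "wac f g" "0 < u" "u \<le> v" "\<And>t. t \<in> {u..v} \<Longrightarrow> norm (g t - c) \<le> e"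
  shows "norm (f v - f u - (v - u) *\<^sub>R c) \<le> e * (v - u)"
  using wac_norm_diff_le[OF assms(1-3) integrable_const_ivl assms(4)] assms(3) by (simp add: mult.commute)

lemma wac_continuous:
  assumes "wac f g"
  shows "continuous_on {0<..} f"
proof -
  obtain m where m: "loc_int m" "\<And>t. 0 < t \<Longrightarrow> norm (g t) \<le> m t" using wac_dominated[OF assms] by blast
  define M where "M = primitive m"
  have M: "\<And>u v. 0 < u \<Longrightarrow> u \<le> v \<Longrightarrow> (m has_integral (M v - M u)) {u..v}" "continuous_on {0<..} M"
    unfolding M_def by (auto intro: primitive_has_integral[OF m(1)] continuous_on_primitive[OF m(1)])
  have le: "norm (f v - f u) \<le> M v - M u" if "0 < u" "u \<le> v" for u v
    using wac_norm_diff_le[OF assms that, of m 0] m that integral_unique[OF M(1)[OF that]]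
    by (simp add: loc_int_integrable)
  show ?thesis
  proof (rule continuous_on_dominated[OF M(2)])
    fix u v :: real assume "u \<in> {0<..}" "v \<in> {0<..}"
    then show "dist (f u) (f v) \<le> \<bar>M u - M v\<bar>"
      using le[of u v] le[of v u] by (cases "u \<le> v") (auto simp: dist_norm norm_minus_commute)
  qed
qed

text \<open>As \<open>g\<close> is only weakly measurable, \<open>h\<close> is discretised instead:
  \<open>h (p n t)\<close> takes countably many values, against each of which \<open>g\<close> is
  measurable.\<close>

lemma measurable_inner_continuous:
  fixes g :: "real \<Rightarrow> 'a::real_inner"
  assumes g: "\<And>x. (\<lambda>t. g t \<bullet> x) \<in> borel_measurable (lebesgue_on {u..v})"
    and h: "continuous_on {u..v} h"
  shows "(\<lambda>t. g t \<bullet> h t) \<in> borel_measurable (lebesgue_on {u..v})"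
proof (rule borel_measurable_LIMSEQ_real)
  \<comment> \<open>Rounding down to multiples of \<open>1 / (n + 1)\<close> could leave the
    interval on the left; \<open>max u\<close> brings the point back into
    \<open>{u..v}\<close>.\<close>
  define p where "p n t = max u (real_of_int \<lfloor>real (Suc n) * t\<rfloor> / real (Suc n))" for n t
  show "(\<lambda>t. g t \<bullet> h (p n t)) \<in> borel_measurable (lebesgue_on {u..v})" for n
  proof -
    have "(\<lambda>t. \<lfloor>real (Suc n) * t\<rfloor>) \<in> measurable lborel (count_space UNIV)" by simp
    then have "(\<lambda>t. \<lfloor>real (Suc n) * t\<rfloor>) \<in> measurable (lebesgue_on {u..v}) (count_space UNIV)"
      by (intro measurable_restrict_space1 measurable_completion)
    then show ?thesis unfolding p_def
      by (rule measurable_compose_countable[rotated,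
            where f = "\<lambda>i t. g t \<bullet> h (max u (real_of_int i / real (Suc n)))"]) (rule g)
  qed
  fix t assume "t \<in> space (lebesgue_on {u..v})"
  then have t: "t \<in> {u..v}" by simp
  have le: "real_of_int \<lfloor>real (Suc n) * t\<rfloor> / real (Suc n) \<le> t" for n
  proof -
    have "real_of_int \<lfloor>real (Suc n) * t\<rfloor> \<le> real (Suc n) * t" by simp
    then show ?thesis by (subst pos_divide_le_eq) (simp_all add: mult.commute)
  qed
  have ge: "t - 1 / real (Suc n) \<le> real_of_int \<lfloor>real (Suc n) * t\<rfloor> / real (Suc n)" for n
  proof -
    have "real (Suc n) * t - 1 \<le> real_of_int \<lfloor>real (Suc n) * t\<rfloor>" by linarith
    then have "(real (Suc n) * t - 1) / real (Suc n) \<le> real_of_int \<lfloor>real (Suc n) * t\<rfloor> / real (Suc n)"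
      by (rule divide_right_mono) simp
    then show ?thesis by (simp add: diff_divide_distrib del: of_nat_Suc)
  qed
  have pt: "p n t \<in> {u..v}" for n using le[of n] t by (auto simp: p_def)
  have "(\<lambda>n. p n t) \<longlonglongrightarrow> t"
  proof (rule tendsto_sandwich)
    show "\<forall>\<^sub>F n in sequentially. t - 1 / real (Suc n) \<le> p n t"
      using ge unfolding p_def by (intro always_eventually allI max.coboundedI2)
    show "\<forall>\<^sub>F n in sequentially. p n t \<le> t"
      using le t unfolding p_def by (intro always_eventually allI max.boundedI) auto
    show "(\<lambda>n. t - 1 / real (Suc n)) \<longlonglongrightarrow> t"
      using tendsto_diff[OF tendsto_const LIMSEQ_inverse_real_of_nat, of t] by (simp add: inverse_eq_divide)
  qed simp
  then have "(\<lambda>n. h (p n t)) \<longlonglongrightarrow> h t"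
    using pt by (intro continuous_on_tendsto_compose[OF h _ t] always_eventually allI)
  then show "(\<lambda>n. g t \<bullet> h (p n t)) \<longlonglongrightarrow> g t \<bullet> h t" by (intro tendsto_intros)
qed

lemma continuous_on_Icc_norm_bounded:
  fixes h :: "real \<Rightarrow> 'b::real_normed_vector"
  assumes "continuous_on {u..v} h"
  shows "\<exists>B. \<forall>t\<in>{u..v}. norm (h t) \<le> B"
  using compact_imp_bounded[OF compact_continuous_image[OF assms compact_Icc]] by (simp add: bounded_iff)

lemma integrable_inner_continuous_Icc:
  fixes g :: "real \<Rightarrow> 'a::real_inner"
  assumes g: "\<And>x. (\<lambda>t. g t \<bullet> x) \<in> borel_measurable (lebesgue_on {u..v})"
    and m: "loc_int m" "\<And>t. 0 < t \<Longrightarrow> norm (g t) \<le> m t"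
    and h: "continuous_on {u..v} h" and u: "0 < u"
  shows "(\<lambda>t. g t \<bullet> h t) integrable_on {u..v}"
proof -
  obtain B where B: "\<And>t. t \<in> {u..v} \<Longrightarrow> norm (h t) \<le> B"
    using continuous_on_Icc_norm_bounded[OF h] by blast
  show ?thesis
  proof (rule measurable_bounded_by_integrable_imp_integrable_real)
    show "(\<lambda>t. g t \<bullet> h t) \<in> borel_measurable (lebesgue_on {u..v})"
      by (rule measurable_inner_continuous[OF g h])
    show "(\<lambda>t. B * m t) integrable_on {u..v}"
      by (rule loc_int_integrable[OF loc_int_cmult[OF m(1)] u])
    fix t assume t: "t \<in> {u..v}"
    then have "0 < t" using u by simp
    from abs_inner_le[OF m(2)[OF this] B[OF t]]
    show "\<bar>g t \<bullet> h t\<bar> \<le> B * m t" by (simp add: mult.commute)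
  qed simp
qed

lemma integrable_inner_continuous:
  assumes g: "\<And>x. (\<lambda>t. g t \<bullet> x) \<in> borel_measurable (lebesgue_on {u..v})"
    and m: "loc_int m" "\<And>t. 0 < t \<Longrightarrow> norm (g t) \<le> m t"
    and h: "continuous_on {0<..} h" and u: "0 < u"
  shows "(\<lambda>t. g t \<bullet> h t) integrable_on {u..v}"
  by (rule integrable_inner_continuous_Icc[OF g m continuous_on_subset[OF h] u]) (use u in auto)

lemma wac_measurable:
  assumes "wac f g" "0 < u"
  shows "(\<lambda>t. g t \<bullet> x) \<in> borel_measurable (lebesgue_on {u..v})"
proof (cases "u \<le> v")
  case True
  show ?thesis
    by (rule integrable_imp_measurable[OF has_integral_integrable[OF wac_has_integral[OF assms True]]])
next
  case False
  then have "(\<lambda>t. g t \<bullet> x) integrable_on {u..v}" by (simp add: integrable_on_empty)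
  then show ?thesis by (rule integrable_imp_measurable)
qed

lemma wac_realI:
  fixes F G :: "real \<Rightarrow> real"
  assumes "loc_int m" "\<And>t. 0 < t \<Longrightarrow> \<bar>G t\<bar> \<le> m t"
    "\<And>u v. 0 < u \<Longrightarrow> u \<le> v \<Longrightarrow> (G has_integral (F v - F u)) {u..v}"
  shows "wac F G"
  unfolding wac_def using assms by (auto intro: has_integral_mult_left)

lemma wac_real_has_integral:
  fixes F G :: "real \<Rightarrow> real"
  assumes "wac F G" "0 < u" "u \<le> v"
  shows "(G has_integral (F v - F u)) {u..v}"
  using wac_has_integral[OF assms, of 1] by simp

lemma wac_real_loc_int:
  fixes F G :: "real \<Rightarrow> real"
  assumes "wac F G"
  shows "loc_int G"
proof -
  obtain m where m: "loc_int m" "\<And>t. 0 < t \<Longrightarrow> norm (G t) \<le> m t" using wac_dominated[OF assms] by blast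
  show ?thesis
  proof (rule loc_int_bounded_by[OF _ m(1)])
    show "G integrable_on {u..v}" if "0 < u" for u v
      using wac_real_has_integral[OF assms that, of v] by (cases "u \<le> v") (auto simp: integrable_on_empty)
  qed (use m in simp)
qed

text \<open>On a short interval \<open>{s..t}\<close> the increment of the product is exactly the
  integral of \<open>g \<bullet> h s + k \<bullet> f t\<close>, one factor being frozen at the left
  end and the other at the right end. Unfreezing costs at most the integral of
  \<open>e * (m + m')\<close> by uniform continuity, and \<open>telescoping_zero\<close> disposes of
  these errors.\<close>

lemma wac_inner:
  fixes f h :: "real \<Rightarrow> 'a::real_inner"
  assumes fg: "wac f g" and hk: "wac h k"
  shows "wac (\<lambda>t. f t \<bullet> h t) (\<lambda>t. g t \<bullet> h t + f t \<bullet> k t)"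
proof -
  obtain m where m: "loc_int m" "\<And>t. 0 < t \<Longrightarrow> norm (g t) \<le> m t" using wac_dominated[OF fg] by blast
  obtain m' where m': "loc_int m'" "\<And>t. 0 < t \<Longrightarrow> norm (k t) \<le> m' t" using wac_dominated[OF hk] by blast
  note cf = wac_continuous[OF fg] and ch = wac_continuous[OF hk]
  note mf = wac_measurable[OF fg] and mh = wac_measurable[OF hk]
  let ?\<Phi> = "\<lambda>t. g t \<bullet> h t + f t \<bullet> k t"
  have int_gh: "(\<lambda>t. g t \<bullet> h t) integrable_on {u..v}" if "0 < u" for u v
    by (rule integrable_inner_continuous[OF mf[OF that] m ch that])
  have int_fk: "(\<lambda>t. f t \<bullet> k t) integrable_on {u..v}" if "0 < u" for u v
    using integrable_inner_continuous[OF mh[OF that] m' cf that] by (simp add: inner_commute)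
  have int: "?\<Phi> integrable_on {u..v}" if "0 < u" for u v
    using int_gh[OF that] int_fk[OF that] by (rule integrable_add)
  define M where "M = primitive (\<lambda>t. m t + m' t)"
  have M: "((\<lambda>t. m t + m' t) has_integral (M v - M u)) {u..v}" if "0 < u" "u \<le> v" for u v
    unfolding M_def using that by (rule primitive_has_integral[OF loc_int_add[OF m(1) m'(1)]])
  have key: "f v \<bullet> h v - f u \<bullet> h u = integral {u..v} ?\<Phi>" if uv: "0 < u" "u \<le> v" for u v
  proof -
    define J where "J t = f t \<bullet> h t - integral {u..t} ?\<Phi>" for t
    have "J v = J u"
    proof (rule telescoping_zero[OF uv(2), where M = M])
      fix e :: real assume e: "0 < e"
      have "uniformly_continuous_on {u..v} f" "uniformly_continuous_on {u..v} h"
        using cf ch uv by (auto intro!: compact_uniformly_continuous intro: continuous_on_subset)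
      note unif = this[unfolded uniformly_continuous_on_def, rule_format, OF e]
      obtain d where d: "0 < d" "\<And>s t. s \<in> {u..v} \<Longrightarrow> t \<in> {u..v} \<Longrightarrow> dist s t < d \<Longrightarrow> dist (f s) (f t) < e"
        using unif(1) by blast
      obtain d' where d': "0 < d'" "\<And>s t. s \<in> {u..v} \<Longrightarrow> t \<in> {u..v} \<Longrightarrow> dist s t < d' \<Longrightarrow> dist (h s) (h t) < e"
        using unif(2) by blast
      show "\<exists>d>0. \<forall>s t. u \<le> s \<and> s \<le> t \<and> t \<le> v \<and> t - s < d \<longrightarrow> \<bar>J t - J s\<bar> \<le> e * (M t - M s)"
      proof (intro exI[of _ "min d d'"] conjI allI impI)
        show "0 < min d d'" using d d' by simp
        fix s t assume "u \<le> s \<and> s \<le> t \<and> t \<le> v \<and> t - s < min d d'"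
        then have st: "u \<le> s" "s \<le> t" "t \<le> v" "t - s < d" "t - s < d'" by auto
        then have s0: "0 < s" using uv by simp
        have 1: "((\<lambda>\<tau>. g \<tau> \<bullet> h s) has_integral (f t - f s) \<bullet> h s) {s..t}" by (rule wac_has_integral[OF fg s0 st(2)])
        have 2: "((\<lambda>\<tau>. k \<tau> \<bullet> f t) has_integral (h t - h s) \<bullet> f t) {s..t}" by (rule wac_has_integral[OF hk s0 st(2)])
        have 3: "(?\<Phi> has_integral integral {s..t} ?\<Phi>) {s..t}" using int[OF s0] by (rule integrable_integral)
        have hi: "((\<lambda>\<tau>. (g \<tau> \<bullet> h s + k \<tau> \<bullet> f t) - ?\<Phi> \<tau>) has_integral
            ((f t - f s) \<bullet> h s + (h t - h s) \<bullet> f t) - integral {s..t} ?\<Phi>) {s..t}"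
          by (intro has_integral_diff has_integral_add 1 2 3)
        have "integral {u..s} ?\<Phi> + integral {s..t} ?\<Phi> = integral {u..t} ?\<Phi>"
          by (rule Henstock_Kurzweil_Integration.integral_combine[OF st(1,2) int[OF uv(1)]])
        moreover have "(f t - f s) \<bullet> h s + (h t - h s) \<bullet> f t = f t \<bullet> h t - f s \<bullet> h s"
          by (simp add: inner_diff inner_commute)
        ultimately have "((f t - f s) \<bullet> h s + (h t - h s) \<bullet> f t) - integral {s..t} ?\<Phi> = J t - J s"
          unfolding J_def by linarith
        then have 4: "((\<lambda>\<tau>. (g \<tau> \<bullet> h s + k \<tau> \<bullet> f t) - ?\<Phi> \<tau>) has_integral (J t - J s)) {s..t}"
          using hi by (simp only:)
        have 5: "((\<lambda>\<tau>. e * (m \<tau> + m' \<tau>)) has_integral e * (M t - M s)) {s..t}"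
          by (rule has_integral_mult_right[OF M[OF s0 st(2)]])
        have "norm (integral {s..t} (\<lambda>\<tau>. (g \<tau> \<bullet> h s + k \<tau> \<bullet> f t) - ?\<Phi> \<tau>)) \<le> integral {s..t} (\<lambda>\<tau>. e * (m \<tau> + m' \<tau>))"
        proof (rule integral_norm_bound_integral)
          fix \<tau> assume \<tau>: "\<tau> \<in> {s..t}"
          then have t0: "0 < \<tau>" using s0 by auto
          have "norm (h s - h \<tau>) \<le> e" "norm (f t - f \<tau>) \<le> e"
            using d(2)[of t \<tau>] d'(2)[of s \<tau>] \<tau> st by (auto simp: dist_norm)
          note bds = abs_inner_le[OF m(2)[OF t0] this(1)] abs_inner_le[OF m'(2)[OF t0] this(2)]
          have "(g \<tau> \<bullet> h s + k \<tau> \<bullet> f t) - ?\<Phi> \<tau> = g \<tau> \<bullet> (h s - h \<tau>) + k \<tau> \<bullet> (f t - f \<tau>)"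
            by (simp add: inner_diff inner_commute)
          moreover have "e * (m \<tau> + m' \<tau>) = m \<tau> * e + m' \<tau> * e" by (simp add: distrib_left mult.commute)
          ultimately show "norm ((g \<tau> \<bullet> h s + k \<tau> \<bullet> f t) - ?\<Phi> \<tau>) \<le> e * (m \<tau> + m' \<tau>)"
            using bds unfolding real_norm_def by linarith
        qed (use 4 5 in \<open>auto dest: has_integral_integrable\<close>)
        then show "\<bar>J t - J s\<bar> \<le> e * (M t - M s)"
          unfolding integral_unique[OF 4] integral_unique[OF 5] by simp
      qed
    qed
    then show ?thesis by (simp add: J_def)
  qed
  show ?thesis
  proof (rule wac_realI)
    show "loc_int (\<lambda>t. norm (h t) * m t + norm (f t) * m' t)"
      by (intro loc_int_add loc_int_continuous_mult m m' continuous_on_norm cf ch)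
    show "\<bar>?\<Phi> t\<bar> \<le> norm (h t) * m t + norm (f t) * m' t" if "0 < t" for t
    proof -
      have 1: "\<bar>g t \<bullet> h t\<bar> \<le> m t * norm (h t)" by (rule abs_inner_le[OF m(2)[OF that] order_refl])
      have 2: "\<bar>f t \<bullet> k t\<bar> \<le> norm (f t) * m' t" by (rule abs_inner_le[OF order_refl m'(2)[OF that]])
      have "\<bar>?\<Phi> t\<bar> \<le> \<bar>g t \<bullet> h t\<bar> + \<bar>f t \<bullet> k t\<bar>" by (rule abs_triangle_ineq)
      also have "\<dots> \<le> m t * norm (h t) + norm (f t) * m' t" by (rule add_mono[OF 1 2])
      finally show ?thesis by (simp only: mult.commute[of "m t"])
    qed
    show "(?\<Phi> has_integral (f v \<bullet> h v - f u \<bullet> h u)) {u..v}" if "0 < u" "u \<le> v" for u v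
      using key[OF that] int[OF that(1)] by (simp add: integrable_integral)
  qed
qed

section \<open>Calculus rules for real-valued absolutely continuous functions\<close>

lemma wac_mult:
  fixes f h :: "real \<Rightarrow> real"
  shows "wac f g \<Longrightarrow> wac h k \<Longrightarrow> wac (\<lambda>t. f t * h t) (\<lambda>t. g t * h t + f t * k t)"
  using wac_inner[of f g h k] by simp

lemma wac_lincomb:
  fixes F H :: "real \<Rightarrow> real"
  assumes "wac F G" "wac H K"
  shows "wac (\<lambda>t. F t + c * H t) (\<lambda>t. G t + c * K t)"
proof (rule wac_realI)
  show "loc_int (\<lambda>t. \<bar>G t + c * K t\<bar>)"
    by (intro loc_int_abs loc_int_add loc_int_cmult wac_real_loc_int[OF assms(1)] wac_real_loc_int[OF assms(2)])
  show "((\<lambda>t. G t + c * K t) has_integral (F v + c * H v - (F u + c * H u))) {u..v}" if "0 < u" "u \<le> v" for u v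
    using has_integral_add[OF wac_real_has_integral[OF assms(1) that]
        has_integral_mult_right[OF wac_real_has_integral[OF assms(2) that], of c]]
    by (simp add: algebra_simps)
qed simp

lemma wac_add:
  fixes F H :: "real \<Rightarrow> real"
  shows "wac F G \<Longrightarrow> wac H K \<Longrightarrow> wac (\<lambda>t. F t + H t) (\<lambda>t. G t + K t)"
  using wac_lincomb[of F G H K 1] by simp

lemma wac_diff:
  fixes F H :: "real \<Rightarrow> real"
  shows "wac F G \<Longrightarrow> wac H K \<Longrightarrow> wac (\<lambda>t. F t - H t) (\<lambda>t. G t - K t)"
  using wac_lincomb[of F G H K "- 1"] by simp

lemma wac_C1:
  fixes F G :: "real \<Rightarrow> real"
  assumes "\<And>t. 0 < t \<Longrightarrow> (F has_real_derivative G t) (at t)" "continuous_on {0<..} G"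
  shows "wac F G"
proof (rule wac_realI)
  show "loc_int (\<lambda>t. \<bar>G t\<bar>)" using assms(2) by (intro loc_int_abs loc_int_continuous)
  show "(G has_integral (F v - F u)) {u..v}" if "0 < u" "u \<le> v" for u v
    using that assms(1)
    by (intro fundamental_theorem_of_calculus)
       (auto simp: has_real_derivative_iff_has_vector_derivative[symmetric] intro: has_field_derivative_at_within)
qed auto

lemma wac_mono:
  fixes F G :: "real \<Rightarrow> real"
  assumes "wac F G" "AE t in half_line. a \<le> t \<longrightarrow> 0 \<le> G t" "0 < a" "a \<le> u" "u \<le> v"
  shows "F u \<le> F v"
proof -
  have neg: "negligible {t. 0 < t \<and> \<not> (a \<le> t \<longrightarrow> 0 \<le> G t)}" using assms(2) by (simp add: AE_half_line_iff)
  have "((\<lambda>t. max 0 (G t)) has_integral (F v - F u)) {u..v}"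
    by (rule has_integral_spike[OF neg _ wac_real_has_integral[OF assms(1)]]) (use assms in auto)
  then have "0 \<le> F v - F u" by (rule has_integral_nonneg) auto
  then show ?thesis by simp
qed

text \<open>Since \<open>f\<close> has integral zero over every interval, the sums controlled by
  Henstock's lemma are Riemann sums of \<open>\<bar>f\<bar>\<close>. Thus
  \<open>\<bar>f\<bar>\<close> has integral zero on each \<open>{u..v}\<close>, and countably many
  such intervals exhaust the half-line.\<close>

lemma AE_zero_if_integrals_zero:
  fixes f :: "real \<Rightarrow> real"
  assumes "\<And>u v. 0 < u \<Longrightarrow> u \<le> v \<Longrightarrow> (f has_integral 0) {u..v}"
  shows "AE t in half_line. f t = 0"
proof -
  have neg: "negligible {t \<in> {u..v}. f t \<noteq> 0}" if "0 < u" "u \<le> v" for u v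
  proof -
    have "((\<lambda>t. norm (f t)) has_integral 0) (cbox u v)"
      unfolding has_integral
    proof (intro allI impI)
      fix e :: real assume "0 < e"
      have "f integrable_on cbox u v" using assms[OF that] by auto
      then obtain \<gamma> where \<gamma>: "gauge \<gamma>"
        "\<And>p. p tagged_partial_division_of cbox u v \<Longrightarrow> \<gamma> fine p \<Longrightarrow>
          (\<Sum>(x,k)\<in>p. norm (measure lborel k *\<^sub>R f x - integral k f)) < e"
        by (rule Henstock_lemma[OF _ \<open>0 < e\<close>]) (rule that; assumption?; simp?)
      show "\<exists>\<gamma>. gauge \<gamma> \<and> (\<forall>\<D>. \<D> tagged_division_of cbox u v \<and> \<gamma> fine \<D> \<longrightarrow>
          norm ((\<Sum>(x, k)\<in>\<D>. measure lborel k *\<^sub>R norm (f x)) - 0) < e)"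
      proof (intro exI[of _ \<gamma>] conjI allI impI \<gamma>(1), elim conjE)
        fix p assume p: "p tagged_division_of cbox u v" "\<gamma> fine p"
        have "(\<Sum>(x, k)\<in>p. measure lborel k *\<^sub>R norm (f x)) = (\<Sum>(x,k)\<in>p. norm (measure lborel k *\<^sub>R f x - integral k f))"
        proof (intro sum.cong refl, clarify)
          fix x K assume xK: "(x, K) \<in> p"
          then obtain a b where K: "K = {a..b}" using tagged_division_ofD(4)[OF p(1)] by (metis cbox_interval)
          moreover have "K \<subseteq> {u..v}" "x \<in> K"
            using tagged_division_ofD(2,3)[OF p(1) xK] by auto
          ultimately have "0 < a" "a \<le> b" using that by auto
          then have "integral K f = 0" using assms K by (auto intro: integral_unique)
          then show "measure lborel K *\<^sub>R norm (f x) = norm (measure lborel K *\<^sub>R f x - integral K f)"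
            by (simp add: abs_mult)
        qed
        also have "\<dots> < e" using \<gamma>(2)[OF _ p(2)] p(1) by (auto simp: tagged_division_of_def)
        finally have lt: "(\<Sum>(x, k)\<in>p. measure lborel k *\<^sub>R norm (f x)) < e" .
        have "0 \<le> (\<Sum>(x, k)\<in>p. measure lborel k *\<^sub>R norm (f x))" by (intro sum_nonneg) auto
        with lt show "norm ((\<Sum>(x, k)\<in>p. measure lborel k *\<^sub>R norm (f x)) - 0) < e" by simp
      qed
    qed
    then have I: "((\<lambda>t. norm (f t)) has_integral 0) {u..v}" by simp
    then have "(\<lambda>t. norm (f t)) absolutely_integrable_on {u..v}"
      by (intro nonnegative_absolutely_integrable_1) auto
    then have "integrable (lebesgue_on {u..v}) (\<lambda>t. norm (f t))" "integral\<^sup>L (lebesgue_on {u..v}) (\<lambda>t. norm (f t)) = 0"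
      using I by (simp_all add: lebesgue_integral_eq_integral integral_unique set_integrable_def integrable_restrict_space)
    then have "AE t in lebesgue_on {u..v}. norm (f t) = 0"
      using integral_nonneg_eq_0_iff_AE[of "lebesgue_on {u..v}" "\<lambda>t. norm (f t)"] by auto
    then have "AE t in lebesgue. t \<in> {u..v} \<longrightarrow> norm (f t) = 0"
      by (subst (asm) AE_restrict_space_iff) auto
    then have "\<exists>N. negligible N \<and> {t. \<not> (t \<in> {u..v} \<longrightarrow> norm (f t) = 0)} \<subseteq> N"
      by (simp only: eventually_ae_filter_negligible)
    then show ?thesis by (auto intro: negligible_subset)
  qed
  then have "negligible (\<Union>n. {t \<in> {1 / real (Suc n)..real (Suc n)}. f t \<noteq> 0})"
  proof (intro negligible_countable_Union)
    fix S assume "S \<in> range (\<lambda>n. {t \<in> {1 / real (Suc n)..real (Suc n)}. f t \<noteq> 0})"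
    then obtain n where S: "S = {t \<in> {1 / real (Suc n)..real (Suc n)}. f t \<noteq> 0}" by blast
    have "1 / real (Suc n) \<le> 1" "1 \<le> real (Suc n)" by simp_all
    then have "1 / real (Suc n) \<le> real (Suc n)" by linarith
    then show "negligible S" unfolding S by (intro neg) simp_all
  qed simp
  moreover have "{t. 0 < t \<and> f t \<noteq> 0} \<subseteq> (\<Union>n. {t \<in> {1 / real (Suc n)..real (Suc n)}. f t \<noteq> 0})"
  proof
    fix t assume "t \<in> {t. 0 < t \<and> f t \<noteq> 0}"
    then have t: "0 < t" "f t \<noteq> 0" by auto
    obtain n where n: "t + 1 / t < real n" using reals_Archimedean2 by blast
    have "0 < 1 / t" using t by simp
    then have "t \<le> real (Suc n)" "1 / t \<le> real (Suc n)" using n t by linarith+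
    then have "t \<in> {1 / real (Suc n)..real (Suc n)}" using t by (simp add: divide_le_eq mult.commute)
    then show "t \<in> (\<Union>n. {t \<in> {1 / real (Suc n)..real (Suc n)}. f t \<noteq> 0})" using t by blast
  qed
  ultimately have "negligible {t. 0 < t \<and> f t \<noteq> 0}" by (rule negligible_subset)
  then show ?thesis by (simp add: AE_half_line_iff)
qed

section \<open>Weak derivatives\<close>

text \<open>The support of a test function fits into such an interval, so integrals over intervals
  can replace those over the half-line. As \<open>integral\<close> is 0 on non-integrable functions,
  integrability has to be supplied separately.\<close>

definition weak_der :: "(real \<Rightarrow> real) \<Rightarrow> (real \<Rightarrow> real) \<Rightarrow> bool" where
  "weak_der f g \<longleftrightarrow> (\<forall>\<eta> u v. test_function \<eta> \<longrightarrow> 0 < u \<longrightarrow> (\<forall>t. t \<notin> {u<..<v} \<longrightarrow> \<eta> t = 0) \<longrightarrow>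
     integral {u..v} (\<lambda>t. deriv \<eta> t * f t) = - integral {u..v} (\<lambda>t. \<eta> t * g t))"

lemma integral_eq_on_support:
  fixes h :: "real \<Rightarrow> real"
  assumes "c \<le> a" "b \<le> d" "\<And>t. t \<notin> {a..b} \<Longrightarrow> h t = 0"
  shows "integral {c..d} h = integral {a..b} h"
proof (rule integral_spike_set)
  show "negligible {x \<in> {c..d} - {a..b}. h x \<noteq> 0}" "negligible {x \<in> {a..b} - {c..d}. h x \<noteq> 0}"
    using assms by (auto intro!: negligible_subset[OF negligible_empty])
qed

lemma wac_test_function:
  assumes "test_function \<eta>"
  shows "wac \<eta> (deriv \<eta>)"
  using assms by (intro wac_C1 test_function_has_derivative test_function_continuous test_function_deriv)

section \<open>Bump functions as approximate indicators\<close>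

lemma isCont_bump: "0 < c \<Longrightarrow> isCont (bump a b c p m) t"
  using bump_has_derivative DERIV_isCont by blast

lemma integral_bump_pos:
  assumes "a < b"
  shows "0 < integral {a..b} (bump a b 1 1 0)"
proof -
  have cont: "continuous_on {a..b} (bump a b 1 1 0)"
    by (intro continuous_at_imp_continuous_on ballI isCont_bump) simp
  have nn: "0 \<le> bump a b 1 1 0 t" for t by (simp add: bump_def)
  have "bump a b 1 1 0 ((a + b) / 2) \<noteq> 0" using assms by (simp add: bump_def)
  moreover have "(a + b) / 2 \<in> {a..b}" using assms by simp
  ultimately have "integral {a..b} (bump a b 1 1 0) \<noteq> 0"
    using integral_eq_0_iff[OF cont assms nn] by blast
  moreover have "0 \<le> integral {a..b} (bump a b 1 1 0)"
    by (intro integral_nonneg integrable_continuous_real cont nn)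
  ultimately show ?thesis by simp
qed

text \<open>As \<open>c\<close> tends to 0, the bumps \<open>exp (- c / ((t - a) * (b - t)))\<close>
  stay between 0 and 1 and tend to 1 inside the interval, so dominated convergence applies with
  majorant \<open>\<bar>F\<bar>\<close>.\<close>

lemma integral_bump_tendsto:
  fixes F :: "real \<Rightarrow> real"
  assumes "F absolutely_integrable_on {a..b}"
  shows "(\<lambda>n. integral {a..b} (\<lambda>t. bump a b (1 / real (Suc n)) 1 0 t * F t)) \<longlonglongrightarrow> integral {a..b} F"
proof -
  let ?\<kappa> = "\<lambda>n. bump a b (1 / real (Suc n)) 1 0"
  have F: "F absolutely_integrable_on {a<..<b}" using assms by (simp add: absolutely_integrable_on_Icc_iff_Ioo)
  have cont: "continuous_on {a<..<b} (?\<kappa> n)" for n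
    by (intro continuous_at_imp_continuous_on ballI isCont_bump) simp
  have bd: "0 \<le> ?\<kappa> n t \<and> ?\<kappa> n t \<le> 1" for n t
    by (auto simp: bump_def divide_nonneg_pos)
  have prod: "(\<lambda>t. ?\<kappa> n t * F t) absolutely_integrable_on {a<..<b}" for n
  proof (rule absolutely_integrable_bounded_measurable_product_real)
    show "?\<kappa> n \<in> borel_measurable (lebesgue_on {a<..<b})"
      using cont by (rule continuous_imp_measurable_on_sets_lebesgue) simp
    show "bounded (?\<kappa> n ` {a<..<b})" using bd by (intro boundedI[of _ 1]) auto
  qed (use F in auto)
  have "(\<lambda>n. integral {a<..<b} (\<lambda>t. ?\<kappa> n t * F t)) \<longlonglongrightarrow> integral {a<..<b} F"
  proof (rule dominated_convergence(2))
    show "(\<lambda>t. ?\<kappa> n t * F t) integrable_on {a<..<b}" for n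
      using prod absolutely_integrable_on_def by blast
    show "(\<lambda>t. norm (F t)) integrable_on {a<..<b}"
      using F absolutely_integrable_on_def by blast
    show "norm (?\<kappa> n t * F t) \<le> norm (F t)" for n t
      using bd[of n t] by (simp add: abs_mult mult_left_le_one_le)
    fix t assume t: "t \<in> {a<..<b}"
    have "(\<lambda>n. exp (- (1 / real (Suc n)) / ((t - a) * (b - t))) * F t) \<longlonglongrightarrow> exp (- 0 / ((t - a) * (b - t))) * F t"
      using LIMSEQ_inverse_real_of_nat t by (intro tendsto_intros) (auto simp: inverse_eq_divide)
    then show "(\<lambda>n. ?\<kappa> n t * F t) \<longlonglongrightarrow> F t" using t by (simp add: bump_def)
  qed
  then show ?thesis by (simp only: integral_open_interval_real)
qed

text \<open>
  The lemma of du Bois-Reymond. Subtracting a primitive of \<open>g\<close> reduces it to \<open>g = 0\<close>; a bump function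
  minus a multiple of a fixed one is then an admissible derivative of a test function, and bump
  functions approximate indicators of intervals.
\<close>

lemma du_bois_reymond:
  assumes f: "loc_int f" and weak: "weak_der f g" and G: "wac G g"
  shows "\<exists>k. AE t in half_line. f t = G t + k"
proof -
  have g: "loc_int g" using wac_real_loc_int[OF G] .
  define F where "F t = f t - G t" for t
  have contG: "continuous_on {0<..} G" by (rule wac_continuous[OF G])
  have "loc_int (\<lambda>t. f t + (-1) * G t)"
    by (intro loc_int_add f loc_int_cmult loc_int_continuous contG)
  then have F: "loc_int F" by (simp add: F_def[abs_def])
  have zero: "integral {u..v} (\<lambda>t. deriv \<eta> t * F t) = 0"
    if \<eta>: "test_function \<eta>" and uv: "0 < u" "u < v" and supp: "\<And>t. t \<notin> {u<..<v} \<Longrightarrow> \<eta> t = 0" for \<eta> u v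
  proof -
    have cont: "continuous_on {0<..} \<eta>" "continuous_on {0<..} (deriv \<eta>)"
      using \<eta> test_function_continuous test_function_deriv by blast+
    have "((\<lambda>t. g t * \<eta> t + G t * deriv \<eta> t) has_integral (G v * \<eta> v - G u * \<eta> u)) {u..v}"
      using uv by (intro wac_real_has_integral[OF wac_mult[OF G wac_test_function[OF \<eta>]]]) auto
    then have 1: "((\<lambda>t. \<eta> t * g t + deriv \<eta> t * G t) has_integral 0) {u..v}"
      using supp[of u] supp[of v] by (simp add: mult.commute)
    have int: "(\<lambda>t. deriv \<eta> t * f t) integrable_on {u..v}" "(\<lambda>t. \<eta> t * g t) integrable_on {u..v}"
      "(\<lambda>t. deriv \<eta> t * G t) integrable_on {u..v}"
      by (rule loc_int_integrable[OF loc_int_continuous_mult[OF f cont(2)] uv(1)]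
          loc_int_integrable[OF loc_int_continuous_mult[OF g cont(1)] uv(1)]
          loc_int_integrable[OF loc_int_continuous_mult[OF loc_int_continuous[OF contG] cont(2)] uv(1)])+
    have "integral {u..v} (\<lambda>t. deriv \<eta> t * F t) = integral {u..v} (\<lambda>t. deriv \<eta> t * f t) - integral {u..v} (\<lambda>t. deriv \<eta> t * G t)"
      using integral_diff[OF int(1,3)] by (simp add: F_def right_diff_distrib)
    also have "integral {u..v} (\<lambda>t. deriv \<eta> t * f t) = - integral {u..v} (\<lambda>t. \<eta> t * g t)"
      using weak \<eta> uv(1) supp unfolding weak_der_def by blast
    also have "- integral {u..v} (\<lambda>t. \<eta> t * g t) - integral {u..v} (\<lambda>t. deriv \<eta> t * G t) = 0"
      using integral_unique[OF 1] integral_add[OF int(2,3)] by simp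
    finally show ?thesis .
  qed
  \<comment> \<open>The fixed bump \<open>\<theta>\<close> corrects the mean of every other bump;
    \<open>c\<close>, the mean of \<open>F\<close> weighted by \<open>\<theta>\<close>, is then the
    only possible value of the constant.\<close>
  define \<theta> where "\<theta> = bump 1 2 1 1 0"
  define I where "I = integral {1..2} \<theta>"
  have I: "0 < I" using integral_bump_pos[of 1 2] by (simp add: I_def \<theta>_def)
  define c where "c = integral {1..2} (\<lambda>t. \<theta> t * F t) / I"
  have key: "integral {a..b} F = c * (b - a)" if ab: "0 < a" "a < b" for a b
  proof -
    define lo where "lo = min a 1"
    define hi where "hi = max b 2"
    have lh: "0 < lo" "lo < hi" "lo \<le> a" "lo \<le> 1" "b \<le> hi" "2 \<le> hi" using ab by (auto simp: lo_def hi_def)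
    let ?\<kappa> = "\<lambda>n. bump a b (1 / real (Suc n)) 1 0"
    have supp\<kappa>: "?\<kappa> n t = 0" if "t \<notin> {a..b}" for n t using that by (auto simp: bump_def)
    have supp\<theta>: "\<theta> t = 0" if "t \<notin> {1..2}" for t using that by (auto simp: bump_def \<theta>_def)
    have "isCont (?\<kappa> n) t" for n t
      by (intro isCont_bump) simp
    then have cont\<kappa>: "continuous_on S (?\<kappa> n)" for n S by (simp add: continuous_at_imp_continuous_on)
    have "isCont \<theta> t" for t unfolding \<theta>_def by (intro isCont_bump) simp
    then have cont\<theta>: "continuous_on S \<theta>" for S by (simp add: continuous_at_imp_continuous_on)
    have eq: "integral {a..b} (\<lambda>t. ?\<kappa> n t * F t) = c * integral {a..b} (\<lambda>t. ?\<kappa> n t * 1)" for n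
    proof -
      define d where "d = integral {a..b} (?\<kappa> n) / I"
      define w where "w t = ?\<kappa> n t - d * \<theta> t" for t
      have w: "w \<in> bump_combinations"
        unfolding bump_combinations_def w_def[abs_def] \<theta>_def
        by (intro CollectI exI conjI) (rule refl, simp_all)
      have "integral {lo..hi} w = integral {lo..hi} (?\<kappa> n) - d * integral {lo..hi} \<theta>"
        unfolding w_def using integrable_continuous_real[OF cont\<kappa>] integrable_continuous_real[OF cont\<theta>]
        by (subst integral_diff) (auto intro: integrable_on_mult_right)
      also have "integral {lo..hi} (?\<kappa> n) = integral {a..b} (?\<kappa> n)"
        using lh supp\<kappa> by (intro integral_eq_on_support) auto
      also have "integral {lo..hi} \<theta> = I"
        unfolding I_def using lh supp\<theta> by (intro integral_eq_on_support) auto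
      finally have "integral {lo..hi} w = 0" using I by (simp add: d_def)
      moreover have "w t = 0" if "t \<notin> {lo..hi}" for t
        using supp\<kappa>[of t n] supp\<theta>[of t] that lh by (auto simp: w_def)
      ultimately obtain \<eta> where \<eta>: "test_function \<eta>" "\<And>t. (\<eta> has_real_derivative w t) (at t)"
          "\<And>t. t \<notin> {lo<..<hi} \<Longrightarrow> \<eta> t = 0"
        using test_function_antiderivative[OF w lh(1,2)] by metis
      have "deriv \<eta> = w" using \<eta>(2) DERIV_imp_deriv by blast
      then have "0 = integral {lo..hi} (\<lambda>t. w t * F t)" using zero[OF \<eta>(1) lh(1,2) \<eta>(3)] by simp
      also have "\<dots> = integral {lo..hi} (\<lambda>t. ?\<kappa> n t * F t - d * (\<theta> t * F t))"
        by (simp add: w_def algebra_simps)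
      also have "\<dots> = integral {lo..hi} (\<lambda>t. ?\<kappa> n t * F t) - d * integral {lo..hi} (\<lambda>t. \<theta> t * F t)"
        using loc_int_integrable[OF loc_int_continuous_mult[OF F cont\<kappa>] lh(1)]
          loc_int_integrable[OF loc_int_continuous_mult[OF F cont\<theta>] lh(1)]
        by (subst integral_diff) (auto intro: integrable_on_mult_right)
      also have "integral {lo..hi} (\<lambda>t. ?\<kappa> n t * F t) = integral {a..b} (\<lambda>t. ?\<kappa> n t * F t)"
        using lh supp\<kappa> by (intro integral_eq_on_support) auto
      also have "integral {lo..hi} (\<lambda>t. \<theta> t * F t) = integral {1..2} (\<lambda>t. \<theta> t * F t)"
        using lh supp\<theta> by (intro integral_eq_on_support) auto
      finally show ?thesis using I by (simp add: d_def c_def)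
    qed
    have "(\<lambda>n. integral {a..b} (\<lambda>t. ?\<kappa> n t * F t)) \<longlonglongrightarrow> integral {a..b} F"
      by (rule integral_bump_tendsto[OF loc_intD[OF F ab(1)]])
    moreover have "(\<lambda>n. c * integral {a..b} (\<lambda>t. ?\<kappa> n t * 1)) \<longlonglongrightarrow> c * integral {a..b} (\<lambda>t. 1)"
      by (intro tendsto_mult tendsto_const integral_bump_tendsto) simp
    ultimately have "integral {a..b} F = c * integral {a..b} (\<lambda>t. 1)"
      unfolding eq using LIMSEQ_unique by blast
    then show ?thesis using ab by simp
  qed
  have "AE t in half_line. F t - c = 0"
  proof (rule AE_zero_if_integrals_zero)
    fix u v :: real assume uv: "0 < u" "u \<le> v"
    have "((\<lambda>t. F t - c) has_integral (integral {u..v} F - c * (v - u))) {u..v}"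
      using uv by (intro has_integral_diff integrable_integral loc_int_integrable F)
        (use has_integral_const_real[of c u v] in \<open>auto simp: mult.commute\<close>)
    then show "((\<lambda>t. F t - c) has_integral 0) {u..v}"
      using key[of u v] uv by (cases "u = v") auto
  qed
  then have "AE t in half_line. f t = G t + c" by eventually_elim (simp add: F_def)
  then show ?thesis by blast
qed

lemma AE_half_line_dense:
  assumes "AE t in half_line. P t" "0 < t"
  obtains \<tau> where "\<And>n. 0 < \<tau> n" "\<And>n. P (\<tau> n)" "\<tau> \<longlonglongrightarrow> t"
proof -
  have neg: "negligible {t. 0 < t \<and> \<not> P t}" using assms(1) by (simp add: AE_half_line_iff)
  have "\<exists>s. t < s \<and> s < t + 1 / real (Suc n) \<and> P s" for n
  proof (rule ccontr)
    assume "\<not> (\<exists>s. t < s \<and> s < t + 1 / real (Suc n) \<and> P s)"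
    then have "{t<..<t + 1 / real (Suc n)} \<subseteq> {t. 0 < t \<and> \<not> P t}" using assms(2) by auto
    then have "negligible {t<..<t + 1 / real (Suc n)}" using neg negligible_subset by blast
    then have "{t<..<t + 1 / real (Suc n)} = {}" using open_not_negligible open_greaterThanLessThan by blast
    then show False by (simp add: not_less)
  qed
  then obtain \<tau> where \<tau>: "\<And>n. t < \<tau> n" "\<And>n. \<tau> n < t + 1 / real (Suc n)" "\<And>n. P (\<tau> n)" by metis
  have "\<tau> \<longlonglongrightarrow> t"
  proof (rule tendsto_sandwich[of "\<lambda>n. t" _ _ "\<lambda>n. t + 1 / real (Suc n)"])
    show "(\<lambda>n. t + 1 / real (Suc n)) \<longlonglongrightarrow> t"
      using tendsto_add[OF tendsto_const LIMSEQ_inverse_real_of_nat, of t] by (simp add: inverse_eq_divide)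
  qed (use \<tau> less_imp_le in \<open>blast intro: always_eventually tendsto_const\<close>)+
  then show ?thesis using that[of \<tau>] \<tau> assms(2) less_trans by blast
qed

lemma continuous_AE_eq:
  fixes f g :: "real \<Rightarrow> 'b::t2_space"
  assumes "continuous_on {0<..} f" "continuous_on {0<..} g" "AE t in half_line. f t = g t" "0 < t"
  shows "f t = g t"
proof -
  obtain \<tau> where \<tau>: "\<And>n. 0 < \<tau> n" "\<And>n. f (\<tau> n) = g (\<tau> n)" "\<tau> \<longlonglongrightarrow> t"
    using AE_half_line_dense[OF assms(3,4)] by blast
  have "(\<lambda>n. f (\<tau> n)) \<longlonglongrightarrow> f t" "(\<lambda>n. g (\<tau> n)) \<longlonglongrightarrow> g t"
    using \<tau>(1) assms(4)
    by (auto intro!: continuous_on_tendsto_compose[OF assms(1) \<tau>(3)] continuous_on_tendsto_compose[OF assms(2) \<tau>(3)])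
  then show ?thesis using \<tau>(2) LIMSEQ_unique by simp
qed

text \<open>
  Strong measurability confines \<open>f\<close> to the closure of a countable set, so that the scalar
  identities hold outside a single null set and bound the increments of \<open>f\<close> in norm.
\<close>

lemma weak_derivative_imp_wac:
  fixes f g :: "real \<Rightarrow> 'a::{real_inner,complete_space}"
  assumes sm: "strongly_measurable half_line f"
    and f_int: "\<And>x. loc_int (\<lambda>t. f t \<bullet> x)" and g_int: "\<And>x. loc_int (\<lambda>t. g t \<bullet> x)"
    and m: "loc_int m" "\<And>t. 0 < t \<Longrightarrow> norm (g t) \<le> m t"
    and weak: "\<And>x. weak_der (\<lambda>t. f t \<bullet> x) (\<lambda>t. g t \<bullet> x)"
  obtains h where "wac h g" "AE t in half_line. f t = h t"
proof -
  have "\<exists>F. wac F (\<lambda>t. g t \<bullet> x) \<and> (AE t in half_line. f t \<bullet> x = F t)" for x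
  proof -
    define G where "G = primitive (\<lambda>t. g t \<bullet> x)"
    have G: "((\<lambda>t. g t \<bullet> x) has_integral (G v - G u)) {u..v}" if "0 < u" "u \<le> v" for u v
      unfolding G_def using that by (rule primitive_has_integral[OF g_int])
    have wG: "wac (\<lambda>t. G t + k) (\<lambda>t. g t \<bullet> x)" for k
      by (rule wac_realI[OF loc_int_abs[OF g_int[of x]]]) (simp_all add: G)
    have "wac G (\<lambda>t. g t \<bullet> x)" using wG[of 0] by simp
    from du_bois_reymond[OF f_int[of x] weak[of x] this]
    obtain k where "AE t in half_line. f t \<bullet> x = G t + k" ..
    then show ?thesis by (intro exI[of _ "\<lambda>t. G t + k"] conjI wG)
  qed
  then obtain F where F: "\<And>x. wac (F x) (\<lambda>t. g t \<bullet> x)" "\<And>x. AE t in half_line. f t \<bullet> x = F x t" by metis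
  obtain s where s: "\<And>i::nat. simple_function half_line (s i)" "AE t in half_line. (\<lambda>i. s i t) \<longlonglongrightarrow> f t"
    using sm unfolding strongly_measurable_def by blast
  \<comment> \<open>The values of the approximating simple functions. Their differences form the
    countable set \<open>E\<close> of test vectors, which approximates the increments
    \<open>f v - f u\<close>, so each increment can be tested with itself in the limit.\<close>
  define D where "D = (\<Union>i. s i ` {0<..})"
  have "finite (s i ` {0<..})" for i using simple_functionD(1)[OF s(1)[of i]] by simp
  then have "countable D" unfolding D_def by (intro countable_UN) (auto intro: countable_finite)
  define E where "E = (\<lambda>(d, e). d - e) ` (D \<times> D)"
  have "countable E" unfolding E_def using \<open>countable D\<close> by (intro countable_image countable_SIGMA)
  then have "AE t in half_line. \<forall>x\<in>E. f t \<bullet> x = F x t" using F(2) by (simp add: AE_ball_countable)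
  define S where "S = {t. 0 < t \<and> (\<lambda>i. s i t) \<longlonglongrightarrow> f t \<and> (\<forall>x\<in>E. f t \<bullet> x = F x t)}"
  have AES: "AE t in half_line. t \<in> S"
    using s(2) \<open>AE t in half_line. \<forall>x\<in>E. f t \<bullet> x = F x t\<close> AE_space
    by eventually_elim (simp add: S_def)
  define M where "M = primitive m"
  have M: "\<And>u v. 0 < u \<Longrightarrow> u \<le> v \<Longrightarrow> (m has_integral (M v - M u)) {u..v}" "continuous_on {0<..} M"
    unfolding M_def by (auto intro: primitive_has_integral[OF m(1)] continuous_on_primitive[OF m(1)])
  have m0: "0 \<le> m t" if "0 < t" for t using m(2)[OF that] norm_ge_zero order_trans by blast
  have le: "norm (f v - f u) \<le> M v - M u" if uv: "u \<in> S" "v \<in> S" "u \<le> v" for u v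
  proof (rule norm_le_of_inner_self)
    have u0: "0 < u" using uv by (simp add: S_def)
    show M0: "0 \<le> M v - M u"
      by (rule has_integral_nonneg[OF M(1)[OF u0 uv(3)]]) (use m0 u0 in auto)
    have "(f v - f u) \<bullet> x \<le> norm x * (M v - M u)" if "x \<in> E" for x
    proof -
      have "(f v - f u) \<bullet> x = F x v - F x u" using uv that by (simp add: S_def inner_diff_left)
      also have "\<dots> \<le> norm x * (M v - M u)"
      proof (rule has_integral_le[OF wac_real_has_integral[OF F(1) u0 uv(3)]
            has_integral_mult_right[OF M(1)[OF u0 uv(3)]]])
        fix t assume "t \<in> {u..v}"
        then have "0 < t" using u0 by simp
        from abs_inner_le[OF m(2)[OF this] order_refl, of x]
        show "g t \<bullet> x \<le> norm x * m t" by (simp add: mult.commute)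
      qed
      finally show ?thesis .
    qed
    moreover have "s i t \<in> D" if "t \<in> S" for i t
      using that unfolding D_def S_def by blast
    then have "s i v - s i u \<in> E" for i
      unfolding E_def using uv by (intro image_eqI[of _ _ "(s i v, s i u)"]) auto
    ultimately have bd: "(f v - f u) \<bullet> (s i v - s i u) \<le> norm (s i v - s i u) * (M v - M u)" for i
      by blast
    have lim: "(\<lambda>i. s i v - s i u) \<longlonglongrightarrow> f v - f u"
      using uv by (intro tendsto_diff) (simp_all add: S_def)
    show "(f v - f u) \<bullet> (f v - f u) \<le> norm (f v - f u) * (M v - M u)"
    proof (rule LIMSEQ_le)
      show "(\<lambda>i. (f v - f u) \<bullet> (s i v - s i u)) \<longlonglongrightarrow> (f v - f u) \<bullet> (f v - f u)"
        by (intro tendsto_intros lim)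
      show "(\<lambda>i. norm (s i v - s i u) * (M v - M u)) \<longlonglongrightarrow> norm (f v - f u) * (M v - M u)"
        by (intro tendsto_intros lim)
    qed (use bd in blast)
  qed
  have dle: "dist (f u) (f v) \<le> \<bar>M u - M v\<bar>" if "u \<in> S" "v \<in> S" for u v
    using le[of u v] le[of v u] that by (cases "u \<le> v") (auto simp: dist_norm norm_minus_commute)
  \<comment> \<open>Extension by continuity: on \<open>S\<close> the increments of \<open>f\<close>
    are dominated by those of the continuous \<open>M\<close>, so \<open>f\<close> has a limit along
    a sequence from \<open>S\<close> at every positive time. These limits define
    \<open>h\<close>.\<close>
  have "\<exists>\<tau>. (\<forall>n. \<tau> n \<in> S) \<and> \<tau> \<longlonglongrightarrow> t" if "0 < t" for t
    using AE_half_line_dense[OF AES that] by metis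
  then obtain \<tau> where \<tau>: "\<And>t n. 0 < t \<Longrightarrow> \<tau> t n \<in> S" "\<And>t. 0 < t \<Longrightarrow> \<tau> t \<longlonglongrightarrow> t" by metis
  have M\<tau>: "(\<lambda>n. M (\<tau> t n)) \<longlonglongrightarrow> M t" if "0 < t" for t
  proof (rule continuous_on_tendsto_compose[OF M(2) \<tau>(2)[OF that]])
    show "\<forall>\<^sub>F n in sequentially. \<tau> t n \<in> {0<..}"
      using \<tau>(1)[OF that] by (simp add: S_def)
  qed (use that in simp)
  have "Cauchy (\<lambda>n. f (\<tau> t n))" if "0 < t" for t
  proof (rule metric_CauchyI)
    fix e :: real assume "0 < e"
    from metric_CauchyD[OF LIMSEQ_imp_Cauchy[OF M\<tau>[OF that]] this]
    obtain N where N: "\<forall>m\<ge>N. \<forall>n\<ge>N. dist (M (\<tau> t m)) (M (\<tau> t n)) < e" ..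
    show "\<exists>N. \<forall>m\<ge>N. \<forall>n\<ge>N. dist (f (\<tau> t m)) (f (\<tau> t n)) < e"
    proof (intro exI[of _ N] allI impI)
      fix m n assume "N \<le> m" "N \<le> n"
      then have "dist (M (\<tau> t m)) (M (\<tau> t n)) < e" using N by simp
      with dle[OF \<tau>(1)[OF that] \<tau>(1)[OF that], of m n]
      show "dist (f (\<tau> t m)) (f (\<tau> t n)) < e" by (simp add: dist_real_def)
    qed
  qed
  then have "\<exists>y. (\<lambda>n. f (\<tau> t n)) \<longlonglongrightarrow> y" if "0 < t" for t
    using that Cauchy_convergent_iff convergent_def by blast
  then obtain h where h: "\<And>t. 0 < t \<Longrightarrow> (\<lambda>n. f (\<tau> t n)) \<longlonglongrightarrow> h t" by metis
  have h_f: "dist (h t) (f u) \<le> \<bar>M t - M u\<bar>" if "0 < t" "u \<in> S" for t u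
  proof (rule LIMSEQ_le)
    show "(\<lambda>n. dist (f (\<tau> t n)) (f u)) \<longlonglongrightarrow> dist (h t) (f u)" by (intro tendsto_intros h that)
    show "(\<lambda>n. \<bar>M (\<tau> t n) - M u\<bar>) \<longlonglongrightarrow> \<bar>M t - M u\<bar>" by (intro tendsto_intros M\<tau> that)
  qed (use dle \<tau>(1) that in blast)
  have h_h: "dist (h t) (h u) \<le> \<bar>M t - M u\<bar>" if "0 < t" "0 < u" for t u
  proof (rule LIMSEQ_le)
    show "(\<lambda>n. dist (h t) (f (\<tau> u n))) \<longlonglongrightarrow> dist (h t) (h u)" by (intro tendsto_intros h that)
    show "(\<lambda>n. \<bar>M t - M (\<tau> u n)\<bar>) \<longlonglongrightarrow> \<bar>M t - M u\<bar>" by (intro tendsto_intros M\<tau> that)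
  qed (use h_f \<tau>(1) that in blast)
  have cont: "continuous_on {0<..} h" by (rule continuous_on_dominated[OF M(2) h_h]) auto
  have eq: "f t = h t" if "t \<in> S" for t
    using h_f[of t t] that by (simp add: S_def)
  have fh: "AE t in half_line. f t = h t" using AES by eventually_elim (rule eq)
  have "wac h g"
    unfolding wac_def
  proof (intro conjI exI[of _ m] allI impI m)
    fix x and u v :: real assume uv: "0 < u" "u \<le> v"
    have "AE t in half_line. h t \<bullet> x = F x t" using fh F(2)[of x] by eventually_elim simp
    then have "h t \<bullet> x = F x t" if "0 < t" for t
      using continuous_AE_eq[OF continuous_on_inner[OF cont continuous_on_const] wac_continuous[OF F(1)] _ that]
      by blast
    then have "(h v - h u) \<bullet> x = F x v - F x u" using uv by (simp add: inner_diff_left)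
    then show "((\<lambda>t. g t \<bullet> x) has_integral (h v - h u) \<bullet> x) {u..v}"
      using wac_real_has_integral[OF F(1) uv] by simp
  qed
  then show ?thesis using that fh by blast
qed

section \<open>Scalarization of the Bochner integral\<close>

lemma half_line_measurable_AE:
  fixes f g :: "real \<Rightarrow> real"
  assumes "f \<in> borel_measurable half_line" "AE t in half_line. f t = g t"
  shows "g \<in> borel_measurable half_line"
proof (rule borel_measurable_if_D)
  show "(\<lambda>t. if t \<in> {0<..} then g t else 0) \<in> borel_measurable lebesgue"
  proof (rule borel_measurable_AE)
    show "(\<lambda>t. if t \<in> {0<..} then f t else 0) \<in> borel_measurable lebesgue"
      by (rule borel_measurable_if_I[OF assms(1)]) simp
    have "AE t in lebesgue. t \<in> {0<..} \<longrightarrow> f t = g t"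
      using assms(2) by (subst (asm) AE_restrict_space_iff) simp_all
    then show "AE t in lebesgue. (if t \<in> {0<..} then f t else 0) = (if t \<in> {0<..} then g t else 0)"
      by eventually_elim simp
  qed
qed

lemma strongly_measurable_continuous_image:
  fixes f :: "real \<Rightarrow> 'a::real_normed_vector" and c :: "'a \<Rightarrow> real"
  assumes "strongly_measurable half_line f" "\<And>x. isCont c x"
  shows "(\<lambda>t. c (f t)) \<in> borel_measurable half_line"
proof -
  obtain s where s: "\<And>i::nat. simple_function half_line (s i)" "AE t in half_line. (\<lambda>i. s i t) \<longlonglongrightarrow> f t"
    using assms(1) unfolding strongly_measurable_def by blast
  have "(\<lambda>t. c (s i t)) \<in> borel_measurable half_line" for i
    by (intro borel_measurable_simple_function simple_function_compose1[where g = c] s)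
  then have "(\<lambda>t. lim (\<lambda>i. c (s i t))) \<in> borel_measurable half_line"
    by (rule borel_measurable_lim_metric)
  moreover have "AE t in half_line. lim (\<lambda>i. c (s i t)) = c (f t)"
    using s(2)
  proof eventually_elim
    case (elim t)
    then have "(\<lambda>i. c (s i t)) \<longlonglongrightarrow> c (f t)" using isCont_tendsto_compose assms(2) by blast
    then show ?case by (rule limI)
  qed
  ultimately show ?thesis by (rule half_line_measurable_AE)
qed

lemma strongly_measurable_norm:
  "strongly_measurable half_line f \<Longrightarrow> (\<lambda>t. norm (f t)) \<in> borel_measurable half_line"
  by (erule strongly_measurable_continuous_image) (intro continuous_intros)

lemma strongly_measurable_inner:
  "strongly_measurable half_line f \<Longrightarrow> (\<lambda>t. f t \<bullet> x) \<in> borel_measurable half_line"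
  by (erule strongly_measurable_continuous_image) (intro continuous_intros)

lemma half_line_measurable_subinterval:
  "f \<in> borel_measurable half_line \<Longrightarrow> 0 < u \<Longrightarrow> f \<in> borel_measurable (lebesgue_on {u..v})"
  by (erule measurable_restrict_mono) auto

lemma loc_int_measurable_bounded:
  fixes f :: "real \<Rightarrow> real"
  assumes "f \<in> borel_measurable half_line" "loc_int m" "\<And>t. 0 < t \<Longrightarrow> \<bar>f t\<bar> \<le> m t"
  shows "loc_int f"
  unfolding loc_int_def
proof (intro allI impI)
  fix u v :: real assume u: "0 < u"
  show "f absolutely_integrable_on {u..v}"
    by (rule measurable_bounded_by_integrable_imp_absolutely_integrable[OF
          half_line_measurable_subinterval[OF assms(1) u] _ loc_int_integrable[OF assms(2) u]])
      (use assms(3) u in auto)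
qed

lemma L2_loc_norm_loc_int:
  assumes "f \<in> L2_loc"
  shows "loc_int (\<lambda>t. norm (f t))"
  unfolding loc_int_def
proof (intro allI impI)
  fix u v :: real assume u: "0 < u"
  have "strongly_measurable half_line f" using assms by (simp add: L2_loc_def)
  then have meas: "(\<lambda>t. norm (f t)) \<in> borel_measurable (lebesgue_on {u..v})"
    using half_line_measurable_subinterval[OF strongly_measurable_norm u] by blast
  have "compact {u..v} \<and> {u..v} \<subseteq> {0<..}" using u by auto
  then have "(\<integral>\<^sup>+t\<in>{u..v}. ennreal ((norm (f t))\<^sup>2) \<partial>lebesgue) < \<infinity>"
    using assms by (simp add: L2_loc_def)
  then have "integrable (lebesgue_on {u..v}) (\<lambda>t. (norm (f t))\<^sup>2)"
    using meas by (intro integrableI_bounded) (simp_all add: nn_integral_restrict_space)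
  then have "(\<lambda>t. (norm (f t))\<^sup>2) integrable_on {u..v}"
    by (rule integrable_on_lebesgue_on) simp
  \<comment> \<open>On a bounded interval the square controls the function itself, through
    \<open>n \<le> 1 + n\<^sup>2\<close>.\<close>
  then have int: "(\<lambda>t. 1 + (norm (f t))\<^sup>2) integrable_on {u..v}"
    by (intro integrable_add) auto
  show "(\<lambda>t. norm (f t)) absolutely_integrable_on {u..v}"
  proof (rule measurable_bounded_by_integrable_imp_absolutely_integrable[OF meas _ int])
    fix t
    have "0 \<le> (norm (f t) - 1)\<^sup>2" by simp
    then have "2 * norm (f t) \<le> 1 + (norm (f t))\<^sup>2" by (simp add: power2_diff)
    then have "norm (f t) \<le> 1 + (norm (f t))\<^sup>2" using norm_ge_zero[of "f t"] by linarith
    then show "norm (norm (f t)) \<le> 1 + (norm (f t))\<^sup>2" by simp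
  qed simp
qed

text \<open>The approximating simple functions are paired with \<open>x\<close>; by Cauchy-Schwarz
  their error grows at most by the factor \<open>norm x\<close>. This gives access to the scalar
  integral of the library.\<close>

lemma has_bochner_int_inner:
  fixes f :: "real \<Rightarrow> 'a::real_inner"
  assumes "has_bochner_int half_line f v"
  shows "has_bochner_integral half_line (\<lambda>t. f t \<bullet> x) (v \<bullet> x)"
proof -
  obtain s where sm: "strongly_measurable half_line f"
    and s: "\<And>i::nat. Bochner_Integration.simple_bochner_integrable half_line (s i)"
      "(\<lambda>i. \<integral>\<^sup>+t. ennreal (norm (f t - s i t)) \<partial>half_line) \<longlonglongrightarrow> 0"
      "(\<lambda>i. Bochner_Integration.simple_bochner_integral half_line (s i)) \<longlonglongrightarrow> v"
    using assms unfolding has_bochner_int_def by blast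
  show ?thesis
  proof (rule has_bochner_integral.intros)
    show "(\<lambda>t. f t \<bullet> x) \<in> borel_measurable half_line" by (rule strongly_measurable_inner[OF sm])
    show "Bochner_Integration.simple_bochner_integrable half_line (\<lambda>t. s i t \<bullet> x)" for i
      using simple_bochner_integrable_compose2[of "\<lambda>a b. a \<bullet> x" half_line "s i" "s i"] s(1)[of i] by simp
    have "linear (\<lambda>a. a \<bullet> x)" by (rule bounded_linear.linear[OF bounded_linear_inner_left])
    then have "Bochner_Integration.simple_bochner_integral half_line (\<lambda>t. s i t \<bullet> x)
        = Bochner_Integration.simple_bochner_integral half_line (s i) \<bullet> x" for i
      by (rule simple_bochner_integral_linear[OF _ s(1)])
    then show "(\<lambda>i. Bochner_Integration.simple_bochner_integral half_line (\<lambda>t. s i t \<bullet> x)) \<longlonglongrightarrow> v \<bullet> x"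
      using tendsto_inner[OF s(3) tendsto_const, of x] by simp
    show "(\<lambda>i. \<integral>\<^sup>+t. ennreal (norm (f t \<bullet> x - s i t \<bullet> x)) \<partial>half_line) \<longlonglongrightarrow> 0"
    proof (rule tendsto_sandwich[where f = "\<lambda>i. 0"])
      have "(\<lambda>i. ennreal (norm x) * (\<integral>\<^sup>+t. ennreal (norm (f t - s i t)) \<partial>half_line)) \<longlonglongrightarrow> ennreal (norm x) * 0"
        by (rule ennreal_tendsto_cmult[OF _ s(2)]) simp
      then have "(\<lambda>i. (\<integral>\<^sup>+t. ennreal (norm (f t - s i t)) \<partial>half_line) * ennreal (norm x)) \<longlonglongrightarrow> ennreal (norm x) * 0"
        by (simp only: mult.commute[of _ "ennreal (norm x)"])
      then show "(\<lambda>i. (\<integral>\<^sup>+t. ennreal (norm (f t - s i t)) \<partial>half_line) * ennreal (norm x)) \<longlonglongrightarrow> 0" by simp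
      show "\<forall>\<^sub>F i in sequentially. (\<integral>\<^sup>+t. ennreal (norm (f t \<bullet> x - s i t \<bullet> x)) \<partial>half_line)
          \<le> (\<integral>\<^sup>+t. ennreal (norm (f t - s i t)) \<partial>half_line) * ennreal (norm x)"
      proof (intro always_eventually allI)
        fix i
        have "(\<integral>\<^sup>+t. ennreal (norm (f t \<bullet> x - s i t \<bullet> x)) \<partial>half_line)
            \<le> (\<integral>\<^sup>+t. ennreal (norm (f t - s i t)) * ennreal (norm x) \<partial>half_line)"
        proof (rule nn_integral_mono)
          fix t
          have "norm (f t \<bullet> x - s i t \<bullet> x) \<le> norm (f t - s i t) * norm x"
            using Cauchy_Schwarz_ineq2[of "f t - s i t" x] by (simp add: inner_diff_left)
          then show "ennreal (norm (f t \<bullet> x - s i t \<bullet> x)) \<le> ennreal (norm (f t - s i t)) * ennreal (norm x)"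
            by (simp add: ennreal_mult[symmetric] ennreal_leI)
        qed
        also have "\<dots> = (\<integral>\<^sup>+t. ennreal (norm (f t - s i t)) \<partial>half_line) * ennreal (norm x)"
        proof (rule nn_integral_multc)
          have "strongly_measurable half_line (\<lambda>t. f t - s i t)"
          proof -
            obtain r where r: "\<And>j::nat. simple_function half_line (r j)" "AE t in half_line. (\<lambda>j. r j t) \<longlonglongrightarrow> f t"
              using sm unfolding strongly_measurable_def by blast
            have "simple_function half_line (s i)"
              using s(1)[of i] by (rule Bochner_Integration.simple_bochner_integrable.cases)
            then have "simple_function half_line (\<lambda>t. r j t - s i t)" for j
              using simple_function_compose2[OF r(1)] by blast
            moreover have "AE t in half_line. (\<lambda>j. r j t - s i t) \<longlonglongrightarrow> f t - s i t"
              using r(2) by eventually_elim (intro tendsto_diff tendsto_const)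
            ultimately show ?thesis
              unfolding strongly_measurable_def by (intro exI[of _ "\<lambda>j t. r j t - s i t"] conjI allI)
          qed
          then have "(\<lambda>t. norm (f t - s i t)) \<in> borel_measurable half_line" by (rule strongly_measurable_norm)
          then show "(\<lambda>t. ennreal (norm (f t - s i t))) \<in> borel_measurable half_line" by simp
        qed
        finally show "(\<integral>\<^sup>+t. ennreal (norm (f t \<bullet> x - s i t \<bullet> x)) \<partial>half_line)
          \<le> (\<integral>\<^sup>+t. ennreal (norm (f t - s i t)) \<partial>half_line) * ennreal (norm x)" .
      qed
    qed auto
  qed
qed

text \<open>One simple function at finite L1 distance suffices: \<open>norm (f t)\<close> is at most
  its norm plus the difference of the norms, and both are integrable.\<close>

lemma has_bochner_int_norm_integrable:
  assumes "has_bochner_int half_line f v"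
  shows "integrable half_line (\<lambda>t. norm (f t))"
proof -
  obtain s where sm: "strongly_measurable half_line f"
    and s: "\<And>i::nat. Bochner_Integration.simple_bochner_integrable half_line (s i)"
      "(\<lambda>i. \<integral>\<^sup>+t. ennreal (norm (f t - s i t)) \<partial>half_line) \<longlonglongrightarrow> 0"
    using assms unfolding has_bochner_int_def by blast
  have meas: "(\<lambda>t. norm (f t)) \<in> borel_measurable half_line" by (rule strongly_measurable_norm[OF sm])
  have "\<forall>\<^sub>F i in sequentially. (\<integral>\<^sup>+t. ennreal (norm (f t - s i t)) \<partial>half_line) < 1"
    by (rule order_tendstoD(2)[OF s(2)]) simp
  then obtain i where i: "(\<integral>\<^sup>+t. ennreal (norm (f t - s i t)) \<partial>half_line) < 1"
    using eventually_happens'[OF sequentially_bot] by blast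
  have "Bochner_Integration.simple_bochner_integrable half_line (\<lambda>t. norm (s i t))"
    using simple_bochner_integrable_compose2[of "\<lambda>a b. norm a" half_line "s i" "s i"] s(1)[of i] by simp
  then have ints: "integrable half_line (\<lambda>t. norm (s i t))"
    using has_bochner_integral_simple_bochner_integrable integrable.intros by blast
  have meas_s: "(\<lambda>t. norm (s i t)) \<in> borel_measurable half_line" using ints by simp
  have "integrable half_line (\<lambda>t. \<bar>norm (f t) - norm (s i t)\<bar>)"
  proof (rule integrableI_bounded)
    show "(\<lambda>t. \<bar>norm (f t) - norm (s i t)\<bar>) \<in> borel_measurable half_line" using meas meas_s by simp
    have "(\<integral>\<^sup>+t. ennreal (norm \<bar>norm (f t) - norm (s i t)\<bar>) \<partial>half_line) \<le> (\<integral>\<^sup>+t. ennreal (norm (f t - s i t)) \<partial>half_line)"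
      by (intro nn_integral_mono ennreal_leI) (simp add: norm_triangle_ineq3)
    also have "\<dots> < 1" by (rule i)
    also have "1 < (\<infinity> :: ennreal)" by simp
    finally show "(\<integral>\<^sup>+t. ennreal (norm \<bar>norm (f t) - norm (s i t)\<bar>) \<partial>half_line) < \<infinity>" .
  qed
  then have "integrable half_line (\<lambda>t. \<bar>norm (f t) - norm (s i t)\<bar> + norm (s i t))"
    using ints by (rule Bochner_Integration.integrable_add)
  then show ?thesis
    by (rule Bochner_Integration.integrable_bound) (use meas in auto)
qed

section \<open>Weak derivatives of scalar components\<close>

lemma has_bochner_integral_has_integral:
  fixes f :: "real \<Rightarrow> real"
  assumes "has_bochner_integral half_line f I" "0 < u" "\<And>t. t \<notin> {u..v} \<Longrightarrow> f t = 0"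
  shows "(f has_integral I) {u..v}"
proof -
  have "integrable half_line f" "integral\<^sup>L half_line f = I"
    using assms(1) by (auto simp: has_bochner_integral_iff)
  then have "(f has_integral I) {0<..}" using has_integral_integral_lebesgue_on[of "{0<..}" f] by simp
  then show ?thesis
  proof (subst has_integral_spike_set_eq[of "{u..v}" "{0<..}"])
    show "negligible {x \<in> {u..v} - {0<..}. f x \<noteq> 0}" "negligible {x \<in> {0<..} - {u..v}. f x \<noteq> 0}"
      using assms(2,3) by (auto intro!: negligible_subset[OF negligible_empty])
  qed
qed

lemma weak_der_inner_1:
  assumes "has_weak_deriv 1 f g"
  shows "weak_der (\<lambda>t. f t \<bullet> x) (\<lambda>t. g t \<bullet> x)"
  unfolding weak_der_def
proof (intro allI impI)
  fix \<eta> u v assume \<eta>: "test_function \<eta>" and u: "0 < (u::real)" and supp: "\<forall>t. t \<notin> {u<..<v} \<longrightarrow> \<eta> t = 0"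
  have d0: "deriv \<eta> t = 0" if "t \<notin> {u..v}" for t
    by (rule deriv_eq_zero_outside[OF closed_atLeastAtMost _ that]) (use supp in auto)
  obtain y where y: "has_bochner_int half_line (\<lambda>t. deriv \<eta> t *\<^sub>R f t) y"
    "has_bochner_int half_line (\<lambda>t. \<eta> t *\<^sub>R g t) (- y)"
    using assms \<eta> unfolding has_weak_deriv_def by force
  have "((\<lambda>t. (deriv \<eta> t *\<^sub>R f t) \<bullet> x) has_integral y \<bullet> x) {u..v}"
    using d0 by (intro has_bochner_integral_has_integral[OF has_bochner_int_inner[OF y(1)] u]) simp
  moreover have "((\<lambda>t. (\<eta> t *\<^sub>R g t) \<bullet> x) has_integral (- y) \<bullet> x) {u..v}"
    using supp by (intro has_bochner_integral_has_integral[OF has_bochner_int_inner[OF y(2)] u]) auto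
  ultimately show "integral {u..v} (\<lambda>t. deriv \<eta> t * (f t \<bullet> x)) = - integral {u..v} (\<lambda>t. \<eta> t * (g t \<bullet> x))"
    by (simp add: integral_unique)
qed

text \<open>The solution space provides the first and second weak derivatives independently of each
  other. Testing \<open>g\<close> with \<open>\<eta>'\<close> and \<open>h\<close> with
  \<open>\<eta>\<close> both lead to the integral of \<open>\<eta>'' f\<close>, with signs -1 and 1,
  and this links them.\<close>

lemma weak_der_inner_2:
  assumes "has_weak_deriv 1 f g" "has_weak_deriv 2 f h"
  shows "weak_der (\<lambda>t. g t \<bullet> x) (\<lambda>t. h t \<bullet> x)"
  unfolding weak_der_def
proof (intro allI impI)
  fix \<eta> u v assume \<eta>: "test_function \<eta>" and u: "0 < (u::real)" and supp: "\<forall>t. t \<notin> {u<..<v} \<longrightarrow> \<eta> t = 0"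
  have d0: "deriv \<eta> t = 0" if "t \<notin> {u..v}" for t
    by (rule deriv_eq_zero_outside[OF closed_atLeastAtMost _ that]) (use supp in auto)
  obtain y where y: "has_bochner_int half_line (\<lambda>t. deriv (deriv \<eta>) t *\<^sub>R f t) y"
    "has_bochner_int half_line (\<lambda>t. deriv \<eta> t *\<^sub>R g t) (- y)"
    using assms(1) test_function_deriv[OF \<eta>] unfolding has_weak_deriv_def by force
  obtain z where z: "has_bochner_int half_line (\<lambda>t. deriv (deriv \<eta>) t *\<^sub>R f t) z"
    "has_bochner_int half_line (\<lambda>t. \<eta> t *\<^sub>R h t) z"
    using assms(2) \<eta> unfolding has_weak_deriv_def by (force simp: numeral_2_eq_2)
  have yz: "y \<bullet> x = z \<bullet> x"
    using has_bochner_int_inner[OF y(1), of x] has_bochner_int_inner[OF z(1), of x] has_bochner_integral_eq by blast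
  have "((\<lambda>t. (deriv \<eta> t *\<^sub>R g t) \<bullet> x) has_integral (- y) \<bullet> x) {u..v}"
    using d0 by (intro has_bochner_integral_has_integral[OF has_bochner_int_inner[OF y(2)] u]) simp
  moreover have "((\<lambda>t. (\<eta> t *\<^sub>R h t) \<bullet> x) has_integral z \<bullet> x) {u..v}"
    using supp by (intro has_bochner_integral_has_integral[OF has_bochner_int_inner[OF z(2)] u]) auto
  ultimately show "integral {u..v} (\<lambda>t. deriv \<eta> t * (g t \<bullet> x)) = - integral {u..v} (\<lambda>t. \<eta> t * (h t \<bullet> x))"
    using yz by (simp add: integral_unique)
qed

text \<open>
  A weak derivative is not assumed to be locally integrable, but testing with a bump function
  that is positive on a given interval shows that it is.
\<close>

lemma weak_deriv_loc_int:
  fixes g :: "real \<Rightarrow> 'a::real_inner"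
  assumes "has_weak_deriv k f g"
  shows "loc_int (\<lambda>t. norm (g t))" "loc_int (\<lambda>t. g t \<bullet> x)"
proof -
  have "(\<lambda>t. norm (g t)) absolutely_integrable_on {u..v} \<and> (\<lambda>t. g t \<bullet> x) absolutely_integrable_on {u..v}"
    if u: "0 < u" for u v
  proof (cases "u \<le> v")
    case False
    then show ?thesis by simp
  next
    case True
    define \<eta> where "\<eta> = bump (u / 2) (2 * v) 1 1 0"
    have \<eta>: "test_function \<eta>" unfolding \<eta>_def using u by (intro test_function_bump) auto
    have pos: "0 < \<eta> t" if "t \<in> {u..v}" for t using that u by (simp add: \<eta>_def bump_def)
    obtain y where y: "has_bochner_int half_line (\<lambda>t. \<eta> t *\<^sub>R g t) ((-1) ^ k *\<^sub>R y)"
      using assms \<eta> unfolding has_weak_deriv_def by blast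
    have cont: "continuous_on {u..v} (\<lambda>t. inverse (\<eta> t))"
      using pos by (intro continuous_on_inverse test_function_continuous[OF \<eta>]) force
    have sub: "h absolutely_integrable_on {u..v}" if "integrable half_line h" for h :: "real \<Rightarrow> real"
    proof -
      have "h absolutely_integrable_on {0<..}"
        using that by (simp add: set_integrable_def integrable_restrict_space)
      then show ?thesis by (rule set_integrable_subset) (use u in auto)
    qed
    have prod: "(\<lambda>t. inverse (\<eta> t) * h t) absolutely_integrable_on {u..v}" if "integrable half_line h" for h :: "real \<Rightarrow> real"
    proof (rule absolutely_integrable_bounded_measurable_product_real)
      show "(\<lambda>t. inverse (\<eta> t)) \<in> borel_measurable (lebesgue_on {u..v})"
        using cont by (rule continuous_imp_measurable_on_sets_lebesgue) simp
      show "bounded ((\<lambda>t. inverse (\<eta> t)) ` {u..v})"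
        using compact_continuous_image[OF cont] compact_imp_bounded by blast
    qed (use sub[OF that] in auto)
    have "(\<lambda>t. inverse (\<eta> t) * norm (\<eta> t *\<^sub>R g t)) absolutely_integrable_on {u..v}"
      by (rule prod[OF has_bochner_int_norm_integrable[OF y]])
    then have 1: "(\<lambda>t. norm (g t)) absolutely_integrable_on {u..v}"
      by (rule absolutely_integrable_spike[OF _ negligible_empty]) (use pos in force)
    have "integrable half_line (\<lambda>t. (\<eta> t *\<^sub>R g t) \<bullet> x)"
      using has_bochner_int_inner[OF y] by (rule integrable.intros)
    from prod[OF this] have 2: "(\<lambda>t. g t \<bullet> x) absolutely_integrable_on {u..v}"
      by (rule absolutely_integrable_spike[OF _ negligible_empty]) (use pos in force)
    from 1 2 show ?thesis ..
  qed
  then show "loc_int (\<lambda>t. norm (g t))" "loc_int (\<lambda>t. g t \<bullet> x)" by (auto simp: loc_int_def)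
qed

section \<open>The quadratic form along the solution\<close>

text \<open>Both endpoints may move, so that forward quotients at \<open>t\<close> and backward
  quotients ending at \<open>t\<close> are instances.\<close>

lemma difference_quotient_tendsto:
  fixes f :: "real \<Rightarrow> 'a::real_inner"
  assumes wac: "wac f g" and cont: "continuous_on {0<..} g" and t: "0 < t"
    and uv: "\<And>n. 0 < u n" "\<And>n. u n < v n" "u \<longlonglongrightarrow> t" "v \<longlonglongrightarrow> t"
  shows "(\<lambda>n. (1 / (v n - u n)) *\<^sub>R (f (v n) - f (u n))) \<longlonglongrightarrow> g t"
proof (rule metric_LIMSEQ_I)
  fix e :: real assume "0 < e"
  then have "0 < e / 2" by simp
  then have "\<exists>d>0. \<forall>s\<in>{0<..}. dist s t < d \<longrightarrow> dist (g s) (g t) < e / 2"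
    using cont[unfolded continuous_on_iff, rule_format, of t "e / 2"] t by simp
  then obtain d where d: "0 < d" "\<forall>s\<in>{0<..}. dist s t < d \<longrightarrow> dist (g s) (g t) < e / 2"
    by blast
  have "\<forall>\<^sub>F n in sequentially. dist (u n) t < d \<and> dist (v n) t < d"
    by (rule eventually_conj[OF tendstoD[OF uv(3) d(1)] tendstoD[OF uv(4) d(1)]])
  then obtain N where N: "\<forall>n\<ge>N. dist (u n) t < d \<and> dist (v n) t < d"
    unfolding eventually_sequentially ..
  show "\<exists>N. \<forall>n\<ge>N. dist ((1 / (v n - u n)) *\<^sub>R (f (v n) - f (u n))) (g t) < e"
  proof (intro exI allI impI)
    fix n assume n: "N \<le> n"
    have len: "0 < v n - u n" using uv(2)[of n] by simp
    have le: "norm (f (v n) - f (u n) - (v n - u n) *\<^sub>R g t) \<le> e / 2 * (v n - u n)"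
    proof (rule wac_norm_diff_le_const[OF wac uv(1)])
      show "u n \<le> v n" using len by simp
      fix s assume s: "s \<in> {u n..v n}"
      then have "u n \<le> s" "s \<le> v n" by simp_all
      moreover have "\<bar>u n - t\<bar> < d" "\<bar>v n - t\<bar> < d" using N n by (simp_all add: dist_real_def)
      ultimately have "\<bar>s - t\<bar> < d" by linarith
      moreover have "0 < s" using s uv(1)[of n] by simp
      ultimately have "dist (g s) (g t) < e / 2" using d(2) by (simp add: dist_real_def)
      then show "norm (g s - g t) \<le> e / 2" by (simp add: dist_norm)
    qed
    have "(1 / (v n - u n)) *\<^sub>R (f (v n) - f (u n)) - g t
        = (1 / (v n - u n)) *\<^sub>R (f (v n) - f (u n) - (v n - u n) *\<^sub>R g t)"
      using len by (simp add: scaleR_diff_right)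
    then have "dist ((1 / (v n - u n)) *\<^sub>R (f (v n) - f (u n))) (g t)
        = norm (f (v n) - f (u n) - (v n - u n) *\<^sub>R g t) / (v n - u n)"
      using len by (simp add: dist_norm)
    also have "\<dots> \<le> e / 2" using le len by (simp add: pos_divide_le_eq)
    also have "\<dots> < e" using \<open>0 < e\<close> by simp
    finally show "dist ((1 / (v n - u n)) *\<^sub>R (f (v n) - f (u n))) (g t) < e" .
  qed
qed

text \<open>
  By symmetry, \<open>\<langle>a(t+h), \<Phi>(t+h)\<rangle> - \<langle>a(t), \<Phi>(t)\<rangle> = \<langle>a(t+h) + a(t), \<Phi>(t+h) - \<Phi>(t)\<rangle>\<close> with \<open>a = A \<Phi>\<close>, so that
  only the difference quotients of \<open>\<Phi>\<close>, not those of \<open>a\<close>, have to converge.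
\<close>

lemma quadratic_form_weak_der:
  fixes \<Phi> :: "real \<Rightarrow> 'a::real_inner"
  assumes A: "symmetric_operator A" and graph: "AE t in half_line. (\<Phi> t, a t) \<in> A"
    and wac: "wac \<Phi> \<Psi>" and cont: "continuous_on {0<..} \<Psi>"
    and meas: "\<And>x u v. 0 < u \<Longrightarrow> (\<lambda>t. a t \<bullet> x) \<in> borel_measurable (lebesgue_on {u..v})"
    and m: "loc_int m" "\<And>t. 0 < t \<Longrightarrow> norm (a t) \<le> m t"
  shows "weak_der (\<lambda>t. a t \<bullet> \<Phi> t) (\<lambda>t. 2 * (a t \<bullet> \<Psi> t))"
  unfolding weak_der_def
proof (intro allI impI)
  fix \<eta> u v assume \<eta>: "test_function \<eta>" and u: "0 < (u::real)" and supp: "\<forall>t. t \<notin> {u<..<v} \<longrightarrow> \<eta> t = 0"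
  have d0: "deriv \<eta> t = 0" if "t \<notin> {u..v}" for t
    by (rule deriv_eq_zero_outside[OF closed_atLeastAtMost _ that]) (use supp in auto)
  define q where "q t = a t \<bullet> \<Phi> t" for t
  \<comment> \<open>The interval is enlarged so that it still contains the support of
    \<open>\<eta>\<close> after a shift by \<open>h n\<close>; the bound \<open>u / 4\<close> on the
    shifts keeps all arguments positive.\<close>
  define lo where "lo = u / 2"
  define hi where "hi = max v u + 1"
  have lohi: "0 < lo" "lo \<le> u" "v \<le> hi" "lo \<le> hi" using u by (auto simp: lo_def hi_def)
  define h where "h n = min (u / 4) 1 / real (Suc n)" for n
  have h0: "0 < h n" for n using u by (simp add: h_def)
  have hle: "h n \<le> min (u / 4) 1" for n
    using divide_left_mono[of 1 "real (Suc n)" "min (u / 4) 1"] u by (simp add: h_def)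
  have h1: "h n \<le> u / 4" "h n \<le> 1" for n using hle[of n] by simp_all
  have hlim: "h \<longlonglongrightarrow> 0"
  proof -
    have "(\<lambda>n. min (u / 4) 1 * inverse (real (Suc n))) \<longlonglongrightarrow> 0"
      by (rule tendsto_mult_right_zero[OF LIMSEQ_inverse_real_of_nat])
    then show ?thesis unfolding h_def[abs_def] by (simp only: divide_inverse)
  qed
  have cont\<Phi>: "continuous_on {0<..} \<Phi>" by (rule wac_continuous[OF wac])
  have cont\<eta>: "continuous_on S \<eta>" for S by (rule test_function_continuous[OF \<eta>])
  have contd: "continuous_on S (deriv \<eta>)" for S by (rule test_function_continuous[OF test_function_deriv[OF \<eta>]])
  have int_a: "(\<lambda>t. a t \<bullet> k t) integrable_on {lo..hi}" if "continuous_on {lo..hi} k" for k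
    by (rule integrable_inner_continuous_Icc[OF meas[OF lohi(1)] m(1) m(2) that lohi(1)])
  \<comment> \<open>A discrete integration by parts. Shifting the second half of \<open>X\<close> by
    \<open>h n\<close> puts \<open>\<eta> t\<close> in front of both halves, and the symmetry of
    \<open>A\<close> collapses them to the forward difference of \<open>q\<close>, which cancels
    against \<open>Y\<close>.\<close>
  define X where "X n t = \<eta> t *\<^sub>R ((1 / h n) *\<^sub>R (\<Phi> (t + h n) - \<Phi> t))
      + \<eta> (t - h n) *\<^sub>R ((1 / h n) *\<^sub>R (\<Phi> t - \<Phi> (t - h n)))" for n t
  define Y where "Y n t = (\<eta> t - \<eta> (t - h n)) / h n" for n t
  have cX1: "continuous_on {lo..hi} (\<lambda>t. \<eta> t *\<^sub>R ((1 / h n) *\<^sub>R (\<Phi> (t + h n) - \<Phi> t)))" for n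
    using lohi h0[of n]
    by (intro continuous_on_scaleR continuous_on_diff continuous_on_const cont\<eta>
        continuous_on_compose2[OF cont\<Phi>] continuous_on_add continuous_on_id) auto
  have cX2: "continuous_on {lo..hi} (\<lambda>t. \<eta> (t - h n) *\<^sub>R ((1 / h n) *\<^sub>R (\<Phi> t - \<Phi> (t - h n))))" for n
    using lohi h0[of n] h1(1)[of n] u
    by (intro continuous_on_scaleR continuous_on_diff continuous_on_const continuous_on_compose2[OF cont\<eta>]
        continuous_on_compose2[OF cont\<Phi>] continuous_on_id) (auto simp: lo_def)
  have cont_shift: "continuous_on {lo..hi} (\<lambda>t. \<eta> (t - h n))" for n
    by (intro continuous_on_compose2[OF cont\<eta>] continuous_intros) auto
  have sub\<Phi>: "continuous_on {lo..hi} \<Phi>" using lohi by (intro continuous_on_subset[OF cont\<Phi>]) auto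
  have step: "integral {lo..hi} (\<lambda>t. q t * Y n t + a t \<bullet> X n t) = 0" for n
  proof -
    let ?h = "h n"
    let ?dF = "\<lambda>t. (1 / ?h) *\<^sub>R (\<Phi> (t + ?h) - \<Phi> t)"
    have supp': "\<eta> (t - ?h) = 0" if "t \<notin> {u + ?h..v + ?h}" for t using supp that by auto
    have rng: "lo \<le> u + ?h" "v + ?h \<le> hi" using lohi h0[of n] h1(2)[of n] by (auto simp: hi_def)
    have i1: "(\<lambda>t. q t * \<eta> t) integrable_on {lo..hi}"
      using int_a[OF continuous_on_scaleR[OF cont\<eta> sub\<Phi>]] by (simp add: q_def mult.commute)
    have i2: "(\<lambda>t. q t * \<eta> (t - ?h)) integrable_on {lo..hi}"
      using int_a[OF continuous_on_scaleR[OF cont_shift sub\<Phi>]] by (simp add: q_def mult.commute)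
    have i3: "(\<lambda>t. a t \<bullet> (\<eta> t *\<^sub>R ?dF t)) integrable_on {lo..hi}"
      by (rule int_a[OF cX1])
    have i4: "(\<lambda>t. a t \<bullet> (\<eta> (t - ?h) *\<^sub>R ((1 / ?h) *\<^sub>R (\<Phi> t - \<Phi> (t - ?h))))) integrable_on {lo..hi}"
      by (rule int_a[OF cX2])
    have sub: "f integrable_on {u..v}" "f integrable_on {u + ?h..v + ?h}" if "f integrable_on {lo..hi}" for f :: "real \<Rightarrow> real"
      using that lohi rng by (auto intro: integrable_on_subinterval)
    have I1: "integral {lo..hi} (\<lambda>t. q t * \<eta> t) = integral {u..v} (\<lambda>t. q t * \<eta> t)"
      using supp lohi by (intro integral_eq_on_support) auto
    have I3: "integral {lo..hi} (\<lambda>t. a t \<bullet> (\<eta> t *\<^sub>R ?dF t)) = integral {u..v} (\<lambda>t. a t \<bullet> (\<eta> t *\<^sub>R ?dF t))"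
      using supp lohi by (intro integral_eq_on_support) auto
    have "integral {lo..hi} (\<lambda>t. q t * \<eta> (t - ?h)) = integral {u + ?h..v + ?h} (\<lambda>t. q t * \<eta> (t - ?h))"
      using supp' rng by (intro integral_eq_on_support) auto
    also have "\<dots> = integral {u..v} ((\<lambda>t. q t * \<eta> (t - ?h)) \<circ> (+) ?h)"
      by (rule integral_shift_Icc_real[symmetric])
    finally have I2: "integral {lo..hi} (\<lambda>t. q t * \<eta> (t - ?h)) = integral {u..v} (\<lambda>t. q (t + ?h) * \<eta> t)"
      by (simp add: o_def add.commute)
    have "integral {lo..hi} (\<lambda>t. a t \<bullet> (\<eta> (t - ?h) *\<^sub>R ((1 / ?h) *\<^sub>R (\<Phi> t - \<Phi> (t - ?h)))))
        = integral {u + ?h..v + ?h} (\<lambda>t. a t \<bullet> (\<eta> (t - ?h) *\<^sub>R ((1 / ?h) *\<^sub>R (\<Phi> t - \<Phi> (t - ?h)))))"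
      using supp' rng by (intro integral_eq_on_support) auto
    also have "\<dots> = integral {u..v} ((\<lambda>t. a t \<bullet> (\<eta> (t - ?h) *\<^sub>R ((1 / ?h) *\<^sub>R (\<Phi> t - \<Phi> (t - ?h))))) \<circ> (+) ?h)"
      by (rule integral_shift_Icc_real[symmetric])
    finally have I4: "integral {lo..hi} (\<lambda>t. a t \<bullet> (\<eta> (t - ?h) *\<^sub>R ((1 / ?h) *\<^sub>R (\<Phi> t - \<Phi> (t - ?h)))))
        = integral {u..v} (\<lambda>t. a (t + ?h) \<bullet> (\<eta> t *\<^sub>R ?dF t))"
      by (simp add: o_def add.commute)
    have j2: "(\<lambda>t. q (t + ?h) * \<eta> t) integrable_on {u..v}"
      using sub(2)[OF i2] integrable_on_shift_Icc_real[of "\<lambda>t. q t * \<eta> (t - ?h)" ?h u v]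
      by (simp add: o_def add.commute)
    have j4: "(\<lambda>t. a (t + ?h) \<bullet> (\<eta> t *\<^sub>R ?dF t)) integrable_on {u..v}"
      using sub(2)[OF i4] integrable_on_shift_Icc_real[of "\<lambda>t. a t \<bullet> (\<eta> (t - ?h) *\<^sub>R ((1 / ?h) *\<^sub>R (\<Phi> t - \<Phi> (t - ?h))))" ?h u v]
      by (simp add: o_def add.commute)
    \<comment> \<open>The graph relation is used at \<open>t\<close> and at \<open>t + h n\<close>,
      so the exceptional set and its translate are both discarded.\<close>
    define N where "N = {t. 0 < t \<and> (\<Phi> t, a t) \<notin> A}"
    have "negligible N" using graph by (simp add: N_def AE_half_line_iff)
    then have negl: "negligible (N \<union> (+) (- ?h) ` N)" by (intro negligible_Un negligible_translation)
    have pt: "a t \<bullet> (\<eta> t *\<^sub>R ?dF t) + a (t + ?h) \<bullet> (\<eta> t *\<^sub>R ?dF t) = (q (t + ?h) * \<eta> t - q t * \<eta> t) / ?h"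
      if "t \<in> {u..v} - (N \<union> (+) (- ?h) ` N)" for t
    proof -
      have "t + ?h \<notin> N"
      proof
        assume "t + ?h \<in> N"
        then have "t \<in> (+) (- ?h) ` N" by (intro image_eqI[of _ _ "t + ?h"]) auto
        then show False using that by blast
      qed
      moreover have "0 < t" "0 < t + ?h" using that u h0[of n] by auto
      ultimately have "(\<Phi> t, a t) \<in> A" "(\<Phi> (t + ?h), a (t + ?h)) \<in> A" using that by (auto simp: N_def)
      from symmetric_operatorD[OF A this] have "a t \<bullet> \<Phi> (t + ?h) = a (t + ?h) \<bullet> \<Phi> t"
        by (simp only: inner_commute)
      then have "(a t + a (t + ?h)) \<bullet> (\<Phi> (t + ?h) - \<Phi> t) = q (t + ?h) - q t"
        by (simp add: q_def inner_add_left inner_diff_right)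
      moreover have "a t \<bullet> (\<eta> t *\<^sub>R ?dF t) + a (t + ?h) \<bullet> (\<eta> t *\<^sub>R ?dF t)
          = (\<eta> t / ?h) * ((a t + a (t + ?h)) \<bullet> (\<Phi> (t + ?h) - \<Phi> t))"
        unfolding inner_add_left[symmetric] by simp
      ultimately have "a t \<bullet> (\<eta> t *\<^sub>R ?dF t) + a (t + ?h) \<bullet> (\<eta> t *\<^sub>R ?dF t)
          = (\<eta> t / ?h) * (q (t + ?h) - q t)"
        by (simp only:)
      also have "\<dots> = (q (t + ?h) * \<eta> t - q t * \<eta> t) / ?h"
        by (simp add: right_diff_distrib diff_divide_distrib mult.commute)
      finally show ?thesis .
    qed
    have "integral {u..v} (\<lambda>t. a t \<bullet> (\<eta> t *\<^sub>R ?dF t)) + integral {u..v} (\<lambda>t. a (t + ?h) \<bullet> (\<eta> t *\<^sub>R ?dF t))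
        = integral {u..v} (\<lambda>t. a t \<bullet> (\<eta> t *\<^sub>R ?dF t) + a (t + ?h) \<bullet> (\<eta> t *\<^sub>R ?dF t))"
      by (rule Henstock_Kurzweil_Integration.integral_add[OF sub(1)[OF i3] j4, symmetric])
    also have "\<dots> = integral {u..v} (\<lambda>t. (q (t + ?h) * \<eta> t - q t * \<eta> t) / ?h)"
      by (rule integral_spike[OF negl]) (simp only: pt)
    also have "\<dots> = (integral {u..v} (\<lambda>t. q (t + ?h) * \<eta> t) - integral {u..v} (\<lambda>t. q t * \<eta> t)) / ?h"
      by (simp only: integral_divide Henstock_Kurzweil_Integration.integral_diff[OF j2 sub(1)[OF i1]])
    finally have main: "integral {u..v} (\<lambda>t. a t \<bullet> (\<eta> t *\<^sub>R ?dF t)) + integral {u..v} (\<lambda>t. a (t + ?h) \<bullet> (\<eta> t *\<^sub>R ?dF t))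
        = (integral {u..v} (\<lambda>t. q (t + ?h) * \<eta> t) - integral {u..v} (\<lambda>t. q t * \<eta> t)) / ?h" .
    have iX: "((\<lambda>t. a t \<bullet> X n t) has_integral (integral {u..v} (\<lambda>t. a t \<bullet> (\<eta> t *\<^sub>R ?dF t))
        + integral {u..v} (\<lambda>t. a (t + ?h) \<bullet> (\<eta> t *\<^sub>R ?dF t)))) {lo..hi}"
      unfolding X_def inner_add_right I3[symmetric] I4[symmetric]
      by (intro has_integral_add integrable_integral i3 i4)
    have iY: "((\<lambda>t. q t * Y n t) has_integral (integral {u..v} (\<lambda>t. q t * \<eta> t)
        - integral {u..v} (\<lambda>t. q (t + ?h) * \<eta> t)) / ?h) {lo..hi}"
      unfolding Y_def times_divide_eq_right right_diff_distrib I1[symmetric] I2[symmetric]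
      by (intro has_integral_divide has_integral_diff integrable_integral i1 i2)
    show ?thesis
      using integral_unique[OF has_integral_add[OF iY iX]] unfolding main by (simp add: diff_divide_distrib)
  qed
  obtain B\<Psi> where B\<Psi>: "\<And>t. t \<in> {u/4..hi+1} \<Longrightarrow> norm (\<Psi> t) \<le> B\<Psi>"
  proof -
    have "continuous_on {u/4..hi+1} \<Psi>" using u by (intro continuous_on_subset[OF cont]) auto
    from continuous_on_Icc_norm_bounded[OF this] show ?thesis using that by blast
  qed
  obtain B\<eta> where B\<eta>: "\<forall>t\<in>{0..hi}. norm (\<eta> t) \<le> B\<eta>"
    using continuous_on_Icc_norm_bounded[OF cont\<eta>] by blast
  obtain Bd where Bd: "\<forall>t\<in>{0..hi}. norm (deriv \<eta> t) \<le> Bd"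
    using continuous_on_Icc_norm_bounded[OF contd] by blast
  have B: "\<bar>\<eta> t\<bar> \<le> B\<eta>" "\<bar>deriv \<eta> t\<bar> \<le> Bd" if "t \<in> {0..hi}" for t
    using B\<eta> Bd that by (auto simp del: atLeastAtMost_iff)
  have sub\<Psi>: "continuous_on {lo..hi} \<Psi>" using lohi by (intro continuous_on_subset[OF cont]) auto
  have quot\<Phi>: "norm ((1 / (t - s)) *\<^sub>R (\<Phi> t - \<Phi> s)) \<le> B\<Psi>" if "u / 4 \<le> s" "s < t" "t \<le> hi + 1" for s t
  proof -
    have "norm (\<Phi> t - \<Phi> s - (t - s) *\<^sub>R 0) \<le> B\<Psi> * (t - s)"
      using that u B\<Psi> by (intro wac_norm_diff_le_const[OF wac]) auto
    then show ?thesis using that by (simp add: pos_divide_le_eq)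
  qed
  have quot\<eta>: "\<bar>(\<eta> t - \<eta> s) / (t - s)\<bar> \<le> Bd" if "0 < s" "s < t" "t \<le> hi" for s t
  proof -
    have "norm (\<eta> t - \<eta> s - (t - s) *\<^sub>R 0) \<le> Bd * (t - s)"
      using that B(2) by (intro wac_norm_diff_le_const[OF wac_test_function[OF \<eta>]]) auto
    then show ?thesis using that by (simp add: pos_divide_le_eq)
  qed
  \<comment> \<open>As \<open>h n\<close> tends to 0, \<open>Y\<close> tends to
    \<open>\<eta>'\<close> and \<open>X\<close> to \<open>2 \<eta> \<Psi>\<close>. Both are bounded
    uniformly in \<open>n\<close>, so a constant times \<open>m t * (1 + norm (\<Phi> t))\<close>
    dominates.\<close>
  have lim: "(\<lambda>n. integral {lo..hi} (\<lambda>t. q t * Y n t + a t \<bullet> X n t))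
      \<longlonglongrightarrow> integral {lo..hi} (\<lambda>t. q t * deriv \<eta> t + a t \<bullet> (2 * \<eta> t) *\<^sub>R \<Psi> t)"
  proof (rule dominated_convergence(2))
    have cY: "continuous_on {lo..hi} (Y n)" for n
      unfolding Y_def[abs_def] using h0[of n] by (intro continuous_intros cont\<eta> cont_shift) simp
    have cX: "continuous_on {lo..hi} (X n)" for n
      unfolding X_def[abs_def] by (rule continuous_on_add[OF cX1 cX2])
    show "(\<lambda>t. q t * Y n t + a t \<bullet> X n t) integrable_on {lo..hi}" for n
      using int_a[OF continuous_on_add[OF continuous_on_scaleR[OF cY sub\<Phi>] cX], of n n]
      by (simp add: q_def inner_add_right mult.commute)
    have "loc_int (\<lambda>t. norm (\<Phi> t) * m t)" by (intro loc_int_continuous_mult m continuous_on_norm cont\<Phi>)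
    then show "(\<lambda>t. Bd * (norm (\<Phi> t) * m t) + (2 * B\<eta> * B\<Psi>) * m t) integrable_on {lo..hi}"
      by (intro loc_int_integrable loc_int_add loc_int_cmult m lohi)
    fix t assume t: "t \<in> {lo..hi}"
    then have t0: "0 < t" using lohi by simp
    have th: "u / 4 \<le> t - h n" for n using t h1(1)[of n] u by (simp add: lo_def)
    have th0: "0 < t - h n" for n using th[of n] u by linarith
    show "norm (q t * Y n t + a t \<bullet> X n t) \<le> Bd * (norm (\<Phi> t) * m t) + (2 * B\<eta> * B\<Psi>) * m t" for n
    proof -
      have "\<bar>Y n t\<bar> \<le> Bd" using quot\<eta>[of "t - h n" t] th0[of n] h0[of n] t by (simp add: Y_def)
      moreover have "\<bar>q t\<bar> \<le> m t * norm (\<Phi> t)" unfolding q_def by (rule abs_inner_le[OF m(2)[OF t0] order_refl])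
      ultimately have 1: "\<bar>q t * Y n t\<bar> \<le> (m t * norm (\<Phi> t)) * Bd"
        unfolding abs_mult by (intro mult_mono) auto
      have "norm ((1 / h n) *\<^sub>R (\<Phi> (t + h n) - \<Phi> t)) \<le> B\<Psi>"
        using quot\<Phi>[of t "t + h n"] t h0[of n] h1(2)[of n] u by (simp add: lo_def)
      moreover have "norm ((1 / h n) *\<^sub>R (\<Phi> t - \<Phi> (t - h n))) \<le> B\<Psi>"
        using quot\<Phi>[of "t - h n" t] th[of n] t h0[of n] by simp
      moreover have "\<bar>\<eta> t\<bar> \<le> B\<eta>" "\<bar>\<eta> (t - h n)\<bar> \<le> B\<eta>"
        using B(1)[of t] B(1)[of "t - h n"] t t0 th0[of n] h0[of n] by auto
      ultimately have "norm (X n t) \<le> B\<eta> * B\<Psi> + B\<eta> * B\<Psi>"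
        unfolding X_def
        by (intro order_trans[OF norm_triangle_ineq] add_mono; subst norm_scaleR; intro mult_mono) auto
      from abs_inner_le[OF m(2)[OF t0] this]
      have 2: "\<bar>a t \<bullet> X n t\<bar> \<le> m t * (B\<eta> * B\<Psi> + B\<eta> * B\<Psi>)" .
      have "norm (q t * Y n t + a t \<bullet> X n t) \<le> (m t * norm (\<Phi> t)) * Bd + m t * (B\<eta> * B\<Psi> + B\<eta> * B\<Psi>)"
        using abs_triangle_ineq[of "q t * Y n t" "a t \<bullet> X n t"] 1 2 unfolding real_norm_def by linarith
      then show ?thesis by (simp add: algebra_simps)
    qed
    have lims: "(\<lambda>n. t - h n) \<longlonglongrightarrow> t" "(\<lambda>n. t + h n) \<longlonglongrightarrow> t"
      using tendsto_diff[OF tendsto_const hlim, of t] tendsto_add[OF tendsto_const hlim, of t] by simp_all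
    have "(\<lambda>n. (1 / ((t + h n) - t)) *\<^sub>R (\<Phi> (t + h n) - \<Phi> t)) \<longlonglongrightarrow> \<Psi> t"
      using t0 h0 lims by (intro difference_quotient_tendsto[OF wac cont t0]) auto
    moreover have "(\<lambda>n. (1 / (t - (t - h n))) *\<^sub>R (\<Phi> t - \<Phi> (t - h n))) \<longlonglongrightarrow> \<Psi> t"
      using th0 h0 lims by (intro difference_quotient_tendsto[OF wac cont t0]) auto
    moreover have "(\<lambda>n. (1 / (t - (t - h n))) *\<^sub>R (\<eta> t - \<eta> (t - h n))) \<longlonglongrightarrow> deriv \<eta> t"
      using th0 h0 lims by (intro difference_quotient_tendsto[OF wac_test_function[OF \<eta>] contd t0]) auto
    moreover have "(\<lambda>n. \<eta> (t - h n)) \<longlonglongrightarrow> \<eta> t"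
      using continuous_on_tendsto_compose[OF cont\<eta>[of UNIV] lims(1)] by simp
    ultimately have "(\<lambda>n. q t * Y n t + a t \<bullet> X n t)
        \<longlonglongrightarrow> q t * deriv \<eta> t + a t \<bullet> (\<eta> t *\<^sub>R \<Psi> t + \<eta> t *\<^sub>R \<Psi> t)"
      unfolding X_def Y_def by (intro tendsto_intros) simp_all
    then show "(\<lambda>n. q t * Y n t + a t \<bullet> X n t) \<longlonglongrightarrow> q t * deriv \<eta> t + a t \<bullet> (2 * \<eta> t) *\<^sub>R \<Psi> t"
      by (simp add: scaleR_2 flip: scaleR_scaleR)
  qed
  have zero: "integral {lo..hi} (\<lambda>t. q t * deriv \<eta> t + a t \<bullet> (2 * \<eta> t) *\<^sub>R \<Psi> t) = 0"
    using lim unfolding step by (simp add: LIMSEQ_const_iff)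
  have i5: "(\<lambda>t. deriv \<eta> t * q t) integrable_on {lo..hi}"
    using int_a[OF continuous_on_scaleR[OF contd sub\<Phi>]] by (simp add: q_def)
  have i6: "(\<lambda>t. \<eta> t * (2 * (a t \<bullet> \<Psi> t))) integrable_on {lo..hi}"
    using int_a[OF continuous_on_scaleR[OF continuous_on_mult[OF continuous_on_const cont\<eta>, of _ 2] sub\<Psi>]]
    by (simp add: mult_ac)
  have "integral {lo..hi} (\<lambda>t. deriv \<eta> t * q t) + integral {lo..hi} (\<lambda>t. \<eta> t * (2 * (a t \<bullet> \<Psi> t))) = 0"
    using Henstock_Kurzweil_Integration.integral_add[OF i5 i6] zero by (simp add: mult_ac)
  moreover have "integral {lo..hi} (\<lambda>t. deriv \<eta> t * q t) = integral {u..v} (\<lambda>t. deriv \<eta> t * q t)"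
    using d0 lohi by (intro integral_eq_on_support) auto
  moreover have "integral {lo..hi} (\<lambda>t. \<eta> t * (2 * (a t \<bullet> \<Psi> t))) = integral {u..v} (\<lambda>t. \<eta> t * (2 * (a t \<bullet> \<Psi> t)))"
    using supp lohi by (intro integral_eq_on_support) auto
  ultimately show "integral {u..v} (\<lambda>t. deriv \<eta> t * (a t \<bullet> \<Phi> t)) = - integral {u..v} (\<lambda>t. \<eta> t * (2 * (a t \<bullet> \<Psi> t)))"
    by (simp add: q_def)
qed

section \<open>The weighted energy\<close>

text \<open>The Carleman weight is \<open>e\<^sup>w\<close> with \<open>w = l t\<^bsup>4/3\<^esup>\<close>; \<open>w\<^sub>k\<close> denotes the derivative of order \<open>k\<close> of \<open>w\<close>.\<close>

definition wgt :: "real \<Rightarrow> real \<Rightarrow> real" where "wgt l t = exp (2 * l * t powr (4/3))"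
definition w\<^sub>1 :: "real \<Rightarrow> real \<Rightarrow> real" where "w\<^sub>1 l t = l * (4/3 * t powr (1/3))"
definition w\<^sub>2 :: "real \<Rightarrow> real \<Rightarrow> real" where "w\<^sub>2 l t = l * (4/9 * t powr (-2/3))"
definition w\<^sub>3 :: "real \<Rightarrow> real \<Rightarrow> real" where "w\<^sub>3 l t = l * (-8/27 * t powr (-5/3))"
definition w\<^sub>4 :: "real \<Rightarrow> real \<Rightarrow> real" where "w\<^sub>4 l t = l * (40/81 * t powr (-8/3))"

lemma wgt_derivs:
  assumes "0 < t"
  shows "(wgt l has_real_derivative 2 * w\<^sub>1 l t * wgt l t) (at t)"
    "(w\<^sub>1 l has_real_derivative w\<^sub>2 l t) (at t)"
    "(w\<^sub>2 l has_real_derivative w\<^sub>3 l t) (at t)"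
    "(w\<^sub>3 l has_real_derivative w\<^sub>4 l t) (at t)"
proof -
  have p: "((\<lambda>z. z powr r) has_real_derivative r * t powr (r - 1)) (at t)" for r
    by (rule has_real_derivative_powr[OF assms])
  have "((\<lambda>z. 2 * l * z powr (4/3)) has_real_derivative 2 * w\<^sub>1 l t) (at t)"
    by (rule DERIV_cong[OF DERIV_cmult[OF p]]) (simp add: w\<^sub>1_def)
  from DERIV_fun_exp[OF this] show "(wgt l has_real_derivative 2 * w\<^sub>1 l t * wgt l t) (at t)"
    by (simp add: wgt_def[abs_def] mult.commute)
  show "(w\<^sub>1 l has_real_derivative w\<^sub>2 l t) (at t)"
    unfolding w\<^sub>1_def[abs_def] by (rule DERIV_cong[OF DERIV_cmult[OF DERIV_cmult[OF p]]]) (simp add: w\<^sub>2_def)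
  show "(w\<^sub>2 l has_real_derivative w\<^sub>3 l t) (at t)"
    unfolding w\<^sub>2_def[abs_def] by (rule DERIV_cong[OF DERIV_cmult[OF DERIV_cmult[OF p]]]) (simp add: w\<^sub>3_def)
  show "(w\<^sub>3 l has_real_derivative w\<^sub>4 l t) (at t)"
    unfolding w\<^sub>3_def[abs_def] by (rule DERIV_cong[OF DERIV_cmult[OF DERIV_cmult[OF p]]]) (simp add: w\<^sub>4_def)
qed

text \<open>Inserting \<open>u = e\<^sup>w \<phi>\<close> and
  \<open>u' = e\<^sup>w (\<phi>' + w' \<phi>)\<close> into the energy gives these coefficients for
  \<open>\<parallel>\<phi>'\<parallel>\<^sup>2 - \<langle>A \<phi>, \<phi>\<rangle>\<close>,
  \<open>\<langle>\<phi>', \<phi>\<rangle>\<close> and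
  \<open>\<parallel>\<phi>\<parallel>\<^sup>2\<close>. Moreover \<open>e\<^sub>R\<close> is the
  derivative of \<open>e\<^sub>D\<close>; primes denote derivatives.\<close>

definition e\<^sub>D :: "real \<Rightarrow> real \<Rightarrow> real" where "e\<^sub>D l t = wgt l t * w\<^sub>1 l t"
definition e\<^sub>R :: "real \<Rightarrow> real \<Rightarrow> real" where "e\<^sub>R l t = wgt l t * (2 * (w\<^sub>1 l t)\<^sup>2 + w\<^sub>2 l t)"
definition e\<^sub>N :: "real \<Rightarrow> real \<Rightarrow> real" where
  "e\<^sub>N l t = wgt l t * (2 * w\<^sub>1 l t ^ 3 + w\<^sub>1 l t * w\<^sub>2 l t - w\<^sub>3 l t / 2)"
definition e\<^sub>R' :: "real \<Rightarrow> real \<Rightarrow> real" where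
  "e\<^sub>R' l t = wgt l t * (4 * w\<^sub>1 l t ^ 3 + 6 * w\<^sub>1 l t * w\<^sub>2 l t + w\<^sub>3 l t)"
definition e\<^sub>N' :: "real \<Rightarrow> real \<Rightarrow> real" where
  "e\<^sub>N' l t = wgt l t * (4 * w\<^sub>1 l t ^ 4 + 8 * (w\<^sub>1 l t)\<^sup>2 * w\<^sub>2 l t + (w\<^sub>2 l t)\<^sup>2 - w\<^sub>4 l t / 2)"

lemma wgt_continuous:
  "continuous_on {0<..} (wgt l)" "continuous_on {0<..} (w\<^sub>1 l)" "continuous_on {0<..} (w\<^sub>2 l)"
  "continuous_on {0<..} (w\<^sub>3 l)" "continuous_on {0<..} (w\<^sub>4 l)"
  unfolding wgt_def[abs_def] w\<^sub>1_def[abs_def] w\<^sub>2_def[abs_def] w\<^sub>3_def[abs_def] w\<^sub>4_def[abs_def]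
  by (intro continuous_intros; auto)+

lemma energy_coeff_wac: "wac (e\<^sub>D l) (e\<^sub>R l)" "wac (e\<^sub>R l) (e\<^sub>R' l)" "wac (e\<^sub>N l) (e\<^sub>N' l)"
proof -
  have D: "(e\<^sub>D l has_real_derivative e\<^sub>R l t) (at t)" if "0 < t" for t
    unfolding e\<^sub>D_def[abs_def] e\<^sub>R_def
    by (rule DERIV_cong[OF DERIV_mult[OF wgt_derivs(1,2)[OF that]]]) (simp add: algebra_simps power2_eq_square)
  have R: "(e\<^sub>R l has_real_derivative e\<^sub>R' l t) (at t)" if "0 < t" for t
    unfolding e\<^sub>R_def[abs_def] e\<^sub>R'_def
    by (rule DERIV_cong[OF DERIV_mult[OF wgt_derivs(1)[OF that]
          DERIV_add[OF DERIV_cmult[OF DERIV_power[OF wgt_derivs(2)[OF that]]] wgt_derivs(3)[OF that]]]])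
       (simp add: algebra_simps power2_eq_square power3_eq_cube)
  have N: "(e\<^sub>N l has_real_derivative e\<^sub>N' l t) (at t)" if "0 < t" for t
    unfolding e\<^sub>N_def[abs_def] e\<^sub>N'_def
    by (rule DERIV_cong[OF DERIV_mult[OF wgt_derivs(1)[OF that]
          DERIV_diff[OF DERIV_add[OF DERIV_cmult[OF DERIV_power[OF wgt_derivs(2)[OF that]]]
            DERIV_mult[OF wgt_derivs(2,3)[OF that]]] DERIV_cdivide[OF wgt_derivs(4)[OF that]]]]])
       (simp add: algebra_simps power2_eq_square power3_eq_cube power4_eq_xxxx)
  show "wac (e\<^sub>D l) (e\<^sub>R l)" unfolding e\<^sub>R_def[abs_def] by (rule wac_C1[OF D[unfolded e\<^sub>R_def]], assumption) (auto intro!: continuous_intros wgt_continuous)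
  show "wac (e\<^sub>R l) (e\<^sub>R' l)" unfolding e\<^sub>R'_def[abs_def] by (rule wac_C1[OF R[unfolded e\<^sub>R'_def]], assumption) (auto intro!: continuous_intros wgt_continuous)
  show "wac (e\<^sub>N l) (e\<^sub>N' l)" unfolding e\<^sub>N'_def[abs_def] by (rule wac_C1[OF N[unfolded e\<^sub>N'_def]], assumption) (auto intro!: continuous_intros wgt_continuous)
qed

text \<open>
  Completion of squares for the derivative of the energy; the operator enters only through
  \<open>r = W - a\<close> because the terms with \<open>\<langle>a, \<phi>\<rangle>\<close> cancel.
\<close>

lemma energy_identity:
  fixes W a \<psi> \<phi> :: "'a::real_inner" and x y z w :: real
  defines "r \<equiv> W - a"
  shows "(2 * x\<^sup>2 + y) * (\<psi> \<bullet> \<psi> - a \<bullet> \<phi>) + x * (W \<bullet> \<psi> + \<psi> \<bullet> W - 2 * (a \<bullet> \<psi>))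
      + (4 * x ^ 3 + 6 * x * y + z) * (\<psi> \<bullet> \<phi>) + (2 * x\<^sup>2 + y) * (W \<bullet> \<phi> + \<psi> \<bullet> \<psi>)
      + (4 * x ^ 4 + 8 * x\<^sup>2 * y + y\<^sup>2 - w / 2) * (\<phi> \<bullet> \<phi>)
      + (2 * x ^ 3 + x * y - z / 2) * (\<psi> \<bullet> \<phi> + \<phi> \<bullet> \<psi>)
    = (norm ((1/2) *\<^sub>R r + (2 * x) *\<^sub>R \<psi> + (2 * x\<^sup>2 + y) *\<^sub>R \<phi>))\<^sup>2 - (norm r)\<^sup>2 / 4
      + 2 * y * (norm (\<psi> + x *\<^sub>R \<phi>))\<^sup>2 + (2 * x\<^sup>2 * y - w / 2) * (\<phi> \<bullet> \<phi>)"
proof -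
  have W: "W = a + r" by (simp add: r_def)
  \<comment> \<open>With \<open>x = w'\<close> and \<open>y = w''\<close>, this vector times
    \<open>e\<^sup>w\<close> is \<open>2 w' u' + w'' u + e\<^sup>w r / 2\<close>, and
    \<open>\<psi> + x \<phi>\<close> times \<open>e\<^sup>w\<close> is \<open>u'\<close>.\<close>
  have "(norm ((1/2) *\<^sub>R r + (2 * x) *\<^sub>R \<psi> + (2 * x\<^sup>2 + y) *\<^sub>R \<phi>))\<^sup>2
      = (r \<bullet> r) / 4 + 4 * x\<^sup>2 * (\<psi> \<bullet> \<psi>) + (2 * x\<^sup>2 + y)\<^sup>2 * (\<phi> \<bullet> \<phi>)
        + 2 * x * (r \<bullet> \<psi>) + (2 * x\<^sup>2 + y) * (r \<bullet> \<phi>) + 4 * x * (2 * x\<^sup>2 + y) * (\<psi> \<bullet> \<phi>)"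
    unfolding power2_norm_eq_inner
    by (simp add: inner_add_left inner_add_right inner_commute[of \<psi> r] inner_commute[of \<phi> r] inner_commute[of \<phi> \<psi>])
       (simp add: field_simps power2_eq_square)
  moreover have "(norm (\<psi> + x *\<^sub>R \<phi>))\<^sup>2 = \<psi> \<bullet> \<psi> + 2 * x * (\<psi> \<bullet> \<phi>) + x\<^sup>2 * (\<phi> \<bullet> \<phi>)"
    unfolding power2_norm_eq_inner
    by (simp add: inner_add_left inner_add_right inner_commute[of \<phi> \<psi>])
       (simp add: algebra_simps power2_eq_square)
  moreover have "(norm r)\<^sup>2 = r \<bullet> r" by (rule power2_norm_eq_inner)
  moreover have "W \<bullet> \<psi> = a \<bullet> \<psi> + r \<bullet> \<psi>" "\<psi> \<bullet> W = a \<bullet> \<psi> + r \<bullet> \<psi>" "W \<bullet> \<phi> = a \<bullet> \<phi> + r \<bullet> \<phi>" "\<phi> \<bullet> \<psi> = \<psi> \<bullet> \<phi>"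
    unfolding W by (simp_all add: inner_add_left inner_add_right inner_commute)
  ultimately show ?thesis
    by (simp only:) (simp add: algebra_simps power2_eq_square power3_eq_cube power4_eq_xxxx)
qed

text \<open>With \<open>T = t\<^sub>0 powr (-8/3)\<close>, the threshold ensures \<open>l\<^sup>3
  \<ge> l * (T + \<beta>\<^sup>2) \<ge> l * T + \<beta>\<^sup>2\<close>. Since
  \<open>w\<^sub>4\<close> is linear in \<open>l\<close> and decreasing in time, the cubic term
  absorbs it and the perturbation together, uniformly from \<open>t\<^sub>0\<close> on.\<close>

lemma carleman_large:
  assumes "0 < t\<^sub>0" "t\<^sub>0 \<le> t" "1 + t\<^sub>0 powr (-8/3) + \<beta>\<^sup>2 \<le> l"
  shows "\<beta>\<^sup>2 / 4 \<le> 2 * (w\<^sub>1 l t)\<^sup>2 * w\<^sub>2 l t - w\<^sub>4 l t / 2"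
proof -
  define T where "T = t\<^sub>0 powr (-8/3)"
  have T: "0 \<le> T" by (simp add: T_def)
  have t: "0 < t" using assms by simp
  have Tle: "t powr (-8/3) \<le> T" unfolding T_def using assms by (intro powr_mono2') auto
  have l: "1 \<le> l" "T + \<beta>\<^sup>2 \<le> l"
    using assms(3) T zero_le_power2[of \<beta>] unfolding T_def by linarith+
  have pw: "(t powr (1/3))\<^sup>2 * t powr (-2/3) = 1"
    using t by (simp add: power2_eq_square flip: powr_add)
  have "2 * (w\<^sub>1 l t)\<^sup>2 * w\<^sub>2 l t = l ^ 3 * (128/81) * ((t powr (1/3))\<^sup>2 * t powr (-2/3))"
    by (simp add: w\<^sub>1_def w\<^sub>2_def power_mult_distrib power2_eq_square power3_eq_cube)
  then have main: "2 * (w\<^sub>1 l t)\<^sup>2 * w\<^sub>2 l t = l ^ 3 * (128/81)" unfolding pw by simp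
  have "w\<^sub>4 l t / 2 = 20/81 * (l * t powr (-8/3))" by (simp add: w\<^sub>4_def)
  also have "\<dots> \<le> 20/81 * (l * T)" using Tle l by (intro mult_left_mono) auto
  finally have w4: "w\<^sub>4 l t / 2 \<le> 20/81 * (l * T)" .
  have "l * (T + \<beta>\<^sup>2) \<le> l * l" using l by (intro mult_left_mono) auto
  also have "\<dots> \<le> l * (l * l)" using l mult_right_mono[of 1 l "l * l"] by simp
  finally have "l * T + l * \<beta>\<^sup>2 \<le> l ^ 3" by (simp add: distrib_left power3_eq_cube)
  moreover have "\<beta>\<^sup>2 \<le> l * \<beta>\<^sup>2" using mult_right_mono[OF l(1), of "\<beta>\<^sup>2"] by simp
  moreover have "0 \<le> l * T" using l T by simp
  moreover have "0 \<le> \<beta>\<^sup>2" by simp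
  ultimately have "\<beta>\<^sup>2 / 4 \<le> l ^ 3 * (128/81) - 20/81 * (l * T)" by argo
  then show ?thesis unfolding main using w4 by linarith
qed

text \<open>Relative to \<open>wgt l t\<close> the coefficient grows only polynomially in
  \<open>t\<close>; raising \<open>l\<close> by 1 pays for this with the factor
  \<open>exp (2 * t powr (4/3))\<close>. Decay at every rate is what makes the larger weight
  admissible.\<close>

lemma coefficient_bound:
  assumes t0: "0 < t\<^sub>0" and l: "0 < l" and C: "0 \<le> C"
  shows "\<exists>K\<ge>0. \<forall>t\<ge>t\<^sub>0. e\<^sub>D l t * C + e\<^sub>N l t \<le> K * wgt (l + 1) t"
proof -
  \<comment> \<open>One summand for each of the terms with \<open>w\<^sub>1 C\<close>,
    \<open>w\<^sub>1\<^sup>3\<close>, \<open>w\<^sub>1 w\<^sub>2\<close> and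
    \<open>w\<^sub>3\<close>; negative powers of \<open>t\<close> are estimated by their values at
    \<open>t\<^sub>0\<close>.\<close>
  define K where "K = 4/3 * l * C + 128/27 * l ^ 3 + 16/27 * l\<^sup>2 * t\<^sub>0 powr (-1/3) + 4/27 * l * t\<^sub>0 powr (-5/3)"
  have K: "0 \<le> K" using l C by (simp add: K_def)
  have "e\<^sub>D l t * C + e\<^sub>N l t \<le> K * wgt (l + 1) t" if t: "t\<^sub>0 \<le> t" for t
  proof -
    have tp: "0 < t" using t t0 by simp
    define x where "x = 1 + t powr (4/3)"
    have x: "1 \<le> x" by (simp add: x_def)
    have pow: "t powr r \<le> x" if "0 \<le> r" "r \<le> 4/3" for r
    proof (cases "t \<le> 1")
      case True
      then have "t powr r \<le> 1" using tp that by (intro powr_le1) auto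
      then show ?thesis using x by simp
    next
      case False
      then have "t powr r \<le> t powr (4/3)" using that by (intro powr_mono) auto
      then show ?thesis by (simp add: x_def)
    qed
    have neg: "t powr (-r) \<le> t\<^sub>0 powr (-r) * x" if "0 \<le> r" for r
    proof -
      have "t powr (-r) \<le> t\<^sub>0 powr (-r)" using that t t0 by (intro powr_mono2') auto
      also have "\<dots> \<le> t\<^sub>0 powr (-r) * x" using mult_left_mono[OF x, of "t\<^sub>0 powr (-r)"] by simp
      finally show ?thesis .
    qed
    have "w\<^sub>1 l t * C = 4/3 * l * C * t powr (1/3)" by (simp add: w\<^sub>1_def)
    also have "\<dots> \<le> 4/3 * l * C * x" using l C by (intro mult_left_mono pow) auto
    finally have 1: "w\<^sub>1 l t * C \<le> 4/3 * l * C * x" .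
    have "2 * w\<^sub>1 l t ^ 3 = 128/27 * l ^ 3 * (t powr (1/3)) ^ 3"
      by (simp add: w\<^sub>1_def power_mult_distrib power3_eq_cube)
    also have "(t powr (1/3)) ^ 3 = t powr 1" using tp by (simp add: power3_eq_cube flip: powr_add)
    also have "128/27 * l ^ 3 * t powr 1 \<le> 128/27 * l ^ 3 * x" using l by (intro mult_left_mono pow) auto
    finally have 2: "2 * w\<^sub>1 l t ^ 3 \<le> 128/27 * l ^ 3 * x" .
    have "w\<^sub>1 l t * w\<^sub>2 l t = 16/27 * l\<^sup>2 * (t powr (1/3) * t powr (-2/3))"
      by (simp add: w\<^sub>1_def w\<^sub>2_def power2_eq_square)
    also have "t powr (1/3) * t powr (-2/3) = t powr (-(1/3))" using tp by (simp flip: powr_add)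
    also have "16/27 * l\<^sup>2 * t powr (-(1/3)) \<le> 16/27 * l\<^sup>2 * (t\<^sub>0 powr (-(1/3)) * x)"
      by (intro mult_left_mono neg) auto
    finally have 3: "w\<^sub>1 l t * w\<^sub>2 l t \<le> 16/27 * l\<^sup>2 * (t\<^sub>0 powr (-(1/3)) * x)" .
    have "- w\<^sub>3 l t / 2 = 4/27 * l * t powr (-(5/3))" by (simp add: w\<^sub>3_def)
    also have "\<dots> \<le> 4/27 * l * (t\<^sub>0 powr (-(5/3)) * x)" using l by (intro mult_left_mono neg) auto
    finally have 4: "- w\<^sub>3 l t / 2 \<le> 4/27 * l * (t\<^sub>0 powr (-(5/3)) * x)" .
    have "w\<^sub>1 l t * C + (2 * w\<^sub>1 l t ^ 3 + w\<^sub>1 l t * w\<^sub>2 l t - w\<^sub>3 l t / 2)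
        \<le> 4/3 * l * C * x + 128/27 * l ^ 3 * x + 16/27 * l\<^sup>2 * (t\<^sub>0 powr (-(1/3)) * x) + 4/27 * l * (t\<^sub>0 powr (-(5/3)) * x)"
      using 1 2 3 4 by linarith
    also have "\<dots> = K * x" by (simp add: K_def distrib_right)
    also have "\<dots> \<le> K * exp (2 * t powr (4/3))"
    proof (rule mult_left_mono[OF _ K])
      have "1 + 2 * t powr (4/3) \<le> exp (2 * t powr (4/3))" by (rule exp_ge_add_one_self)
      then show "x \<le> exp (2 * t powr (4/3))" using powr_ge_zero[of t "4/3"] unfolding x_def by linarith
    qed
    finally have "wgt l t * (w\<^sub>1 l t * C + (2 * w\<^sub>1 l t ^ 3 + w\<^sub>1 l t * w\<^sub>2 l t - w\<^sub>3 l t / 2))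
        \<le> wgt l t * (K * exp (2 * t powr (4/3)))"
      by (rule mult_left_mono) (simp add: wgt_def)
    moreover have "wgt (l + 1) t = wgt l t * exp (2 * t powr (4/3))"
      by (simp add: wgt_def distrib_left distrib_right flip: exp_add)
    ultimately show ?thesis by (simp add: e\<^sub>D_def e\<^sub>N_def distrib_left mult_ac)
  qed
  with K show ?thesis by blast
qed

lemma cubic_leading_coeff:
  fixes A B C L :: real
  assumes "\<And>l. L \<le> l \<Longrightarrow> A * l ^ 3 + B * l\<^sup>2 + C * l \<le> 0"
  shows "A \<le> 0"
proof (rule tendsto_upperbound)
  have "((\<lambda>l. A + B * inverse l + C * (inverse l * inverse l)) \<longlongrightarrow> A + B * 0 + C * (0 * 0)) at_top"
    by (intro tendsto_intros tendsto_inverse_0_at_top filterlim_ident)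
  then show "((\<lambda>l. A + B * inverse l + C * (inverse l * inverse l)) \<longlongrightarrow> A) at_top" by simp
  show "\<forall>\<^sub>F l in at_top. A + B * inverse l + C * (inverse l * inverse l) \<le> 0"
    using eventually_ge_at_top[of L] eventually_gt_at_top[of 0]
  proof eventually_elim
    case (elim l)
    have "A + B * inverse l + C * (inverse l * inverse l) = (A * l ^ 3 + B * l\<^sup>2 + C * l) / l ^ 3"
      using elim(2) by (simp add: field_simps power2_eq_square power3_eq_cube)
    also have "\<dots> \<le> 0" using assms[OF elim(1)] elim(2) by (simp add: divide_nonpos_pos)
    finally show ?case .
  qed
qed simp

text \<open>Here \<open>a = A \<Phi>\<close>, and \<open>q\<close> is the continuous representative of \<open>\<langle>A \<Phi>, \<Phi>\<rangle>\<close>.\<close>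

locale evolution =
  fixes \<Phi> \<Psi> W a :: "real \<Rightarrow> 'a::real_inner" and q :: "real \<Rightarrow> real" and \<beta> c :: real
  assumes wac_\<Phi>: "wac \<Phi> \<Psi>" and wac_\<Psi>: "wac \<Psi> W" and wac_q: "wac q (\<lambda>t. 2 * (a t \<bullet> \<Psi> t))"
    and q_eq: "AE t in half_line. q t = a t \<bullet> \<Phi> t"
    and q_ge: "AE t in half_line. - c * (\<Phi> t \<bullet> \<Phi> t) \<le> a t \<bullet> \<Phi> t"
    and r_le: "\<And>t. 0 < t \<Longrightarrow> norm (W t - a t) \<le> \<beta> * norm (\<Phi> t)"
    and c_nonneg: "0 \<le> c" and \<beta>_pos: "0 < \<beta>"
begin

abbreviation N where "N t \<equiv> \<Phi> t \<bullet> \<Phi> t"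
abbreviation R where "R t \<equiv> \<Psi> t \<bullet> \<Phi> t"
abbreviation D where "D t \<equiv> \<Psi> t \<bullet> \<Psi> t - q t"

definition energy :: "real \<Rightarrow> real \<Rightarrow> real" where
  "energy l t = e\<^sub>D l t * D t + e\<^sub>R l t * R t + e\<^sub>N l t * N t"

definition energy' :: "real \<Rightarrow> real \<Rightarrow> real" where
  "energy' l t = (e\<^sub>R l t * D t + e\<^sub>D l t * (W t \<bullet> \<Psi> t + \<Psi> t \<bullet> W t - 2 * (a t \<bullet> \<Psi> t)))
     + (e\<^sub>R' l t * R t + e\<^sub>R l t * (W t \<bullet> \<Phi> t + \<Psi> t \<bullet> \<Psi> t))
     + (e\<^sub>N' l t * N t + e\<^sub>N l t * (\<Psi> t \<bullet> \<Phi> t + \<Phi> t \<bullet> \<Psi> t))"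

lemma wac_N: "wac N (\<lambda>t. \<Psi> t \<bullet> \<Phi> t + \<Phi> t \<bullet> \<Psi> t)"
  by (rule wac_inner[OF wac_\<Phi> wac_\<Phi>])

lemma wac_R: "wac R (\<lambda>t. W t \<bullet> \<Phi> t + \<Psi> t \<bullet> \<Psi> t)"
  by (rule wac_inner[OF wac_\<Psi> wac_\<Phi>])

lemma wac_energy: "wac (energy l) (energy' l)"
  unfolding energy_def[abs_def] energy'_def[abs_def]
  by (intro wac_add wac_mult energy_coeff_wac wac_N wac_R wac_diff wac_inner[OF wac_\<Psi> wac_\<Psi>] wac_q)

lemma energy_mono:
  assumes "0 < t\<^sub>0" "0 < l"
    and large: "\<And>t. t\<^sub>0 \<le> t \<Longrightarrow> \<beta>\<^sup>2 / 4 \<le> 2 * (w\<^sub>1 l t)\<^sup>2 * w\<^sub>2 l t - w\<^sub>4 l t / 2"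
    and "t\<^sub>0 \<le> u" "u \<le> v"
  shows "energy l u \<le> energy l v"
proof (rule wac_mono[OF wac_energy _ assms(1,4,5)])
  show "AE t in half_line. t\<^sub>0 \<le> t \<longrightarrow> 0 \<le> energy' l t"
    using q_eq
  proof eventually_elim
    case (elim t)
    show ?case
    proof
      assume t: "t\<^sub>0 \<le> t"
      then have t0: "0 < t" using assms(1) by simp
      let ?r = "W t - a t"
      let ?v = "(1/2) *\<^sub>R ?r + (2 * w\<^sub>1 l t) *\<^sub>R \<Psi> t + (2 * (w\<^sub>1 l t)\<^sup>2 + w\<^sub>2 l t) *\<^sub>R \<Phi> t"
      have eq: "energy' l t = wgt l t * ((norm ?v)\<^sup>2 - (norm ?r)\<^sup>2 / 4
          + 2 * w\<^sub>2 l t * (norm (\<Psi> t + w\<^sub>1 l t *\<^sub>R \<Phi> t))\<^sup>2 + (2 * (w\<^sub>1 l t)\<^sup>2 * w\<^sub>2 l t - w\<^sub>4 l t / 2) * N t)"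
        unfolding energy_identity[of "w\<^sub>1 l t" "w\<^sub>2 l t" "\<Psi> t" "a t" "\<Phi> t" "W t" "w\<^sub>3 l t" "w\<^sub>4 l t", symmetric]
          energy'_def e\<^sub>D_def e\<^sub>R_def e\<^sub>N_def e\<^sub>R'_def e\<^sub>N'_def elim
        by (simp only: mult.assoc) (simp only: distrib_left mult.assoc add.assoc)
      have "0 \<le> (norm ?v)\<^sup>2" by simp
      moreover have "0 \<le> 2 * w\<^sub>2 l t * (norm (\<Psi> t + w\<^sub>1 l t *\<^sub>R \<Phi> t))\<^sup>2"
        using \<open>0 < l\<close> by (simp add: w\<^sub>2_def)
      moreover have "(norm ?r)\<^sup>2 / 4 \<le> (2 * (w\<^sub>1 l t)\<^sup>2 * w\<^sub>2 l t - w\<^sub>4 l t / 2) * N t"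
      proof -
        have "(norm ?r)\<^sup>2 \<le> (\<beta> * norm (\<Phi> t))\<^sup>2" by (rule power_mono[OF r_le[OF t0]]) simp
        then have "(norm ?r)\<^sup>2 / 4 \<le> \<beta>\<^sup>2 / 4 * N t" by (simp add: power_mult_distrib power2_norm_eq_inner)
        also have "\<dots> \<le> (2 * (w\<^sub>1 l t)\<^sup>2 * w\<^sub>2 l t - w\<^sub>4 l t / 2) * N t"
          by (intro mult_right_mono large[OF t]) simp
        finally show ?thesis .
      qed
      ultimately show "0 \<le> energy' l t"
        unfolding eq by (intro mult_nonneg_nonneg) (simp add: wgt_def, linarith)
    qed
  qed
qed

text \<open>The first group on the right is the derivative of
  \<open>e\<^sub>D \<langle>\<Psi>, \<Phi>\<rangle>\<close>. Compared with the energy it has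
  \<open>W \<bullet> \<Phi>\<close> in place of \<open>- q\<close>; as
  \<open>W \<bullet> \<Phi>\<close> is \<open>q\<close> up to \<open>\<beta> N\<close>, the gap is
  essentially \<open>2 q\<close>, whence the \<open>2 * c\<close>.\<close>

lemma energy_le:
  assumes "0 < l"
  shows "AE t in half_line. energy l t \<le>
    (e\<^sub>R l t * R t + e\<^sub>D l t * (W t \<bullet> \<Phi> t + \<Psi> t \<bullet> \<Psi> t)) + (e\<^sub>D l t * (2 * c + \<beta>) + e\<^sub>N l t) * N t"
  using q_eq q_ge AE_space
proof eventually_elim
  case (elim t)
  then have t0: "0 < t" by simp
  have eD: "0 \<le> e\<^sub>D l t" using assms by (simp add: e\<^sub>D_def wgt_def w\<^sub>1_def)
  have "\<bar>(W t - a t) \<bullet> \<Phi> t\<bar> \<le> \<beta> * norm (\<Phi> t) * norm (\<Phi> t)" by (rule abs_inner_le[OF r_le[OF t0] order_refl])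
  then have "- \<beta> * N t \<le> (W t - a t) \<bullet> \<Phi> t" by (simp add: dot_square_norm power2_eq_square)
  then have "- (2 * c + \<beta>) * N t \<le> q t + W t \<bullet> \<Phi> t"
    using elim by (simp add: inner_diff_left algebra_simps)
  then have "e\<^sub>D l t * (- (2 * c + \<beta>) * N t) \<le> e\<^sub>D l t * (q t + W t \<bullet> \<Phi> t)" using eD by (rule mult_left_mono)
  then show ?case by (simp add: energy_def algebra_simps)
qed

text \<open>
  If the energy were positive at some time, it would stay so. Since it is bounded by the derivative of
  \<open>e\<^sub>D \<langle>\<Psi>, \<Phi>\<rangle>\<close> up to an integrable term, \<open>\<langle>\<Psi>, \<Phi>\<rangle>\<close> would become positive, and then
  \<open>\<parallel>\<Phi>\<parallel>\<close> would increase.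
\<close>

lemma energy_nonpos:
  assumes t0: "0 < t\<^sub>0" and l: "0 < l"
    and large: "\<And>t. t\<^sub>0 \<le> t \<Longrightarrow> \<beta>\<^sup>2 / 4 \<le> 2 * (w\<^sub>1 l t)\<^sup>2 * w\<^sub>2 l t - w\<^sub>4 l t / 2"
    and int: "\<And>l. 0 < l \<Longrightarrow> \<exists>B. \<forall>u v. 0 < u \<longrightarrow> u \<le> v \<longrightarrow> integral {u..v} (\<lambda>t. wgt l t * N t) \<le> B"
  shows "energy l t\<^sub>0 \<le> 0"
proof (rule ccontr)
  define e where "e = energy l t\<^sub>0"
  assume "\<not> energy l t\<^sub>0 \<le> 0"
  then have e: "0 < e" by (simp add: e_def)
  define G where "G t = e\<^sub>D l t * R t" for t
  define g where "g t = e\<^sub>R l t * R t + e\<^sub>D l t * (W t \<bullet> \<Phi> t + \<Psi> t \<bullet> \<Psi> t)" for t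
  define \<delta> where "\<delta> t = (e\<^sub>D l t * (2 * c + \<beta>) + e\<^sub>N l t) * N t" for t
  have G: "wac G g" unfolding G_def[abs_def] g_def[abs_def] by (rule wac_mult[OF energy_coeff_wac(1) wac_R])
  have contN: "continuous_on {0<..} N" by (rule wac_continuous[OF wac_N])
  have cont\<delta>: "continuous_on {0<..} \<delta>"
    unfolding \<delta>_def[abs_def]
    by (intro continuous_on_mult continuous_on_add continuous_on_const contN
        wac_continuous[OF energy_coeff_wac(1)] wac_continuous[OF energy_coeff_wac(3)])
  then have int\<delta>: "loc_int \<delta>" by (rule loc_int_continuous)
  have Z: "wac (primitive \<delta>) \<delta>"
    by (rule wac_realI[OF loc_int_abs[OF int\<delta>]]) (auto intro: primitive_has_integral[OF int\<delta>])
  have lin: "wac (\<lambda>t. e * t) (\<lambda>t. e)" by (rule wac_C1) (auto intro!: derivative_eq_intros)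
  obtain K where K: "0 \<le> K" "\<And>t. t\<^sub>0 \<le> t \<Longrightarrow> e\<^sub>D l t * (2 * c + \<beta>) + e\<^sub>N l t \<le> K * wgt (l + 1) t"
    using coefficient_bound[OF t0 l, of "2 * c + \<beta>"] c_nonneg \<beta>_pos by auto
  obtain B where B: "\<And>u v. 0 < u \<Longrightarrow> u \<le> v \<Longrightarrow> integral {u..v} (\<lambda>t. wgt (l + 1) t * N t) \<le> B"
    using int[of "l + 1"] l by auto
  have int_wN: "(\<lambda>t. wgt l' t * N t) integrable_on {u..v}" if "0 < u" for l' u v
    by (rule loc_int_integrable[OF loc_int_continuous[OF continuous_on_mult[OF wgt_continuous(1) contN]] that])
  have \<delta>_le: "integral {t\<^sub>0..b} \<delta> \<le> K * B" if b: "t\<^sub>0 \<le> b" for b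
  proof -
    have "integral {t\<^sub>0..b} \<delta> \<le> integral {t\<^sub>0..b} (\<lambda>t. K * (wgt (l + 1) t * N t))"
    proof (rule integral_le)
      show "\<delta> integrable_on {t\<^sub>0..b}" by (rule loc_int_integrable[OF int\<delta> t0])
      show "(\<lambda>t. K * (wgt (l + 1) t * N t)) integrable_on {t\<^sub>0..b}"
        using integrable_cmul[OF int_wN[OF t0], of K] by simp
      fix t assume "t \<in> {t\<^sub>0..b}"
      then have "(e\<^sub>D l t * (2 * c + \<beta>) + e\<^sub>N l t) * N t \<le> K * wgt (l + 1) t * N t"
        using K(2)[of t] by (intro mult_right_mono) auto
      then show "\<delta> t \<le> K * (wgt (l + 1) t * N t)" by (simp add: \<delta>_def mult.assoc)
    qed
    also have "\<dots> = K * integral {t\<^sub>0..b} (\<lambda>t. wgt (l + 1) t * N t)" by simp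
    also have "\<dots> \<le> K * B" by (intro mult_left_mono B t0 b K(1))
    finally show ?thesis .
  qed
  \<comment> \<open>The lower bound \<open>e\<close> for the energy is one for
    \<open>g + \<delta>\<close> too, so \<open>G\<close> plus the primitive of
    \<open>\<delta>\<close> grows at least at rate \<open>e\<close>, while that primitive gains at
    most \<open>K * B\<close>.\<close>
  have G_ge: "G t\<^sub>0 + e * (b - t\<^sub>0) - K * B \<le> G b" if b: "t\<^sub>0 \<le> b" for b
  proof -
    have "G t\<^sub>0 + primitive \<delta> t\<^sub>0 - e * t\<^sub>0 \<le> G b + primitive \<delta> b - e * b"
    proof (rule wac_mono[OF wac_diff[OF wac_add[OF G Z] lin] _ t0 order_refl b])
      show "AE t in half_line. t\<^sub>0 \<le> t \<longrightarrow> 0 \<le> g t + \<delta> t - e"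
        using energy_le[OF l]
      proof eventually_elim
        case (elim t)
        have "e \<le> energy l t" if "t\<^sub>0 \<le> t"
          unfolding e_def by (rule energy_mono[OF t0 l large order_refl that])
        then show ?case using elim by (auto simp: g_def \<delta>_def)
      qed
    qed
    moreover have "primitive \<delta> b - primitive \<delta> t\<^sub>0 \<le> K * B"
      using primitive_diff[OF int\<delta> t0 b] \<delta>_le[OF b] by simp
    ultimately show ?thesis by (simp add: right_diff_distrib)
  qed
  \<comment> \<open>By this time the growth \<open>e * (b - t\<^sub>0)\<close> has outrun
    \<open>\<bar>G t\<^sub>0\<bar> + \<bar>K * B\<bar>\<close> by a margin of 1.\<close>
  define b where "b = t\<^sub>0 + (\<bar>G t\<^sub>0\<bar> + \<bar>K * B\<bar> + 1) / e"
  have b: "t\<^sub>0 \<le> b" using e by (simp add: b_def)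
  have R_pos: "0 < R t" if t: "b \<le> t" for t
  proof -
    have "e * (b - t\<^sub>0) \<le> e * (t - t\<^sub>0)" using t e by (intro mult_left_mono) auto
    moreover have "e * (b - t\<^sub>0) = \<bar>G t\<^sub>0\<bar> + \<bar>K * B\<bar> + 1" using e by (simp add: b_def)
    ultimately have "0 < G t" using G_ge[of t] t b by linarith
    moreover have "0 < e\<^sub>D l t" using t0 t b l by (simp add: e\<^sub>D_def wgt_def w\<^sub>1_def)
    ultimately show ?thesis by (simp add: G_def zero_less_mult_iff)
  qed
  have b0: "0 < b" using t0 b by simp
  have N_mono: "N b \<le> N t" if "b \<le> t" for t
  proof (rule wac_mono[OF wac_N _ b0 order_refl that])
    have "0 \<le> \<Psi> s \<bullet> \<Phi> s + \<Phi> s \<bullet> \<Psi> s" if "b \<le> s" for s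
      using R_pos[OF that] by (simp add: inner_commute)
    then show "AE t in half_line. b \<le> t \<longrightarrow> 0 \<le> \<Psi> t \<bullet> \<Phi> t + \<Phi> t \<bullet> \<Psi> t" by simp
  qed
  have "\<Phi> b \<noteq> 0" using R_pos[of b] by auto
  then have Nb: "0 < N b" by simp
  obtain B' where B': "\<And>u v. 0 < u \<Longrightarrow> u \<le> v \<Longrightarrow> integral {u..v} (\<lambda>t. wgt 1 t * N t) \<le> B'"
    using int[of 1] by auto
  \<comment> \<open>Long enough that the constant \<open>N b\<close> has integral
    \<open>\<bar>B'\<bar> + 1\<close> over \<open>{b..d}\<close>, more than the bound
    \<open>B'\<close>; as \<open>wgt 1 t \<ge> 1\<close>, the weighted integral exceeds
    \<open>B'\<close> as well.\<close>
  define d where "d = b + (\<bar>B'\<bar> + 1) / N b"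
  have bd: "b \<le> d" using Nb by (simp add: d_def)
  have "\<bar>B'\<bar> + 1 = (d - b) * N b" using Nb by (simp add: d_def)
  also have "\<dots> = integral {b..d} (\<lambda>t. N b)" using bd by simp
  also have "\<dots> \<le> integral {b..d} (\<lambda>t. wgt 1 t * N t)"
  proof (rule integral_le[OF _ int_wN[OF b0]])
    fix t assume "t \<in> {b..d}"
    then have "N b \<le> N t" using N_mono by simp
    also have "\<dots> \<le> wgt 1 t * N t" using mult_right_mono[of 1 "wgt 1 t" "N t"] by (simp add: wgt_def)
    finally show "N b \<le> wgt 1 t * N t" .
  qed (rule integrable_const_ivl)
  also have "\<dots> \<le> B'" by (rule B'[OF b0 bd])
  finally show False by simp
qed

theorem vanishing:
  assumes t0: "0 < t\<^sub>0"
    and int: "\<And>l. 0 < l \<Longrightarrow> \<exists>B. \<forall>u v. 0 < u \<longrightarrow> u \<le> v \<longrightarrow> integral {u..v} (\<lambda>t. wgt l t * N t) \<le> B"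
  shows "\<Phi> t\<^sub>0 = 0"
proof -
  \<comment> \<open>The values of \<open>w\<^sub>1\<close>, \<open>w\<^sub>2\<close>,
    \<open>w\<^sub>3\<close> at \<open>t\<^sub>0\<close>, divided by \<open>l\<close>. As each is
    linear in \<open>l\<close>, the energy at \<open>t\<^sub>0\<close> without its exponential
    factor is a cubic in \<open>l\<close>, and the term \<open>2 w\<^sub>1\<^sup>3\<close> of
    \<open>e\<^sub>N\<close> is the only source of \<open>l\<^sup>3\<close>.\<close>
  define p where "p = 4/3 * t\<^sub>0 powr (1/3)"
  define s where "s = 4/9 * t\<^sub>0 powr (-2/3)"
  define z where "z = -8/27 * t\<^sub>0 powr (-5/3)"
  define L where "L = 1 + t\<^sub>0 powr (-8/3) + \<beta>\<^sup>2"
  have poly: "2 * p ^ 3 * N t\<^sub>0 * l ^ 3 + (2 * p\<^sup>2 * R t\<^sub>0 + p * s * N t\<^sub>0) * l\<^sup>2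
      + (p * D t\<^sub>0 + s * R t\<^sub>0 - z / 2 * N t\<^sub>0) * l \<le> 0" if "L \<le> l" for l
  proof -
    have l: "0 < l" using that
      using powr_ge_zero[of t\<^sub>0 "-8/3"] zero_le_power2[of \<beta>] unfolding L_def by linarith
    have "energy l t\<^sub>0 \<le> 0"
      using carleman_large[OF t0] that by (intro energy_nonpos[OF t0 l _ int]) (auto simp: L_def)
    moreover have "energy l t\<^sub>0 = wgt l t\<^sub>0 * (2 * p ^ 3 * N t\<^sub>0 * l ^ 3 + (2 * p\<^sup>2 * R t\<^sub>0 + p * s * N t\<^sub>0) * l\<^sup>2
      + (p * D t\<^sub>0 + s * R t\<^sub>0 - z / 2 * N t\<^sub>0) * l)"
    proof -
      have "w\<^sub>1 l t\<^sub>0 = l * p" "w\<^sub>2 l t\<^sub>0 = l * s" "w\<^sub>3 l t\<^sub>0 = l * z"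
        by (simp_all add: w\<^sub>1_def w\<^sub>2_def w\<^sub>3_def p_def s_def z_def)
      then show ?thesis
        unfolding energy_def e\<^sub>D_def e\<^sub>R_def e\<^sub>N_def
        by (simp add: field_simps power2_eq_square power3_eq_cube)
    qed
    moreover have "0 < wgt l t\<^sub>0" by (simp add: wgt_def)
    ultimately show ?thesis by (simp add: mult_le_0_iff)
  qed
  have "2 * p ^ 3 * N t\<^sub>0 \<le> 0" by (rule cubic_leading_coeff[OF poly])
  moreover have "0 < p" using t0 by (simp add: p_def)
  ultimately have "N t\<^sub>0 \<le> 0" by (simp add: mult_le_0_iff)
  then have "N t\<^sub>0 = 0" using inner_ge_zero[of "\<Phi> t\<^sub>0"] by linarith
  then show ?thesis by simp
qed

end

section \<open>From the solution space to the energy argument\<close>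

lemma op_app_mem:
  assumes "self_adjoint A" "x \<in> Domain A"
  shows "(x, op_app A x) \<in> A"
  unfolding op_app_def using assms self_adjoint_unique by (metis DomainE theI)

lemma L2_loc_inner_loc_int:
  fixes f :: "real \<Rightarrow> 'a::real_inner"
  assumes "f \<in> L2_loc"
  shows "loc_int (\<lambda>t. f t \<bullet> x)"
proof (rule loc_int_measurable_bounded)
  show "(\<lambda>t. f t \<bullet> x) \<in> borel_measurable half_line"
    using assms by (intro strongly_measurable_inner) (simp add: L2_loc_def)
  show "loc_int (\<lambda>t. norm x * norm (f t))"
    by (intro loc_int_cmult L2_loc_norm_loc_int assms)
  show "\<bar>f t \<bullet> x\<bar> \<le> norm x * norm (f t)" for t
    using Cauchy_Schwarz_ineq2[of "f t" x] by (simp only: mult.commute)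
qed

lemma wac_AE_cong:
  assumes f: "wac f g" and eq: "AE t in half_line. g t = g' t"
    and m: "loc_int m" "\<And>t. 0 < t \<Longrightarrow> norm (g' t) \<le> m t"
  shows "wac f g'"
  unfolding wac_def
proof (intro conjI exI[of _ m] allI impI m)
  fix x and u v :: real assume uv: "0 < u" "u \<le> v"
  have neg: "negligible {t. 0 < t \<and> g t \<noteq> g' t}" using eq by (simp add: AE_half_line_iff)
  show "((\<lambda>t. g' t \<bullet> x) has_integral (f v - f u) \<bullet> x) {u..v}"
    by (rule has_integral_spike[OF neg _ wac_has_integral[OF f uv]]) (use uv in auto)
qed

lemma loc_int_inner:
  fixes g :: "real \<Rightarrow> 'a::real_inner"
  assumes g: "\<And>x. (\<lambda>t. g t \<bullet> x) \<in> borel_measurable half_line"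
    and m: "loc_int m" "\<And>t. 0 < t \<Longrightarrow> norm (g t) \<le> m t" and h: "continuous_on {0<..} h"
  shows "loc_int (\<lambda>t. g t \<bullet> h t)"
proof (rule loc_int_bounded_by)
  show "(\<lambda>t. g t \<bullet> h t) integrable_on {u..v}" if "0 < u" for u v
    by (rule integrable_inner_continuous[OF half_line_measurable_subinterval[OF g that] m h that])
  show "loc_int (\<lambda>t. norm (h t) * m t)"
    by (rule loc_int_continuous_mult[OF m(1) continuous_on_norm[OF h]])
  show "\<bar>g t \<bullet> h t\<bar> \<le> norm (h t) * m t" if "0 < t" for t
    using abs_inner_le[OF m(2)[OF that] order_refl, of "h t"] by (simp only: mult.commute)
qed

text \<open>For \<open>s\<close> in the domain,
  \<open>\<langle>a t, s\<rangle> = \<langle>\<Phi> t, A s\<rangle>\<close> almost everywhere, which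
  is continuous in \<open>t\<close>; density of the domain reaches all \<open>x\<close>.\<close>

lemma operator_measurable:
  fixes A :: "'a::{real_inner,complete_space} oper"
  assumes A: "self_adjoint A" and graph: "AE t in half_line. (\<Phi> t, a t) \<in> A"
    and cont: "continuous_on {0<..} \<Phi>"
  shows "(\<lambda>t. a t \<bullet> x) \<in> borel_measurable half_line"
proof -
  have "x \<in> closure (Domain A)" using A by (simp add: self_adjoint_def densely_defined_operator_def)
  then obtain s where s: "\<And>n. s n \<in> Domain A" "s \<longlonglongrightarrow> x" by (auto simp: closure_sequential)
  show ?thesis
  proof (rule borel_measurable_LIMSEQ_real)
    show "(\<lambda>n. a t \<bullet> s n) \<longlonglongrightarrow> a t \<bullet> x" for t by (intro tendsto_intros s)
    fix n
    obtain z where z: "(s n, z) \<in> A" using s(1)[of n] by blast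
    have "(\<lambda>t. \<Phi> t \<bullet> z) \<in> borel_measurable half_line"
      by (intro continuous_imp_measurable_on_sets_lebesgue continuous_on_inner cont continuous_on_const) simp
    moreover have "AE t in half_line. \<Phi> t \<bullet> z = a t \<bullet> s n"
      using graph by eventually_elim (simp add: symmetric_operatorD[OF self_adjoint_symmetric[OF A] _ z])
    ultimately show "(\<lambda>t. a t \<bullet> s n) \<in> borel_measurable half_line" by (rule half_line_measurable_AE)
  qed
qed

lemma integral_le_nn_integral:
  fixes f :: "real \<Rightarrow> real"
  assumes cont: "continuous_on {0<..} f" and nn: "\<And>t. 0 \<le> f t"
    and fin: "(\<integral>\<^sup>+t\<in>{0<..}. ennreal (f t) \<partial>lebesgue) < \<infinity>" and u: "0 < u"
  shows "integral {u..v} f \<le> enn2real (\<integral>\<^sup>+t\<in>{0<..}. ennreal (f t) \<partial>lebesgue)"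
proof -
  have "f integrable_on {u..v}" by (rule loc_int_integrable[OF loc_int_continuous[OF cont] u])
  then have "(f has_integral integral {u..v} f) {u..v}" by (rule integrable_integral)
  then have "ennreal (integral {u..v} f) = (\<integral>\<^sup>+t\<in>{u..v}. ennreal (f t) \<partial>lebesgue)"
    using nn_integral_has_integral_lebesgue'[of "{u..v}" f] nn by (simp add: nn_integral_completion)
  also have "\<dots> \<le> (\<integral>\<^sup>+t\<in>{0<..}. ennreal (f t) \<partial>lebesgue)"
    by (rule nn_set_integral_set_mono) (use u in auto)
  finally have "ennreal (integral {u..v} f) \<le> (\<integral>\<^sup>+t\<in>{0<..}. ennreal (f t) \<partial>lebesgue)" .
  moreover have "0 \<le> integral {u..v} f"
    by (rule Henstock_Kurzweil_Integration.integral_nonneg[OF \<open>f integrable_on {u..v}\<close>]) (rule nn)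
  ultimately show ?thesis using fin by (metis enn2real_ennreal enn2real_mono infinity_ennreal_def)
qed

theorem theorem1p3:
  fixes A :: "'a::{real_inner, complete_space} oper"
    and \<phi> :: "real \<Rightarrow> 'a"
    and \<beta> :: real
  assumes "self_adjoint A"
    and "lower_semibounded A"
    and "\<phi> \<in> X2_loc A"
    and "\<beta> > 0"
    and "AE t in half_line. norm (weak_deriv 2 \<phi> t - op_app A (\<phi> t)) \<le> \<beta> * norm (\<phi> t)"
    and "\<And>l::real. l > 0 \<Longrightarrow>
           (\<integral>\<^sup>+t\<in>{0<..}. ennreal (exp (2 * l * t powr (4 / 3)) * (norm (\<phi> t))\<^sup>2) \<partial>lebesgue) < \<infinity>"
  shows "AE t in half_line. \<phi> t = 0"
proof -
  note A = assms(1)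
  define W where "W = weak_deriv 2 \<phi>"
  have \<phi>2: "\<phi> \<in> H_loc 2" and "AE t in half_line. \<phi> t \<in> Domain (abs_half_power A 2)"
    using assms(3) by (auto simp: X2_loc_def H_loc_dom_def)
  from this(2) have dom: "AE t in half_line. \<phi> t \<in> Domain A"
    by eventually_elim (rule subsetD[OF Domain_abs_half_power_2[OF A]])
  have L2: "\<phi> \<in> L2_loc" using \<phi>2 by (simp add: H_loc_def)
  have ex: "\<exists>g\<in>L2_loc. has_weak_deriv j \<phi> g" if "j \<in> {1..2}" for j
    using \<phi>2 that unfolding H_loc_def by simp
  obtain g where g: "g \<in> L2_loc" "has_weak_deriv 1 \<phi> g" using ex[of 1] by auto
  obtain g' where "has_weak_deriv 2 \<phi> g'" using ex[of 2] by auto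
  \<comment> \<open>\<open>weak_deriv\<close> is a choice, and existence makes the chosen function a
    genuine weak derivative. Its local integrability is not part of the choice and comes from
    \<open>weak_deriv_loc_int\<close>.\<close>
  then have W: "has_weak_deriv 2 \<phi> W" unfolding W_def weak_deriv_def by (rule someI[of "has_weak_deriv 2 \<phi>"])
  have sm: "strongly_measurable half_line \<phi>" "strongly_measurable half_line g"
    using L2 g by (simp_all add: L2_loc_def)
  obtain \<Phi> where \<Phi>: "wac \<Phi> g" "AE t in half_line. \<phi> t = \<Phi> t"
    by (rule weak_derivative_imp_wac[OF sm(1) L2_loc_inner_loc_int[OF L2] L2_loc_inner_loc_int[OF g(1)]
          L2_loc_norm_loc_int[OF g(1)] order_refl weak_der_inner_1[OF g(2)]])
  obtain \<Psi> where \<Psi>: "wac \<Psi> W" "AE t in half_line. g t = \<Psi> t"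
    by (rule weak_derivative_imp_wac[OF sm(2) L2_loc_inner_loc_int[OF g(1)] weak_deriv_loc_int(2)[OF W]
          weak_deriv_loc_int(1)[OF W] order_refl weak_der_inner_2[OF g(2) W]])
  have cont: "continuous_on {0<..} \<Phi>" "continuous_on {0<..} \<Psi>"
    by (rule wac_continuous[OF \<Phi>(1)], rule wac_continuous[OF \<Psi>(1)])
  \<comment> \<open>The weak derivative \<open>g\<close> agrees almost everywhere with the
    continuous \<open>\<Psi>\<close>, so \<open>\<Phi>\<close> has a continuous derivative;
    \<open>quadratic_form_weak_der\<close> relies on this.\<close>
  have \<Phi>\<Psi>: "wac \<Phi> \<Psi>"
    by (rule wac_AE_cong[OF \<Phi>(1) \<Psi>(2) loc_int_continuous[OF continuous_on_norm[OF cont(2)]] order_refl])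
  \<comment> \<open>Off a null set this is \<open>A \<Phi>\<close>. The fallback \<open>W t\<close>
    makes \<open>W t - a t\<close> vanish at the exceptional times, so that the bound on the
    perturbation holds for every \<open>t\<close> and not just almost everywhere.\<close>
  define a where "a t = (if (\<Phi> t, op_app A (\<Phi> t)) \<in> A \<and> norm (W t - op_app A (\<Phi> t)) \<le> \<beta> * norm (\<Phi> t)
      then op_app A (\<Phi> t) else W t)" for t
  have r_le: "norm (W t - a t) \<le> \<beta> * norm (\<Phi> t)" for t
    using assms(4) by (simp add: a_def)
  have graph: "AE t in half_line. (\<Phi> t, a t) \<in> A"
    using dom \<Phi>(2) assms(5)
  proof eventually_elim
    case (elim t)
    then show ?case using op_app_mem[OF A, of "\<Phi> t"] by (simp add: a_def W_def)
  qed
  define m where "m t = norm (W t) + \<beta> * norm (\<Phi> t)" for t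
  have m: "loc_int m" unfolding m_def[abs_def]
    by (intro loc_int_add weak_deriv_loc_int(1)[OF W] loc_int_cmult loc_int_continuous continuous_on_norm cont(1))
  have a_le: "norm (a t) \<le> m t" for t
    using norm_triangle_ineq4[of "W t" "W t - a t"] r_le[of t] by (simp add: m_def)
  have meas: "(\<lambda>t. a t \<bullet> x) \<in> borel_measurable half_line" for x
    by (rule operator_measurable[OF A graph cont(1)])
  have "weak_der (\<lambda>t. a t \<bullet> \<Phi> t) (\<lambda>t. 2 * (a t \<bullet> \<Psi> t))"
    by (rule quadratic_form_weak_der[OF self_adjoint_symmetric[OF A] graph \<Phi>\<Psi> cont(2)
          half_line_measurable_subinterval[OF meas] m a_le])
  moreover have int: "loc_int (\<lambda>t. 2 * (a t \<bullet> \<Psi> t))"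
    by (intro loc_int_cmult loc_int_inner[OF meas m a_le cont(2)])
  have G: "wac (\<lambda>t. primitive (\<lambda>t. 2 * (a t \<bullet> \<Psi> t)) t + k) (\<lambda>t. 2 * (a t \<bullet> \<Psi> t))" for k
    by (rule wac_realI[OF loc_int_abs[OF int]]) (simp_all add: primitive_has_integral[OF int])
  ultimately obtain k where k: "AE t in half_line. a t \<bullet> \<Phi> t = primitive (\<lambda>t. 2 * (a t \<bullet> \<Psi> t)) t + k"
    using du_bois_reymond[OF loc_int_inner[OF meas m a_le cont(1)] _ G[of 0]] by auto
  obtain c where c: "\<And>x y. (x, y) \<in> A \<Longrightarrow> c * (norm x)\<^sup>2 \<le> y \<bullet> x"
    using assms(2) unfolding lower_semibounded_def by blast
  interpret evolution \<Phi> \<Psi> W a "\<lambda>t. primitive (\<lambda>t. 2 * (a t \<bullet> \<Psi> t)) t + k" \<beta> "\<bar>c\<bar>"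
  proof
    show "AE t in half_line. primitive (\<lambda>t. 2 * (a t \<bullet> \<Psi> t)) t + k = a t \<bullet> \<Phi> t"
      using k by eventually_elim simp
    \<comment> \<open>The lower bound of \<open>A\<close> may have either sign; weakening it to
      \<open>- \<bar>c\<bar>\<close> provides the nonnegative constant of the locale.\<close>
    show "AE t in half_line. - \<bar>c\<bar> * (\<Phi> t \<bullet> \<Phi> t) \<le> a t \<bullet> \<Phi> t"
      using graph
    proof eventually_elim
      case (elim t)
      have "- \<bar>c\<bar> * (\<Phi> t \<bullet> \<Phi> t) \<le> c * (\<Phi> t \<bullet> \<Phi> t)" by (intro mult_right_mono) auto
      also have "\<dots> \<le> a t \<bullet> \<Phi> t" using c[OF elim] by (simp add: power2_norm_eq_inner)
      finally show ?case .
    qed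
  qed (use \<Phi>\<Psi> \<Psi>(1) G r_le assms(4) in auto)
  have "\<Phi> t = 0" if t: "0 < t" for t
  proof (rule vanishing[OF t])
    fix l :: real assume l: "0 < l"
    let ?f = "\<lambda>t. wgt l t * (\<Phi> t \<bullet> \<Phi> t)"
    have "(\<integral>\<^sup>+t\<in>{0<..}. ennreal (?f t) \<partial>lebesgue)
        = (\<integral>\<^sup>+t\<in>{0<..}. ennreal (exp (2 * l * t powr (4 / 3)) * (norm (\<phi> t))\<^sup>2) \<partial>lebesgue)"
    proof (rule nn_integral_cong_AE)
      have "AE t in lebesgue. t \<in> {0<..} \<longrightarrow> \<phi> t = \<Phi> t"
        using \<Phi>(2) by (subst (asm) AE_restrict_space_iff) simp_all
      then show "AE t in lebesgue. ennreal (?f t) * indicator {0<..} t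
          = ennreal (exp (2 * l * t powr (4 / 3)) * (norm (\<phi> t))\<^sup>2) * indicator {0<..} t"
        by eventually_elim (auto simp: wgt_def power2_norm_eq_inner indicator_def)
    qed
    with assms(6)[OF l] have fin: "(\<integral>\<^sup>+t\<in>{0<..}. ennreal (?f t) \<partial>lebesgue) < \<infinity>" by simp
    have "continuous_on {0<..} ?f"
      by (intro continuous_on_mult wgt_continuous(1) continuous_on_inner cont(1))
    from integral_le_nn_integral[OF this _ fin]
    show "\<exists>B. \<forall>u v. 0 < u \<longrightarrow> u \<le> v \<longrightarrow> integral {u..v} ?f \<le> B"
      by (intro exI allI impI) (simp add: wgt_def)
  qed
  then have "{t. 0 < t \<and> \<Phi> t \<noteq> 0} = {}" by blast
  then have "AE t in half_line. \<Phi> t = 0" by (simp only: AE_half_line_iff negligible_empty)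
  with \<Phi>(2) show ?thesis by eventually_elim simp
qed

end
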